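(* Let $V$ be an irreducible unitarizable Harish-Chandra module for $\mathrm{SL}(2,\mathbb R)$. Let $q$ be a unitary norm on $V$, let $S=\mathrm{spec}_K(V)\subset\hat K=\mathbb Z$, and let $(e_n)_{n\in S}$ be an orthonormal basis consisting of $K$-types (i.e. $e_n$ spans $V[n]$ and $q(e_n)=1$). Let $p$ be any isometric $G$-continuous norm on $V$ and let $\epsilon>0$. Then there exists a constant $C_\epsilon>0$ such that $p\le C_\epsilon\,q_{\frac12+\epsilon}$. Moreover, there exists a constant $C>0$ such that $$p(e_n)\le C(1+|n|)^{\frac12}\qquad(n\in S).$$
   Context: $G=\mathrm{SL}(2,\mathbb R)$, $K=\mathrm{SO}(2)$, with Lie algebras $\mathfrak g,\mathfrak k$. A Harish-Chandra module is a $(\mathfrak g,K)$-module that is finitely generated over $\mathcal U(\mathfrak g)$ and has finite $K$-multiplicities. For a norm $p$ on $V$ let $V_p$ be the Banach completion; $p$ is $G$-continuous if there is a continuous representation of $G$ on $V_p$ whose $(\mathfrak g,K)$-module of $K$-finite vectors is $V$; the action is written $g\cdot v$. A $G$-continuous norm $p$ is isometric if $p(g\cdot v)=p(v)$ for all $g\in G,v\in V$. A unitary norm is a $G$-continuous norm induced by a $G$-invariant inner product; $V$ is unitarizable if such a norm exists. $\mathrm{spec}_K(V)$ is the set of $n\in\mathbb Z$ with $V[n]\ne0$; for irreducible $V$ each such $V[n]$ is one-dimensional. Sobolev norms: let $\Delta_K=-Y^2$ for a fixed unit vector $Y\in\mathfrak k$ (with respect to minus a multiple of the Killing form); it acts on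 each $K$-isotypical component $V[n]$ by a scalar. For $s\in\mathbb R$ let $D_s=(1+\Delta_K)^{s/2}$ (acting diagonally on $K$-types) and $q_s(v):=q(D_sv)$. *)

theory Defs
  imports "HOL-Analysis.Analysis"
begin

section \<open>The group SL(2,R) and its Lie algebra\<close>

definition SL2 :: "(real^2^2) set" where
  "SL2 = {g. det g = 1}"

definition SO2 :: "(real^2^2) set" where
  "SO2 = {k. rotation_matrix k}"

definition sl2 :: "(real^2^2) set" where
  "sl2 = {X. trace X = 0}"

definition so2 :: "(real^2^2) set" where
  "so2 = {X. transpose X = - X}"

definition rot :: "real \<Rightarrow> real^2^2" where
  "rot \<theta> = vector [vector [cos \<theta>, - sin \<theta>], vector [sin \<theta>, cos \<theta>]]"

definition lie_bracket :: "real^2^2 \<Rightarrow> real^2^2 \<Rightarrow> real^2^2" where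
  "lie_bracket X Y = X ** Y - Y ** X"

definition Ad :: "real^2^2 \<Rightarrow> real^2^2 \<Rightarrow> real^2^2" where
  "Ad g X = g ** X ** matrix_inv g"

text \<open>The matrix type is not an instance of the algebra class on which \<open>exp\<close> is defined.\<close>

definition mexp :: "real^2^2 \<Rightarrow> real^2^2" where
  "mexp X = (\<Sum>n. (((**) X ^^ n) (mat 1)) /\<^sub>R fact n)"

text \<open>The trace of \<open>ad X \<circ> ad Y\<close> on \<open>sl2\<close>, computed in the basis \<open>H, E, F\<close>; the coordinates of a
  trace-free matrix in this basis are its entries (1,1), (1,2), (2,1).\<close>

definition killing_form :: "real^2^2 \<Rightarrow> real^2^2 \<Rightarrow> real" where
  "killing_form X Y =
     (let H = vector [vector [1, 0], vector [0, -1]];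
          E = vector [vector [0, 1], vector [0, 0]];
          F = vector [vector [0, 0], vector [1, 0]];
          T = (\<lambda>Z. lie_bracket X (lie_bracket Y Z))
      in T H $ 1 $ 1 + T E $ 1 $ 2 + T F $ 2 $ 1)"


section \<open>Harish-Chandra modules\<close>

text \<open>The underlying complex vector space is the whole type \<open>'v\<close>; only the actions of elements of
  \<open>sl2\<close> and of \<open>SO2\<close> are meaningful.\<close>

record 'v gK =
  cscale :: "complex \<Rightarrow> 'v \<Rightarrow> 'v"
  lie_act :: "real^2^2 \<Rightarrow> 'v \<Rightarrow> 'v"
  K_act :: "real^2^2 \<Rightarrow> 'v \<Rightarrow> 'v"

text \<open>The last axiom says that the \<open>K\<close>-orbit map of \<open>v\<close> stays in a finite-dimensional space (the span
  of \<open>B\<close>, with coordinate functions \<open>a b\<close>), is continuous there, and that its differential is the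
  action of the Lie algebra of \<open>K\<close>.\<close>

locale gK_module =
  fixes M :: "'v::ab_group_add gK"
  assumes vector_space: "vector_space (cscale M)"
    and lie_linear: "X \<in> sl2 \<Longrightarrow> Vector_Spaces.linear (cscale M) (cscale M) (lie_act M X)"
    and lie_add: "\<lbrakk>X \<in> sl2; Y \<in> sl2\<rbrakk> \<Longrightarrow> lie_act M (X + Y) v = lie_act M X v + lie_act M Y v"
    and lie_scaleR: "X \<in> sl2 \<Longrightarrow> lie_act M (r *\<^sub>R X) v = cscale M (complex_of_real r) (lie_act M X v)"
    and lie_bracket: "\<lbrakk>X \<in> sl2; Y \<in> sl2\<rbrakk> \<Longrightarrow>
          lie_act M (lie_bracket X Y) v = lie_act M X (lie_act M Y v) - lie_act M Y (lie_act M X v)"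
    and K_linear: "k \<in> SO2 \<Longrightarrow> Vector_Spaces.linear (cscale M) (cscale M) (K_act M k)"
    and K_one: "K_act M (mat 1) v = v"
    and K_mult: "\<lbrakk>k \<in> SO2; l \<in> SO2\<rbrakk> \<Longrightarrow> K_act M (k ** l) v = K_act M k (K_act M l v)"
    and K_Ad: "\<lbrakk>k \<in> SO2; X \<in> sl2\<rbrakk> \<Longrightarrow> K_act M k (lie_act M X v) = lie_act M (Ad k X) (K_act M k v)"
    and K_finite_differential: "\<exists>B a.
          finite B \<and> \<not> module.dependent (cscale M) B \<and>
          (\<forall>k\<in>SO2. K_act M k v = (\<Sum>b\<in>B. cscale M (a b k) b)) \<and>
          (\<forall>b\<in>B. continuous_on SO2 (a b)) \<and>
          (\<forall>X\<in>so2. \<exists>d. lie_act M X v = (\<Sum>b\<in>B. cscale M (d b) b) \<and>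
             (\<forall>b\<in>B. ((\<lambda>t. a b (mexp (t *\<^sub>R X))) has_vector_derivative d b) (at 0)))"

definition K_type :: "'v::ab_group_add gK \<Rightarrow> int \<Rightarrow> 'v set" where
  "K_type M n = {v. \<forall>\<theta>. K_act M (rot \<theta>) v = cscale M (cis (of_int n * \<theta>)) v}"

definition spec_K :: "'v::ab_group_add gK \<Rightarrow> int set" where
  "spec_K M = {n. K_type M n \<noteq> {0}}"

text \<open>The \<open>U(g)\<close>-submodule generated by \<open>F\<close>: as \<open>U(g)\<close> is spanned by monomials in elements of \<open>g\<close>,
  it is the span of all \<open>X\<^sub>1 (X\<^sub>2 (\<dots> (X\<^sub>m v)))\<close> with \<open>v \<in> F\<close>.\<close>

definition Ug_span :: "'v::ab_group_add gK \<Rightarrow> 'v set \<Rightarrow> 'v set" where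
  "Ug_span M F = module.span (cscale M) {foldr (lie_act M) Xs v | Xs v. set Xs \<subseteq> sl2 \<and> v \<in> F}"

locale harish_chandra_module = gK_module +
  assumes finitely_generated: "\<exists>F. finite F \<and> Ug_span M F = UNIV"
    and finite_multiplicities: "\<exists>B. finite B \<and> K_type M n \<subseteq> module.span (cscale M) B"

definition gK_irreducible :: "'v::ab_group_add gK \<Rightarrow> bool" where
  "gK_irreducible M \<longleftrightarrow> (UNIV :: 'v set) \<noteq> {0} \<and>
     (\<forall>W. module.subspace (cscale M) W \<and> (\<forall>X\<in>sl2. lie_act M X ` W \<subseteq> W) \<and>
          (\<forall>k\<in>SO2. K_act M k ` W \<subseteq> W) \<longrightarrow> W = {0} \<or> W = UNIV)"


section \<open>Norms and Banach completions\<close>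

definition is_norm :: "'v::ab_group_add gK \<Rightarrow> ('v \<Rightarrow> real) \<Rightarrow> bool" where
  "is_norm M p \<longleftrightarrow> (\<forall>v. 0 \<le> p v) \<and> (\<forall>v. p v = 0 \<longleftrightarrow> v = 0) \<and>
     (\<forall>v w. p (v + w) \<le> p v + p w) \<and> (\<forall>c v. p (cscale M c v) = cmod c * p v)"

text \<open>The Banach completion for a norm \<open>p\<close> consists of the classes of \<open>p\<close>-Cauchy sequences modulo
  sequences tending to 0. The operations below are independent of representatives if \<open>p\<close> is a norm.\<close>

definition p_Cauchy :: "('v::ab_group_add \<Rightarrow> real) \<Rightarrow> (nat \<Rightarrow> 'v) set" where
  "p_Cauchy p = {f. \<forall>e>0. \<exists>N. \<forall>m\<ge>N. \<forall>n\<ge>N. p (f m - f n) < e}"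

definition compl_rel :: "('v::ab_group_add \<Rightarrow> real) \<Rightarrow> ((nat \<Rightarrow> 'v) \<times> (nat \<Rightarrow> 'v)) set" where
  "compl_rel p = {(f, g). f \<in> p_Cauchy p \<and> g \<in> p_Cauchy p \<and> (\<lambda>n. p (f n - g n)) \<longlonglongrightarrow> 0}"

definition banach_completion :: "('v::ab_group_add \<Rightarrow> real) \<Rightarrow> (nat \<Rightarrow> 'v) set set" where
  "banach_completion p = p_Cauchy p // compl_rel p"

definition to_completion :: "('v::ab_group_add \<Rightarrow> real) \<Rightarrow> 'v \<Rightarrow> (nat \<Rightarrow> 'v) set" where
  "to_completion p v = compl_rel p `` {\<lambda>_. v}"

definition compl_add ::
    "('v::ab_group_add \<Rightarrow> real) \<Rightarrow> (nat \<Rightarrow> 'v) set \<Rightarrow> (nat \<Rightarrow> 'v) set \<Rightarrow> (nat \<Rightarrow> 'v) set" where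
  "compl_add p x y = (\<Union>f\<in>x. \<Union>g\<in>y. compl_rel p `` {\<lambda>n. f n + g n})"

definition compl_scale ::
    "'v::ab_group_add gK \<Rightarrow> ('v \<Rightarrow> real) \<Rightarrow> complex \<Rightarrow> (nat \<Rightarrow> 'v) set \<Rightarrow> (nat \<Rightarrow> 'v) set" where
  "compl_scale M p c x = (\<Union>f\<in>x. compl_rel p `` {\<lambda>n. cscale M c (f n)})"

text \<open>The value 0 outside the carrier is needed because \<open>Metric_space\<close> requires symmetry and
  nonnegativity of the distance everywhere.\<close>

definition compl_dist ::
    "('v::ab_group_add \<Rightarrow> real) \<Rightarrow> (nat \<Rightarrow> 'v) set \<Rightarrow> (nat \<Rightarrow> 'v) set \<Rightarrow> real" where
  "compl_dist p x y =
     (if x \<in> banach_completion p \<and> y \<in> banach_completion p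
      then (THE r. \<forall>f\<in>x. \<forall>g\<in>y. (\<lambda>n. p (f n - g n)) \<longlonglongrightarrow> r) else 0)"

definition compl_norm :: "('v::ab_group_add \<Rightarrow> real) \<Rightarrow> (nat \<Rightarrow> 'v) set \<Rightarrow> real" where
  "compl_norm p x = (THE r. \<forall>f\<in>x. (\<lambda>n. p (f n)) \<longlonglongrightarrow> r)"

definition compl_topology :: "('v::ab_group_add \<Rightarrow> real) \<Rightarrow> (nat \<Rightarrow> 'v) set topology" where
  "compl_topology p = Metric_space.mtopology (banach_completion p) (compl_dist p)"

definition compl_subspace ::
    "'v::ab_group_add gK \<Rightarrow> ('v \<Rightarrow> real) \<Rightarrow> (nat \<Rightarrow> 'v) set set \<Rightarrow> bool" where
  "compl_subspace M p U \<longleftrightarrow> U \<subseteq> banach_completion p \<and> to_completion p 0 \<in> U \<and>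
     (\<forall>x\<in>U. \<forall>y\<in>U. compl_add p x y \<in> U) \<and> (\<forall>c. \<forall>x\<in>U. compl_scale M p c x \<in> U)"

definition compl_span ::
    "'v::ab_group_add gK \<Rightarrow> ('v \<Rightarrow> real) \<Rightarrow> (nat \<Rightarrow> 'v) set set \<Rightarrow> (nat \<Rightarrow> 'v) set set" where
  "compl_span M p B = \<Inter>{U. compl_subspace M p U \<and> B \<subseteq> U}"


section \<open>Globalizations and G-continuous norms\<close>

definition continuous_rep :: "'v::ab_group_add gK \<Rightarrow> ('v \<Rightarrow> real) \<Rightarrow>
    (real^2^2 \<Rightarrow> (nat \<Rightarrow> 'v) set \<Rightarrow> (nat \<Rightarrow> 'v) set) \<Rightarrow> bool" where
  "continuous_rep M p \<pi> \<longleftrightarrow>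
     (\<forall>g\<in>SL2. \<forall>x\<in>banach_completion p. \<pi> g x \<in> banach_completion p) \<and>
     (\<forall>g\<in>SL2. \<forall>x\<in>banach_completion p. \<forall>y\<in>banach_completion p.
        \<pi> g (compl_add p x y) = compl_add p (\<pi> g x) (\<pi> g y)) \<and>
     (\<forall>g\<in>SL2. \<forall>c. \<forall>x\<in>banach_completion p.
        \<pi> g (compl_scale M p c x) = compl_scale M p c (\<pi> g x)) \<and>
     (\<forall>x\<in>banach_completion p. \<pi> (mat 1) x = x) \<and>
     (\<forall>g\<in>SL2. \<forall>h\<in>SL2. \<forall>x\<in>banach_completion p. \<pi> (g ** h) x = \<pi> g (\<pi> h x)) \<and>
     continuous_map (prod_topology (top_of_set SL2) (compl_topology p)) (compl_topology p)
       (\<lambda>(g, x). \<pi> g x)"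

definition K_finite_vectors :: "'v::ab_group_add gK \<Rightarrow> ('v \<Rightarrow> real) \<Rightarrow>
    (real^2^2 \<Rightarrow> (nat \<Rightarrow> 'v) set \<Rightarrow> (nat \<Rightarrow> 'v) set) \<Rightarrow> (nat \<Rightarrow> 'v) set set" where
  "K_finite_vectors M p \<pi> = {x \<in> banach_completion p.
     \<exists>B. finite B \<and> B \<subseteq> banach_completion p \<and> (\<forall>k\<in>SO2. \<pi> k x \<in> compl_span M p B)}"

text \<open>\<open>\<pi>\<close> is a continuous representation on the completion whose K-finite vectors are exactly the
  elements of \<open>V\<close>, such that the \<open>K\<close>-action and the derived Lie algebra action on them are those of
  the module \<open>V\<close>.\<close>

definition globalization :: "'v::ab_group_add gK \<Rightarrow> ('v \<Rightarrow> real) \<Rightarrow>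
    (real^2^2 \<Rightarrow> (nat \<Rightarrow> 'v) set \<Rightarrow> (nat \<Rightarrow> 'v) set) \<Rightarrow> bool" where
  "globalization M p \<pi> \<longleftrightarrow>
     continuous_rep M p \<pi> \<and>
     K_finite_vectors M p \<pi> = range (to_completion p) \<and>
     (\<forall>k\<in>SO2. \<forall>v. \<pi> k (to_completion p v) = to_completion p (K_act M k v)) \<and>
     (\<forall>X\<in>sl2. \<forall>v. limitin (compl_topology p)
        (\<lambda>t. compl_scale M p (complex_of_real (1 / t))
                (compl_add p (\<pi> (mexp (t *\<^sub>R X)) (to_completion p v)) (to_completion p (- v))))
        (to_completion p (lie_act M X v)) (at 0))"

definition G_continuous_norm :: "'v::ab_group_add gK \<Rightarrow> ('v \<Rightarrow> real) \<Rightarrow> bool" where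
  "G_continuous_norm M p \<longleftrightarrow> is_norm M p \<and> (\<exists>\<pi>. globalization M p \<pi>)"

text \<open>Below, \<open>g \<cdot> v\<close> is an element of the completion, so the norm and the inner
  product have to be taken on the completion.\<close>

definition isometric_G_continuous_norm :: "'v::ab_group_add gK \<Rightarrow> ('v \<Rightarrow> real) \<Rightarrow> bool" where
  "isometric_G_continuous_norm M p \<longleftrightarrow> G_continuous_norm M p \<and>
     (\<exists>\<pi>. globalization M p \<pi> \<and> (\<forall>g\<in>SL2. \<forall>v. compl_norm p (\<pi> g (to_completion p v)) = p v))"

definition inducing_inner_product :: "'v::ab_group_add gK \<Rightarrow> ('v \<Rightarrow> real) \<Rightarrow>
    ((nat \<Rightarrow> 'v) set \<Rightarrow> (nat \<Rightarrow> 'v) set \<Rightarrow> complex) \<Rightarrow> bool" where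
  "inducing_inner_product M q h \<longleftrightarrow>
     (\<forall>x\<in>banach_completion q. \<forall>y\<in>banach_completion q. \<forall>z\<in>banach_completion q.
        h (compl_add q x y) z = h x z + h y z) \<and>
     (\<forall>c. \<forall>x\<in>banach_completion q. \<forall>y\<in>banach_completion q.
        h (compl_scale M q c x) y = c * h x y) \<and>
     (\<forall>x\<in>banach_completion q. \<forall>y\<in>banach_completion q. h y x = cnj (h x y)) \<and>
     (\<forall>x\<in>banach_completion q. h x x = complex_of_real ((compl_norm q x)\<^sup>2))"

definition unitary_norm :: "'v::ab_group_add gK \<Rightarrow> ('v \<Rightarrow> real) \<Rightarrow> bool" where
  "unitary_norm M q \<longleftrightarrow> G_continuous_norm M q \<and>
     (\<exists>\<pi> h. globalization M q \<pi> \<and> inducing_inner_product M q h \<and>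
        (\<forall>g\<in>SL2. \<forall>x\<in>banach_completion q. \<forall>y\<in>banach_completion q.
           h (\<pi> g x) (\<pi> g y) = h x y))"

definition unitarizable :: "'v::ab_group_add gK \<Rightarrow> bool" where
  "unitarizable M \<longleftrightarrow> (\<exists>q. unitary_norm M q)"


section \<open>Sobolev norms\<close>

text \<open>\<open>sobolev_op M Y s\<close> is the operator \<open>(1 + \<Delta>)\<^bsup>s/2\<^esup>\<close> with \<open>\<Delta> = - Y\<^sup>2\<close>, i.e. the linear operator
  acting on a \<open>K\<close>-type by \<open>(1 + r)\<^bsup>s/2\<^esup>\<close> if \<open>\<Delta>\<close> acts on it by \<open>r\<close>. It is determined by this, as
  \<open>V\<close> is the direct sum of its \<open>K\<close>-types.\<close>

definition sobolev_op :: "'v::ab_group_add gK \<Rightarrow> real^2^2 \<Rightarrow> real \<Rightarrow> 'v \<Rightarrow> 'v" where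
  "sobolev_op M Y s = (THE D. Vector_Spaces.linear (cscale M) (cscale M) D \<and>
     (\<forall>n. \<forall>v\<in>K_type M n. \<forall>r::real.
        - lie_act M Y (lie_act M Y v) = cscale M (complex_of_real r) v \<longrightarrow>
        D v = cscale M (complex_of_real ((1 + r) powr (s / 2))) v))"

definition sobolev_norm ::
    "'v::ab_group_add gK \<Rightarrow> real^2^2 \<Rightarrow> ('v \<Rightarrow> real) \<Rightarrow> real \<Rightarrow> 'v \<Rightarrow> real" where
  "sobolev_norm M Y q s v = q (sobolev_op M Y s v)"

end

theory Submission
  imports Defs "HOL-Real_Asymp.Real_Asymp" "HOL-Computational_Algebra.Fundamental_Theorem_Algebra"
begin

text \<open>Let \<open>x = \<pi>(g) e\<^sub>l\<close>, an element of the completion for \<open>p\<close> of norm \<open>p e\<^sub>l\<close>, with Fourier coefficients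
  \<open>f\<^sub>n(g)\<close> along \<open>K\<close>. Convolving \<open>x\<close> over \<open>K\<close> with a trigonometric polynomial with coefficients \<open>v\<^sub>n / f\<^sub>n(g)\<close>
  produces \<open>\<Sum> v\<^sub>n e\<^sub>n\<close>, so \<open>p\<close> of this sum is at most \<open>p e\<^sub>l\<close> times the \<open>L\<^sup>2\<close> norm of \<open>v\<^sub>n / f\<^sub>n(g)\<close>. It
  remains to find, for every \<open>N\<close>, a single \<open>g = diag(e\<^sup>T, e\<^sup>-\<^sup>T)\<close> with \<open>|f\<^sub>n(g)| \<ge> c N\<^sup>-\<^sup>1\<^sup>/\<^sup>2\<close> for all \<open>n\<close> with
  \<open>|n - l| / 2 + 1\<close> in \<open>[N, 2N)\<close>: this bounds \<open>p\<close> by \<open>C N\<^sup>1\<^sup>/\<^sup>2 q\<close> on such a block, and the sum over dyadic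
  blocks converges geometrically against the weights of \<open>q\<close> with Sobolev index \<open>1/2 + \<epsilon>\<close>.

  For fixed \<open>n\<close>, equivariance under \<open>K\<close> on the left and the Lie algebra action on the right give a closed
  \<open>2 \<times> 2\<close> system of differential equations in \<open>t\<close> for the coefficients of \<open>e\<^sub>l\<close> and of its image under the
  ladder operator pointing away from \<open>n\<close>. It is a small perturbation of a triangular system as long as
  \<open>(sinh t)\<^sup>2\<close> is at most a small multiple of \<open>|n - l|\<close>, which yields the lower bound with \<open>(sinh T)\<^sup>2\<close>
  proportional to \<open>N\<close>; the leading coefficient at \<open>t = 0\<close> is a product of matrix entries of the ladder
  operators, whose growth follows from unitarity and the commutation relations.\<close>

section \<open>Two analytic estimates\<close>

text \<open>About \<open>p\<close> only invariance is known; its completion carries no inner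
  product. Invariance under \<open>K\<close> alone makes averaging with weights controllable, so the
  coordinates are \<open>p\<close>-continuous and extend to the completion. The final constants then
  depend on \<open>p\<close> only through the number \<open>p e_l\<close>. Why
  \<open>N^(-1/2)\<close>: for \<open>p = q\<close> the squares \<open>|f_n(g)|^2\<close> sum to 1
  and a block holds up to \<open>N\<close> types, so no better uniform lower bound can be expected.
  Why \<open>(sinh T)^2\<close> of order \<open>N\<close>: the solution of the triangular system
  contains \<open>tanh T ^ m\<close> with \<open>m\<close> of order \<open>N\<close>. This stays
  bounded below only if \<open>(sinh T)^2\<close> is at least of order \<open>N\<close>, while
  smallness of the perturbation asks for at most that order. The system closes because each
  \<open>K\<close>-type is a line: going one step away from \<open>n\<close> and back multiplies
  \<open>e_l\<close> by a scalar. The perturbation estimate needs a sign, which holds when the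
  growth exponent is at most 2. A type \<open>l\<close> of least absolute value provides this in
  each direction, unless the vector on the far side vanishes and the system is triangular from the
  start.\<close>

lemma one_minus_tanh_square: "1 - (tanh t)\<^sup>2 = 1 / (cosh t)\<^sup>2" for t :: real
proof -
  have "(cosh t)\<^sup>2 > 0" by simp
  thus ?thesis using hyperbolic_pythagoras[of t]
    by (simp add: tanh_def power_divide divide_simps del: zero_less_power2)
qed

lemma one_minus_tanh_square': "t > 0 \<Longrightarrow> 1 - (tanh t)\<^sup>2 = tanh t / (sinh t * cosh t)" for t :: real
  unfolding one_minus_tanh_square by (simp add: tanh_def power2_eq_square)

text \<open>The derivative is stated as logarithmic derivative times function, the shape of the
  coefficients in the linear system below, so that these functions serve as integrating
  factors.\<close>

lemma DERIV_tanh_power_cosh_powr: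
  fixes t a :: real
  assumes "t > 0"
  shows "((\<lambda>t. tanh t ^ k * cosh t powr a) has_real_derivative
    (k / (sinh t * cosh t) + a * tanh t) * (tanh t ^ k * cosh t powr a)) (at t)"
proof -
  have D: "((\<lambda>t. tanh t ^ k * cosh t powr a) has_real_derivative
      k * tanh t ^ (k - 1) * (1 - tanh t ^ 2) * cosh t powr a + tanh t ^ k * (a * cosh t powr (a - 1) * sinh t)) (at t)"
    by (rule derivative_eq_intros refl | simp)+
  have 1: "k * tanh t ^ (k - 1) * (1 - tanh t ^ 2) = k / (sinh t * cosh t) * tanh t ^ k"
    using assms by (cases k) (auto simp: one_minus_tanh_square')
  have 2: "a * cosh t powr (a - 1) * sinh t = a * tanh t * cosh t powr a"
    by (simp add: powr_diff tanh_def)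
  show ?thesis by (rule DERIV_cong[OF D]) (simp only: 1 2, simp add: algebra_simps)
qed

text \<open>For \<open>\<kappa> = 0\<close> the system is triangular, with solutions \<open>f = B \<phi>\<close> (\<open>\<phi>\<close> as in the proof). Integrating
  twice, \<open>\<kappa>\<close> changes \<open>f / \<phi>\<close> on \<open>[0, T]\<close> by at most a third of its supremum.\<close>

lemma singular_system_lower_bound:
  fixes f y :: "real \<Rightarrow> complex" and m :: nat and L T :: real and \<kappa> B :: complex
  assumes f': "\<And>t. t > 0 \<Longrightarrow> (f has_vector_derivative
      (of_real (m / (sinh t * cosh t) - L * tanh t) * f t + 2 * y t)) (at t)"
    and y': "\<And>t. t > 0 \<Longrightarrow> (y has_vector_derivative
      (2 * \<kappa> * f t - of_real ((m + 1) / (sinh t * cosh t) - (L - 2) * tanh t) * y t)) (at t)"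
    and y0: "isCont y 0"
    and f0: "((\<lambda>t. f t / of_real t ^ m) \<longlongrightarrow> B) (at_right 0)"
    and L: "L \<le> 2 \<or> \<kappa> = 0"
    and T: "T > 0" "3 * cmod \<kappa> * (sinh T)\<^sup>2 \<le> m + 1"
  shows "cmod B / 2 * tanh T ^ m * cosh T powr (- L) \<le> cmod (f T)"
proof -
  \<comment> \<open>\<open>\<phi>\<close> and \<open>1 / \<psi>\<close> solve the two homogeneous
    equations, so the derivative of \<open>w = f / \<phi>\<close> involves only \<open>y\<close> and
    that of \<open>u = \<psi> * y\<close> only \<open>f\<close>. As \<open>\<phi> t\<close> behaves
    like \<open>t ^ m\<close> at 0, the value \<open>B\<close> makes \<open>w\<close> continuous
    there.\<close>
  define \<phi> where "\<phi> t = tanh t ^ m * cosh t powr (- L)" for t :: real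
  define \<psi> where "\<psi> t = tanh t ^ (m + 1) * cosh t powr (2 - L)" for t :: real
  define w where "w t = (if t = 0 then B else f t / of_real (\<phi> t))" for t
  define u where "u t = of_real (\<psi> t) * y t" for t
  have \<phi>_pos: "\<phi> t > 0" and \<psi>_pos: "\<psi> t > 0" if "t > 0" for t
    using that by (auto simp: \<phi>_def \<psi>_def)
  have d\<phi>: "(\<phi> has_real_derivative (m / (sinh t * cosh t) - L * tanh t) * \<phi> t) (at t)" if "t > 0" for t
    using DERIV_tanh_power_cosh_powr[OF that, of m "- L"] by (simp add: \<phi>_def [abs_def])
  have d\<psi>: "(\<psi> has_real_derivative ((m + 1) / (sinh t * cosh t) - (L - 2) * tanh t) * \<psi> t) (at t)" if "t > 0" for t
    using DERIV_tanh_power_cosh_powr[OF that, of "m + 1" "2 - L"] by (simp add: \<psi>_def [abs_def] algebra_simps)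
  have dw: "(w has_vector_derivative (2 * y t / of_real (\<phi> t))) (at t)" if "t > 0" for t
  proof -
    have 1: "((\<lambda>t. of_real (1 / \<phi> t) * f t) has_vector_derivative (2 * y t / of_real (\<phi> t))) (at t)"
    proof -
      have d1: "((\<lambda>t. 1 / \<phi> t) has_real_derivative - (m / (sinh t * cosh t) - L * tanh t) / \<phi> t) (at t)"
        using \<phi>_pos[OF that] by (auto intro!: derivative_eq_intros d\<phi> that simp: field_simps)
      have d2: "((\<lambda>t. of_real (1 / \<phi> t) :: complex) has_vector_derivative of_real (- (m / (sinh t * cosh t) - L * tanh t) / \<phi> t)) (at t)"
        by (rule has_vector_derivative_of_real[OF d1])
      show ?thesis
        using has_vector_derivative_mult[OF d2 f'[OF that]] \<phi>_pos[OF that]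
        by (elim has_vector_derivative_eq_rhs) (simp add: algebra_simps divide_simps)
    qed
    show ?thesis
      by (rule has_vector_derivative_transform_within_open[OF 1, of "{0<..}"])
        (use that in \<open>auto simp: w_def\<close>)
  qed
  have du: "(u has_vector_derivative (2 * \<kappa> * f t * of_real (\<psi> t))) (at t)" if "t > 0" for t
  proof -
    have d2: "((\<lambda>t. of_real (\<psi> t) :: complex) has_vector_derivative of_real (((m + 1) / (sinh t * cosh t) - (L - 2) * tanh t) * \<psi> t)) (at t)"
      by (rule has_vector_derivative_of_real[OF d\<psi>[OF that]])
    show ?thesis
      unfolding u_def using has_vector_derivative_mult[OF d2 y'[OF that]]
      by (elim has_vector_derivative_eq_rhs) (simp add: algebra_simps)
  qed
  have w0: "(w \<longlongrightarrow> B) (at_right 0)"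
  proof -
    have "((\<lambda>t::real. t / sinh t * cosh t) \<longlongrightarrow> 1) (at_right 0)"
      by real_asymp
    hence "((\<lambda>t::real. (t / sinh t * cosh t) ^ m) \<longlongrightarrow> 1 ^ m) (at_right 0)"
      by (rule tendsto_power)
    moreover have "((\<lambda>t::real. cosh t powr L) \<longlongrightarrow> cosh 0 powr L) (at_right 0)"
      by (intro tendsto_intros) auto
    ultimately have "((\<lambda>t::real. (t / sinh t * cosh t) ^ m * cosh t powr L) \<longlongrightarrow> 1 ^ m * cosh 0 powr L) (at_right 0)"
      by (rule tendsto_mult)
    hence "((\<lambda>t. f t / of_real t ^ m * of_real ((t / sinh t * cosh t) ^ m * cosh t powr L)) \<longlongrightarrow> B * of_real (1 ^ m * cosh 0 powr L)) (at_right 0)"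
      by (rule tendsto_mult[OF f0 tendsto_of_real])
    moreover have "\<forall>\<^sub>F t in at_right 0. f t / of_real t ^ m * of_real ((t / sinh t * cosh t) ^ m * cosh t powr L) = w t"
    proof -
      have "\<forall>\<^sub>F t in at_right (0::real). t > 0" by (simp add: eventually_at_right_less)
      thus ?thesis
        by eventually_elim (auto simp: w_def \<phi>_def tanh_def powr_minus power_divide power_mult_distrib field_simps)
    qed
    ultimately show ?thesis by (auto intro: Lim_transform_eventually)
  qed
  have cw: "continuous_on {0..T} w"
  proof (rule continuous_on_IccI)
    show "(w \<longlongrightarrow> w 0) (at_right 0)" using w0 by (simp add: w_def)
    show "(w \<longlongrightarrow> w T) (at_left T)"
      using has_vector_derivative_continuous[OF dw[OF T(1)]]
      by (simp add: continuous_at filterlim_at_split)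
  next
    fix t assume "0 < t" "t < T"
    thus "w \<midarrow>t\<rightarrow> w t" using has_vector_derivative_continuous[OF dw[of t]]
      by (simp add: continuous_at)
  qed (use T in auto)
  have cu: "continuous_on {0..T} u"
  proof -
    have "isCont y t" if "t \<ge> 0" for t
      using that y0 has_vector_derivative_continuous[OF y'[of t]] by (cases "t = 0") auto
    hence "continuous_on {0..T} y" by (auto intro!: continuous_at_imp_continuous_on)
    moreover have "continuous_on {0..T} \<psi>"
      unfolding \<psi>_def by (auto intro!: continuous_intros)
    ultimately show ?thesis unfolding u_def by (intro continuous_intros)
  qed
  obtain \<xi> where \<xi>: "\<xi> \<in> {0..T}" "\<And>t. t \<in> {0..T} \<Longrightarrow> cmod (w t) \<le> cmod (w \<xi>)"
    using continuous_attains_sup[of "{0..T}" "\<lambda>t. cmod (w t)"] T cw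
    by (force intro: continuous_intros)
  define S where "S = cmod (w \<xi>)"
  \<comment> \<open>A majorant of \<open>u\<close>: differentiating the power of \<open>tanh\<close>
    gives at least the bound \<open>2 * cmod \<kappa> * S * \<phi> * \<psi>\<close> for the
    derivative of \<open>u\<close>. What is left over carries the factor \<open>4 - 2 * L\<close>,
    which is nonnegative unless \<open>\<kappa> = 0\<close>, in which case \<open>G\<close>
    vanishes.\<close>
  define G where "G t = 2 * cmod \<kappa> * S / (2 * m + 2) * (tanh t ^ (2 * m + 2) * cosh t powr (4 - 2 * L))" for t
  have S0: "S \<ge> 0" by (simp add: S_def)
  have uG: "cmod (u t) \<le> G t" if t: "0 < t" "t \<le> T" for t
  proof -
    define G' where "G' t = 2 * cmod \<kappa> * S / (2 * m + 2) *
        (((2 * m + 2) / (sinh t * cosh t) + (4 - 2 * L) * tanh t) * (tanh t ^ (2 * m + 2) * cosh t powr (4 - 2 * L)))" for t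
    have dG: "(G has_real_derivative G' t) (at t)" if "t > 0" for t
      unfolding G_def [abs_def] G'_def by (rule DERIV_cmult[OF DERIV_tanh_power_cosh_powr[OF that]])
    have G'_ge: "2 * cmod \<kappa> * S * (tanh t ^ (2 * m + 1) * cosh t powr (2 - 2 * L)) \<le> G' t" if "t > 0" for t
    proof -
      define z where "z = tanh t ^ (2 * m + 1) * cosh t powr (2 - 2 * L)"
      have "cosh t powr (4 - 2 * L) = cosh t powr 2 * cosh t powr (2 - 2 * L)"
        by (subst powr_add[symmetric]) simp
      hence z: "tanh t ^ (2 * m + 2) * cosh t powr (4 - 2 * L) = sinh t * cosh t * z"
        by (simp add: z_def powr_numeral power2_eq_square) (simp add: tanh_def)
      have "2 * cmod \<kappa> * S * z \<le> 2 * cmod \<kappa> * S * z + 2 * cmod \<kappa> * S / (2 * m + 2) * ((4 - 2 * L) * tanh t * (sinh t * cosh t * z))"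
      proof (cases "\<kappa> = 0")
        case False
        then show ?thesis using L that S0 by (simp add: z_def)
      qed simp
      also have "\<dots> = G' t"
      proof -
        have "sinh t * cosh t \<noteq> 0" "real (2 * m + 2) \<noteq> 0" using that by simp_all
        moreover have "x * z + x / k * (a * (y * z)) = x / k * ((k / y + a) * (y * z))" if "y \<noteq> 0" "k \<noteq> 0" for x k a y :: real
          using that by (simp add: field_simps)
        ultimately show ?thesis unfolding G'_def z by blast
      qed
      finally show ?thesis by (simp add: z_def)
    qed
    have "norm (u t - u 0) \<le> G t - G 0"
    proof (rule differentiable_bound_general[where a = 0 and b = t])
      show "continuous_on {0..t} u" using cu t by (auto intro: continuous_on_subset)
      show "continuous_on {0..t} G" unfolding G_def by (auto intro!: continuous_intros)
      fix x assume x: "0 < x" "x < t"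
      show "(u has_vector_derivative (2 * \<kappa> * f x * of_real (\<psi> x))) (at x)" using du x by auto
      show "(G has_vector_derivative G' x) (at x)"
        by (rule dG[OF x(1), unfolded has_real_derivative_iff_has_vector_derivative])
      have "\<phi> x * \<psi> x = tanh x ^ (2 * m + 1) * cosh x powr (2 - 2 * L)"
      proof -
        have "tanh x ^ m * tanh x ^ (m + 1) = tanh x ^ (2 * m + 1)"
          by (simp add: mult_2 power_add)
        moreover have "cosh x powr (- L) * cosh x powr (2 - L) = cosh x powr (2 - 2 * L)"
          by (subst powr_add[symmetric]) simp
        moreover have "\<phi> x * \<psi> x = (tanh x ^ m * tanh x ^ (m + 1)) * (cosh x powr (- L) * cosh x powr (2 - L))"
          by (simp add: \<phi>_def \<psi>_def)
        ultimately show ?thesis by simp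
      qed
      moreover have "cmod (f x) = cmod (w x) * \<phi> x"
        using x \<phi>_pos[of x] by (simp add: w_def norm_divide)
      ultimately have "norm (2 * \<kappa> * f x * of_real (\<psi> x)) = 2 * cmod \<kappa> * cmod (w x) * (tanh x ^ (2 * m + 1) * cosh x powr (2 - 2 * L))"
        using x \<psi>_pos[of x] by (simp add: norm_mult mult.assoc)
      also have "\<dots> \<le> 2 * cmod \<kappa> * S * (tanh x ^ (2 * m + 1) * cosh x powr (2 - 2 * L))"
        using \<xi>(2)[of x] x t by (intro mult_right_mono mult_left_mono) (auto simp: S_def)
      also have "\<dots> \<le> G' x" by (rule G'_ge[OF x(1)])
      finally show "norm (2 * \<kappa> * f x * of_real (\<psi> x)) \<le> \<dots>" .
    qed (use t in auto)
    thus ?thesis by (simp add: u_def \<psi>_def G_def)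
  qed
  have wB: "cmod (w t - B) \<le> S / 3" if t: "0 \<le> t" "t \<le> T" for t
  proof (cases "t = 0")
    case True thus ?thesis using S0 by (simp add: w_def)
  next
    case False
    \<comment> \<open>Inserting the bound \<open>G\<close> for \<open>u\<close>, the powers of
      \<open>tanh\<close> and \<open>cosh\<close> cancel against \<open>\<psi> * \<phi>\<close> up
      to \<open>sinh * cosh\<close>, whose integral is half of \<open>sinh\<close> squared. This is
      where the condition on \<open>(sinh T)\<^sup>2\<close> comes from.\<close>
    have "norm (w t - w 0) \<le> cmod \<kappa> * S / (m + 1) * (sinh t)\<^sup>2 - cmod \<kappa> * S / (m + 1) * (sinh 0)\<^sup>2"
    proof (rule differentiable_bound_general[where a = 0 and b = t])
      show "continuous_on {0..t} w" using cw t by (auto intro: continuous_on_subset)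
      show "continuous_on {0..t} (\<lambda>t. cmod \<kappa> * S / (m + 1) * (sinh t)\<^sup>2)" by (auto intro!: continuous_intros)
      fix x assume x: "0 < x" "x < t"
      show "(w has_vector_derivative (2 * y x / of_real (\<phi> x))) (at x)" using dw x by auto
      have "((\<lambda>t. cmod \<kappa> * S / (m + 1) * (sinh t)\<^sup>2) has_real_derivative 2 * cmod \<kappa> * S / (m + 1) * (sinh x * cosh x)) (at x)"
        by (rule derivative_eq_intros refl | simp)+
      thus "((\<lambda>t. cmod \<kappa> * S / (m + 1) * (sinh t)\<^sup>2) has_vector_derivative 2 * cmod \<kappa> * S / (m + 1) * (sinh x * cosh x)) (at x)"
        by (simp only: has_real_derivative_iff_has_vector_derivative)
      have e: "cosh x powr (4 - 2 * L) = cosh x powr 2 * (cosh x powr (2 - L) * cosh x powr (- L))"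
        by (subst powr_add[symmetric])+ simp
      have "norm (2 * y x / of_real (\<phi> x)) = 2 * cmod (u x) / (\<psi> x * \<phi> x)"
        using x \<psi>_pos[of x] \<phi>_pos[of x] by (simp add: u_def norm_mult norm_divide)
      also have "\<dots> \<le> 2 * G x / (\<psi> x * \<phi> x)"
        using uG[of x] x t \<psi>_pos[of x] \<phi>_pos[of x] by (intro divide_right_mono mult_left_mono) auto
      also have "\<dots> = 2 * cmod \<kappa> * S / (m + 1) * (tanh x * (cosh x powr 2))"
      proof -
        have g: "G x = cmod \<kappa> * S / (m + 1) * (tanh x * (cosh x powr 2)) * (\<psi> x * \<phi> x)"
        proof -
          have "tanh x ^ (2 * m + 2) = tanh x * (tanh x ^ (m + 1) * tanh x ^ m)"
            by (simp add: mult_2 power_add)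
          moreover have "2 * cmod \<kappa> * S / (2 * m + 2) = cmod \<kappa> * S / (m + 1)"
            by (simp add: divide_simps)
          ultimately show ?thesis
            unfolding G_def \<psi>_def \<phi>_def e by (simp only: mult_ac)
        qed
        show ?thesis unfolding g using x \<psi>_pos[of x] \<phi>_pos[of x] by simp
      qed
      also have "tanh x * cosh x powr 2 = sinh x * cosh x"
        by (simp add: tanh_def powr_numeral power2_eq_square)
      finally show "norm (2 * y x / of_real (\<phi> x)) \<le> 2 * cmod \<kappa> * S / (m + 1) * (sinh x * cosh x)" .
    qed (use t False in auto)
    also have "\<dots> \<le> S / 3"
    proof -
      have "3 * cmod \<kappa> * (sinh t)\<^sup>2 \<le> 3 * cmod \<kappa> * (sinh T)\<^sup>2"
        using t by (intro mult_left_mono power_mono) auto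
      also have "\<dots> \<le> m + 1" by (rule T)
      finally have "S * (3 * cmod \<kappa> * (sinh t)\<^sup>2) \<le> S * (m + 1)" using S0 by (intro mult_left_mono) auto
      thus ?thesis by (simp add: field_simps)
    qed
    finally show ?thesis by (simp add: w_def)
  qed
  \<comment> \<open>The supremum is absorbed: it is at most \<open>3/2\<close> of
    \<open>cmod B\<close>, so \<open>w T\<close> differs from \<open>B\<close> by at most half of
    \<open>cmod B\<close>.\<close>
  have "S \<le> cmod B + S / 3"
    using wB[of \<xi>] \<xi>(1) norm_triangle_ineq[of B "w \<xi> - B"] by (auto simp: S_def)
  hence "S / 3 \<le> cmod B / 2" by simp
  hence "cmod B / 2 \<le> cmod (w T)"
    using wB[of T] T norm_triangle_ineq4[of "w T" "w T - B"] by auto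
  moreover have "cmod (f T) = cmod (w T) * \<phi> T"
    using T \<phi>_pos[of T] by (simp add: w_def norm_divide)
  ultimately have "cmod B / 2 * \<phi> T \<le> cmod (f T)"
    using \<phi>_pos[of T] T by (simp add: mult_right_mono)
  thus ?thesis by (simp add: \<phi>_def mult.assoc)
qed

text \<open>The quotient \<open>a k / (k + 1)\<^sup>2\<close> is \<open>1 + s / k\<close> up to
  order \<open>1 / k\<^sup>2\<close>, and so is \<open>((k + 2) / (k + 1)) powr s\<close>; hence the
  logarithms \<open>g\<close> of their ratios are summable and the telescoped product is comparable
  to \<open>(m + 1) powr s\<close>. If some factor is not positive, only finitely many
  \<open>m\<close> are admissible.\<close>

lemma quadratic_product_growth:
  fixes s d :: real
  defines "a \<equiv> \<lambda>k::nat. (real k)\<^sup>2 + (s + 2) * real k + d"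
  shows "\<exists>c>0. \<forall>m. (\<forall>k<m. 0 < a k) \<longrightarrow> c * real (m + 1) powr s \<le> (\<Prod>k<m. a k) / (fact m)\<^sup>2"
proof (cases "\<forall>k. 0 < a k")
  case True
  define g where "g k = ln (a k / (real k + 1)\<^sup>2) - s * ln ((real k + 2) / (real k + 1))" for k
  have "g \<in> O(\<lambda>k. 1 / real k ^ 2)"
    unfolding g_def a_def by real_asymp
  hence "summable g"
    by (rule summable_comparison_test_bigo[rotated]) (simp add: inverse_power_summable flip: inverse_eq_divide)
  hence "Bseq (\<lambda>m. \<Sum>k<m. g k)"
    by (intro convergent_imp_Bseq) (simp add: summable_iff_convergent)
  then obtain K where K: "\<And>m. \<bar>\<Sum>k<m. g k\<bar> \<le> K" by (auto simp: Bseq_def)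
  have "exp (- K) * real (m + 1) powr s \<le> (\<Prod>k<m. a k) / (fact m)\<^sup>2" for m
  proof -
    have "(\<Prod>k<m. a k) / (fact m)\<^sup>2 = exp (\<Sum>k<m. g k) * real (m + 1) powr s"
    proof (induction m)
      case (Suc m)
      have "exp (g m) = a m / (real m + 1)\<^sup>2 * ((real m + 1) / (real m + 2)) powr s"
      proof -
        have "a m / (real m + 1)\<^sup>2 > 0" using True by simp
        moreover have "exp (- (s * ln ((real m + 2) / (real m + 1)))) = ((real m + 1) / (real m + 2)) powr s"
          by (simp add: powr_def ln_div algebra_simps)
        ultimately show ?thesis by (simp only: g_def diff_conv_add_uminus exp_add exp_ln)
      qed
      hence "exp (g m) * real (Suc m + 1) powr s = a m / (real m + 1)\<^sup>2 * real (m + 1) powr s"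
        by (simp add: powr_divide add_ac)
      moreover have "exp (\<Sum>k<Suc m. g k) * real (Suc m + 1) powr s = exp (\<Sum>k<m. g k) * (exp (g m) * real (Suc m + 1) powr s)"
        by (simp add: exp_add)
      ultimately have "exp (\<Sum>k<Suc m. g k) * real (Suc m + 1) powr s = exp (\<Sum>k<m. g k) * real (m + 1) powr s * (a m / (real m + 1)\<^sup>2)"
        by simp
      also have "\<dots> = (\<Prod>k<Suc m. a k) / (fact (Suc m))\<^sup>2"
        by (subst Suc.IH [symmetric]) (simp add: field_simps power2_eq_square)
      finally show ?case ..
    qed auto
    moreover have "exp (- K) \<le> exp (\<Sum>k<m. g k)" using K[of m] by simp
    ultimately show ?thesis by (simp add: mult_right_mono)
  qed
  thus ?thesis by (intro exI[of _ "exp (- K)"]) auto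
next
  case False
  then obtain k0 where k0: "\<not> 0 < a k0" by blast
  \<comment> \<open>The default 1 keeps \<open>h\<close> positive at the \<open>m\<close> excluded
    by the hypothesis, so that the minimum over all \<open>m\<close> up to \<open>k0\<close> is
    positive.\<close>
  define h where "h m = (if \<forall>k<m. 0 < a k then ((\<Prod>k<m. a k) / (fact m)\<^sup>2) / real (m + 1) powr s else 1)" for m
  define c where "c = Min (h ` {..k0})"
  have "h m > 0" for m by (auto simp: h_def intro!: divide_pos_pos prod_pos)
  hence "c > 0" by (auto simp: c_def)
  moreover have "c * real (m + 1) powr s \<le> (\<Prod>k<m. a k) / (fact m)\<^sup>2" if m: "\<forall>k<m. 0 < a k" for m
  proof -
    have "m \<le> k0" using m k0 by (meson not_le)
    hence "c \<le> h m" by (auto simp: c_def)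
    thus ?thesis using m unfolding h_def by (simp add: pos_le_divide_eq mult_ac)
  qed
  ultimately show ?thesis by blast
qed

lemma sum_cis_roots:
  assumes "M > 0" "\<not> int M dvd j"
  shows "(\<Sum>k<M. cis (2 * pi * real k * of_int j / M)) = 0"
proof -
  define z where "z = cis (2 * pi * of_int j / M)"
  have "z ^ M = 1"
    using assms cis_multiple_2pi[of "of_int j"] by (simp add: z_def Complex.DeMoivre mult_ac)
  moreover have "z \<noteq> 1"
  proof
    assume "z = 1"
    hence "exp (\<i> * complex_of_real (2 * pi * of_int j / M)) = 1" by (simp add: z_def cis_conv_exp)
    then obtain i :: int where "2 * pi * of_int j / M = 2 * pi * of_int i"
      unfolding exp_eq_1 by auto
    hence "(of_int j :: real) = of_int (int M * i)" using assms by (simp add: field_simps)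
    hence "j = int M * i" by linarith
    thus False using assms by auto
  qed
  moreover have "cis (2 * pi * real k * of_int j / M) = z ^ k" for k
    by (simp add: z_def Complex.DeMoivre mult_ac)
  ultimately show ?thesis by (simp add: sum_gp_strict)
qed

section \<open>Matrices\<close>

definition mat2 :: "real \<Rightarrow> real \<Rightarrow> real \<Rightarrow> real \<Rightarrow> real^2^2" where
  "mat2 a b c d = vector [vector [a, b], vector [c, d]]"

text \<open>\<open>mat_J\<close> spans the Lie algebra of \<open>SO2\<close>; \<open>mat_H\<close>
  and \<open>mat_S\<close> span its orthogonal complement for the Killing form.\<close>

abbreviation "mat_J \<equiv> mat2 0 (-1) 1 0"
abbreviation "mat_H \<equiv> mat2 1 0 0 (-1)"
abbreviation "mat_S \<equiv> mat2 0 1 1 0"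
abbreviation "mat_A t \<equiv> mat2 (exp t) 0 0 (exp (- t))"

lemma mat2_nth [simp]:
  "mat2 a b c d $ 1 $ 1 = a" "mat2 a b c d $ 1 $ 2 = b"
  "mat2 a b c d $ 2 $ 1 = c" "mat2 a b c d $ 2 $ 2 = d"
  by (simp_all add: mat2_def)

lemma mat2_eqI:
  fixes X Y :: "real^2^2"
  assumes "X $ 1 $ 1 = Y $ 1 $ 1" "X $ 1 $ 2 = Y $ 1 $ 2" "X $ 2 $ 1 = Y $ 2 $ 1" "X $ 2 $ 2 = Y $ 2 $ 2"
  shows "X = Y"
  using assms by (simp add: vec_eq_iff forall_2)

lemma matrix_mult_nth_2: "((X :: real^2^2) ** Y) $ i $ j = X $ i $ 1 * Y $ 1 $ j + X $ i $ 2 * Y $ 2 $ j"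
  by (simp add: matrix_matrix_mult_def sum_2)

lemma mat2_mult: "mat2 a b c d ** mat2 a' b' c' d' =
    mat2 (a * a' + b * c') (a * b' + b * d') (c * a' + d * c') (c * b' + d * d')"
  by (rule mat2_eqI) (simp_all add: matrix_mult_nth_2)

lemma mat2_add: "mat2 a b c d + mat2 a' b' c' d' = mat2 (a + a') (b + b') (c + c') (d + d')"
  and mat2_diff: "mat2 a b c d - mat2 a' b' c' d' = mat2 (a - a') (b - b') (c - c') (d - d')"
  and mat2_scaleR: "r *\<^sub>R mat2 a b c d = mat2 (r * a) (r * b) (r * c) (r * d)"
  and mat_1_mat2: "mat 1 = mat2 1 0 0 1"
  by (rule mat2_eqI; simp add: mat_def)+

lemma mat2_in_SL2: "mat2 a b c d \<in> SL2 \<longleftrightarrow> a * d - b * c = 1"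
  by (simp add: SL2_def det_2)

lemma mat2_in_sl2: "mat2 a b c d \<in> sl2 \<longleftrightarrow> a + d = 0"
  by (simp add: sl2_def trace_def sum_2)

lemma sl2_scaleR: "X \<in> sl2 \<Longrightarrow> r *\<^sub>R X \<in> sl2"
  by (simp add: sl2_def trace_def sum_2 flip: distrib_left)

lemma sl2_add: "X \<in> sl2 \<Longrightarrow> Y \<in> sl2 \<Longrightarrow> X + Y \<in> sl2"
  by (simp add: sl2_def trace_def sum_2)

lemma J_H_S_in_sl2: "mat_J \<in> sl2" "mat_H \<in> sl2" "mat_S \<in> sl2"
  by (simp_all add: mat2_in_sl2)

lemma sl2_decomposition:
  assumes "X \<in> sl2"
  obtains a b c where "X = a *\<^sub>R mat_H + b *\<^sub>R mat_S + c *\<^sub>R mat_J"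
proof
  have "X $ 2 $ 2 = - X $ 1 $ 1" using assms by (simp add: sl2_def trace_def sum_2)
  thus "X = X $ 1 $ 1 *\<^sub>R mat_H + ((X $ 1 $ 2 + X $ 2 $ 1) / 2) *\<^sub>R mat_S
      + ((X $ 2 $ 1 - X $ 1 $ 2) / 2) *\<^sub>R mat_J"
    by (intro mat2_eqI) (simp_all add: add_divide_distrib diff_divide_distrib)
qed

lemma so2_decomposition:
  assumes "X \<in> so2"
  obtains y where "X = y *\<^sub>R mat_J"
proof
  have "X $ i $ j = - X $ j $ i" for i j
  proof -
    have "transpose X $ j $ i = (- X) $ j $ i" using assms by (simp add: so2_def)
    thus ?thesis by (simp add: transpose_def)
  qed
  from this[of 1 1] this[of 2 2] this[of 1 2]
  have "X $ 1 $ 1 = 0" "X $ 2 $ 2 = 0" "X $ 1 $ 2 = - X $ 2 $ 1" by linarith+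
  thus "X = X $ 2 $ 1 *\<^sub>R mat_J"
    by (intro mat2_eqI) simp_all
qed

lemma J_in_so2: "mat_J \<in> so2"
  by (simp add: so2_def transpose_def) (rule mat2_eqI; simp)

section \<open>Rotations and their adjoint action\<close>

lemma rot_mat2: "rot \<theta> = mat2 (cos \<theta>) (- sin \<theta>) (sin \<theta>) (cos \<theta>)"
  by (simp add: rot_def mat2_def)

lemma SO2_eq_range_rot: "SO2 = range rot"
proof (intro set_eqI iffI)
  fix k assume "k \<in> SO2"
  hence o: "transpose k ** k = mat 1" "k ** transpose k = mat 1" and d: "det k = 1"
    by (auto simp: SO2_def rotation_matrix_def orthogonal_matrix_def)
  define a b c d where "a = k $ 1 $ 1" "b = k $ 1 $ 2" "c = k $ 2 $ 1" "d = k $ 2 $ 2"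
  have k: "k = mat2 a b c d" by (rule mat2_eqI) (simp_all add: a_b_c_d_def)
  have t: "transpose k = mat2 a c b d" by (rule mat2_eqI) (simp_all add: a_b_c_d_def transpose_def)
  have "mat2 a c b d ** mat2 a b c d = mat2 1 0 0 1"
    using o(1) unfolding t mat_1_mat2[symmetric] k[symmetric] .
  hence m: "(mat2 a c b d ** mat2 a b c d) $ i $ j = mat2 1 0 0 1 $ i $ j" for i j by simp
  have e: "a * a + c * c = 1" "b * b + d * d = 1" "a * b + c * d = 0"
    using m[of 1 1] m[of 2 2] m[of 1 2] by (simp_all add: mat2_mult)
  have dd: "a * d - b * c = 1" using d by (simp add: k det_2)
  \<comment> \<open>The squared lengths of both columns minus twice the determinant form a sum of
    two squares with value 0, which forces the shape of a rotation.\<close>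
  have "(a - d)\<^sup>2 + (b + c)\<^sup>2 = (a * a + c * c) + (b * b + d * d) - 2 * (a * d - b * c)"
    by (simp add: power2_eq_square algebra_simps)
  hence "(a - d)\<^sup>2 + (b + c)\<^sup>2 = 0" unfolding e dd by simp
  hence "d = a" "b = - c" by simp_all
  moreover have "a\<^sup>2 + c\<^sup>2 = 1" using e(1) by (simp add: power2_eq_square)
  then obtain \<theta> where "a = cos \<theta>" "c = sin \<theta>"
    by (rule sincos_total_2pi)
  ultimately show "k \<in> range rot" by (auto simp: k rot_mat2)
next
  fix k assume "k \<in> range rot"
  then obtain \<theta> where k: "k = rot \<theta>" by auto
  have t: "transpose k = mat2 (cos \<theta>) (sin \<theta>) (- sin \<theta>) (cos \<theta>)"
    unfolding k rot_mat2 by (rule mat2_eqI) (simp_all add: transpose_def)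
  have "transpose k ** k = mat 1" "k ** transpose k = mat 1"
    unfolding t unfolding k rot_mat2 mat2_mult mat_1_mat2
    using sin_cos_squared_add3[of \<theta>] sin_cos_squared_add[of \<theta>, unfolded power2_eq_square]
    by (simp_all add: mult.commute)
  moreover have "det k = 1"
    unfolding k rot_mat2 det_2 using sin_cos_squared_add3[of \<theta>] by simp
  ultimately show "k \<in> SO2"
    by (simp add: SO2_def rotation_matrix_def orthogonal_matrix_def)
qed

lemma rot_in_SO2 [simp]: "rot \<theta> \<in> SO2"
  by (simp add: SO2_eq_range_rot)

lemma SO2_subset_SL2: "SO2 \<subseteq> SL2"
  by (auto simp: SO2_def SL2_def rotation_matrix_def)

lemma mat_A_in_SL2: "mat_A t \<in> SL2"
  by (simp add: mat2_in_SL2 flip: exp_add)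

lemma rot_0: "rot 0 = mat 1"
  by (simp add: rot_mat2 mat_1_mat2)

lemma rot_add: "rot (\<theta> + \<phi>) = rot \<theta> ** rot \<phi>"
  by (simp add: rot_mat2 mat2_mult sin_add cos_add algebra_simps)

lemma Ad_rot: "Ad (rot \<theta>) X = rot \<theta> ** X ** rot (- \<theta>)"
proof -
  have inv: "rot \<theta> ** rot (- \<theta>) = mat 1" "rot (- \<theta>) ** rot \<theta> = mat 1"
    by (simp_all flip: rot_add rot_0)
  have "rot \<theta> ** matrix_inv (rot \<theta>) = mat 1"
    unfolding matrix_inv_def using someI[of "\<lambda>B. rot \<theta> ** B = mat 1 \<and> B ** rot \<theta> = mat 1"] inv by blast
  hence "rot (- \<theta>) ** (rot \<theta> ** matrix_inv (rot \<theta>)) = rot (- \<theta>)" by simp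
  hence "matrix_inv (rot \<theta>) = rot (- \<theta>)"
    by (simp add: matrix_mul_assoc inv)
  thus ?thesis by (simp add: Ad_def)
qed

text \<open>The plane spanned by \<open>mat_H\<close> and \<open>mat_S\<close> is rotated by twice
  the angle; for this reason the ladder operators below shift \<open>K\<close>-types by 2.\<close>

lemma Ad_rot_J: "Ad (rot \<theta>) mat_J = mat_J"
  and Ad_rot_H: "Ad (rot \<theta>) mat_H = cos (2 * \<theta>) *\<^sub>R mat_H + sin (2 * \<theta>) *\<^sub>R mat_S"
  and Ad_rot_S: "Ad (rot \<theta>) mat_S = - sin (2 * \<theta>) *\<^sub>R mat_H + cos (2 * \<theta>) *\<^sub>R mat_S"
proof -
  have e: "sin (2 * \<theta>) = 2 * sin \<theta> * cos \<theta>" "cos (2 * \<theta>) = cos \<theta> * cos \<theta> - sin \<theta> * sin \<theta>"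
      "cos \<theta> * cos \<theta> + sin \<theta> * sin \<theta> = 1"
    using sin_cos_squared_add2[of \<theta>] by (simp_all add: cos_double sin_double power2_eq_square)
  show "Ad (rot \<theta>) mat_J = mat_J"
    "Ad (rot \<theta>) mat_H = cos (2 * \<theta>) *\<^sub>R mat_H + sin (2 * \<theta>) *\<^sub>R mat_S"
    "Ad (rot \<theta>) mat_S = - sin (2 * \<theta>) *\<^sub>R mat_H + cos (2 * \<theta>) *\<^sub>R mat_S"
    unfolding Ad_rot unfolding rot_mat2 mat2_mult mat2_add mat2_scaleR e(1,2)
    using e(3) by (rule_tac [!] mat2_eqI) (simp_all add: algebra_simps)
qed

section \<open>Exponentials of matrices whose square is scalar\<close>

lemma matrix_power_of_square:
  assumes "X ** X = d *\<^sub>R (mat 1 :: real^2^2)"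
  shows "((**) (t *\<^sub>R X) ^^ n) (mat 1) =
    (if even n then (d ^ (n div 2) * t ^ n) *\<^sub>R mat 1 else (d ^ (n div 2) * t ^ n) *\<^sub>R X)"
proof (induction n)
  case (Suc n)
  have "(t *\<^sub>R X) ** (b *\<^sub>R X) = (t * b * d) *\<^sub>R mat 1" "(t *\<^sub>R X) ** (b *\<^sub>R mat 1) = (t * b) *\<^sub>R X" for b
    by (simp_all add: matrix_scalar_ac assms flip: scalar_matrix_assoc)
  thus ?case
    by (cases "even n") (simp_all add: Suc.IH mult_ac)
qed auto

lemma mexp_rotation:
  assumes "X ** X = - (mat 1 :: real^2^2)"
  shows "mexp (t *\<^sub>R X) = cos t *\<^sub>R mat 1 + sin t *\<^sub>R X"
proof -
  have "(\<lambda>n. (cos_coeff n * t ^ n) *\<^sub>R mat 1 + (sin_coeff n * t ^ n) *\<^sub>R X) sums (cos t *\<^sub>R mat 1 + sin t *\<^sub>R X)"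
    using cos_converges[of t] sin_converges[of t] by (intro sums_add sums_scaleR_left) auto
  moreover have "((**) (t *\<^sub>R X) ^^ n) (mat 1) /\<^sub>R fact n = (cos_coeff n * t ^ n) *\<^sub>R mat 1 + (sin_coeff n * t ^ n) *\<^sub>R X" for n
    using matrix_power_of_square[of X "-1" n t] assms
  proof (cases "even n")
    case False
    hence "(n - Suc 0) div 2 = n div 2" by (auto elim!: oddE)
    thus ?thesis using False matrix_power_of_square[of X "-1" n t] assms
      by (simp add: sin_coeff_def cos_coeff_def divide_inverse mult_ac)
  qed (simp add: cos_coeff_def sin_coeff_def divide_inverse mult_ac)
  ultimately show ?thesis by (simp add: mexp_def sums_iff)
qed

lemma mexp_hyperbolic:
  assumes "X ** X = (mat 1 :: real^2^2)"
  shows "mexp (t *\<^sub>R X) = cosh t *\<^sub>R mat 1 + sinh t *\<^sub>R X"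
proof -
  have "(\<lambda>n. (if even n then t ^ n /\<^sub>R fact n else 0) *\<^sub>R mat 1 + (if even n then 0 else t ^ n /\<^sub>R fact n) *\<^sub>R X) sums (cosh t *\<^sub>R mat 1 + sinh t *\<^sub>R X)"
    using cosh_converges[of t] sinh_converges[of t] by (intro sums_add sums_scaleR_left) auto
  moreover have "((**) (t *\<^sub>R X) ^^ n) (mat 1) /\<^sub>R fact n = (if even n then t ^ n /\<^sub>R fact n else 0) *\<^sub>R mat 1 + (if even n then 0 else t ^ n /\<^sub>R fact n) *\<^sub>R X" for n
    using matrix_power_of_square[of X 1 n t] assms by (cases "even n") (simp_all add: mult.commute)
  ultimately show ?thesis by (simp add: mexp_def sums_iff)
qed

lemma mexp_J: "mexp (t *\<^sub>R mat_J) = rot t"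
proof -
  have "mat_J ** mat_J = - mat 1"
    unfolding mat2_mult mat_1_mat2 by (rule mat2_eqI) simp_all
  from mexp_rotation[OF this] show ?thesis
    unfolding rot_mat2 mat_1_mat2 mat2_scaleR mat2_add by simp
qed

lemma mexp_H: "mexp (t *\<^sub>R mat_H) = mat_A t"
proof -
  have "mat_H ** mat_H = mat 1"
    unfolding mat2_mult mat_1_mat2 by simp
  from mexp_hyperbolic[OF this] show ?thesis
    unfolding mat_1_mat2 mat2_scaleR mat2_add by (simp add: cosh_plus_sinh cosh_minus_sinh)
qed

lemma mexp_S: "mexp (t *\<^sub>R mat_S) = mat2 (cosh t) (sinh t) (sinh t) (cosh t)"
proof -
  have "mat_S ** mat_S = mat 1"
    unfolding mat2_mult mat_1_mat2 by simp
  from mexp_hyperbolic[OF this] show ?thesis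
    unfolding mat_1_mat2 mat2_scaleR mat2_add by simp
qed

lemma mexp_in_SL2:
  assumes "X \<in> {mat_J, mat_H, mat_S}"
  shows "mexp (t *\<^sub>R X) \<in> SL2"
proof -
  have "mexp (t *\<^sub>R mat_J) \<in> SL2"
    unfolding mexp_J using SO2_subset_SL2 rot_in_SO2 by blast
  moreover have "mexp (t *\<^sub>R mat_H) \<in> SL2"
    unfolding mexp_H by (rule mat_A_in_SL2)
  moreover have "mexp (t *\<^sub>R mat_S) \<in> SL2"
    unfolding mexp_S mat2_in_SL2 using hyperbolic_pythagoras[of t] by (simp add: power2_eq_square)
  ultimately show ?thesis using assms by auto
qed

lemma mat_A_add: "mat_A (s + t) = mat_A s ** mat_A t"
  by (simp add: mat2_mult flip: exp_add)

text \<open>The matrix in the exponent is \<open>Ad (mat_A (- t)) mat_J\<close>, so its exponential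
  is the conjugate of \<open>rot s\<close> by \<open>mat_A (- t)\<close>.\<close>

lemma mat_A_mult_mexp: "mat_A t ** mexp (s *\<^sub>R (cosh (2 * t) *\<^sub>R mat_J + sinh (2 * t) *\<^sub>R mat_S)) = rot s ** mat_A t"
proof -
  have X: "cosh (2 * t) *\<^sub>R mat_J + sinh (2 * t) *\<^sub>R mat_S = mat2 0 (- exp (- (2 * t))) (exp (2 * t)) 0"
    by (simp add: mat2_scaleR mat2_add) (rule mat2_eqI; simp add: cosh_def sinh_def field_simps)
  have m: "mexp (s *\<^sub>R mat2 0 (- exp (- (2 * t))) (exp (2 * t)) 0) =
      mat2 (cos s) (- sin s * exp (- (2 * t))) (sin s * exp (2 * t)) (cos s)"
    by (subst mexp_rotation)
       (simp_all add: mat2_mult mat_1_mat2 mat2_scaleR mat2_add flip: exp_add, rule mat2_eqI, simp_all)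
  have e: "exp t * exp (- (2 * t)) = exp (- t)" "exp (- t) * exp (2 * t) = exp t"
    "exp (- (2 * t)) * exp (2 * t) = 1" by (simp_all flip: exp_add)
  have "exp t * (- sin s * exp (- (2 * t))) = - sin s * exp (- t)"
    by (simp flip: e(1))
  moreover have "exp (- t) * (sin s * exp (2 * t)) = sin s * exp t"
    by (simp add: mult.left_commute e)
  ultimately show ?thesis
    unfolding X m rot_mat2 mat2_mult by (intro mat2_eqI) (simp_all only: mat2_nth, simp_all)
qed

lemma lie_bracket_J_H_S:
  "lie_bracket mat_H mat_S = (-2) *\<^sub>R mat_J"
  "lie_bracket mat_J mat_H = 2 *\<^sub>R mat_S"
  "lie_bracket mat_J mat_S = (-2) *\<^sub>R mat_H"
  unfolding lie_bracket_def mat2_mult mat2_diff mat2_scaleR by simp_all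

lemma killing_form_so2: "killing_form (y *\<^sub>R mat_J) (y *\<^sub>R mat_J) = - 8 * y\<^sup>2"
  unfolding killing_form_def Let_def mat2_def[symmetric] mat2_scaleR lie_bracket_def mat2_mult mat2_diff
  by (simp add: power2_eq_square)

section \<open>The completion\<close>

locale normed_module =
  fixes M :: "'v::ab_group_add gK" and p :: "'v \<Rightarrow> real"
  assumes vector_space: "vector_space (cscale M)" and is_norm: "is_norm M p"
begin

sublocale V: vector_space "cscale M"
  by (rule vector_space)

lemma p_ge_0 [simp]: "0 \<le> p v"
  and p_eq_0_iff [simp]: "p v = 0 \<longleftrightarrow> v = 0"
  and p_triangle: "p (v + w) \<le> p v + p w"
  and p_scale: "p (cscale M c v) = cmod c * p v"
  using is_norm unfolding is_norm_def by blast+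

lemma p_zero [simp]: "p 0 = 0"
  by simp

lemma p_minus [simp]: "p (- v) = p v"
  using p_scale[of "-1" v] by simp

lemma p_minus_commute: "p (v - w) = p (w - v)"
  using p_minus[of "v - w"] by simp

lemma p_triangle_sub: "p (u - w) \<le> p (u - v) + p (v - w)"
  using p_triangle[of "u - v" "v - w"] by simp

lemma p_diff_bound: "\<bar>p v - p w\<bar> \<le> p (v - w)"
  using p_triangle[of "v - w" w] p_triangle[of "w - v" v] by (simp add: p_minus_commute)

lemma p_sum: "p (\<Sum>i\<in>I. f i) \<le> (\<Sum>i\<in>I. p (f i))"
proof (cases "finite I")
  case True
  thus ?thesis
    by induction (auto intro: order_trans[OF p_triangle])
qed simp

section \<open>Cauchy sequences\<close>

lemma const_p_Cauchy [simp, intro]: "(\<lambda>_. v) \<in> p_Cauchy p"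
  by (simp add: p_Cauchy_def)

lemma p_CauchyD:
  assumes "f \<in> p_Cauchy p" "e > 0"
  obtains N where "\<And>m n. m \<ge> N \<Longrightarrow> n \<ge> N \<Longrightarrow> p (f m - f n) < e"
  using assms unfolding p_Cauchy_def by blast

lemma p_Cauchy_add:
  assumes "f \<in> p_Cauchy p" "g \<in> p_Cauchy p"
  shows "(\<lambda>n. f n + g n) \<in> p_Cauchy p"
  unfolding p_Cauchy_def
proof (intro CollectI allI impI)
  fix e :: real assume "e > 0"
  hence e: "e / 2 > 0" by simp
  obtain N1 where N1: "\<And>m n. m \<ge> N1 \<Longrightarrow> n \<ge> N1 \<Longrightarrow> p (f m - f n) < e / 2"
    using p_CauchyD[OF assms(1) e] by blast
  obtain N2 where N2: "\<And>m n. m \<ge> N2 \<Longrightarrow> n \<ge> N2 \<Longrightarrow> p (g m - g n) < e / 2"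
    using p_CauchyD[OF assms(2) e] by blast
  have "p (f m + g m - (f n + g n)) < e" if "m \<ge> max N1 N2" "n \<ge> max N1 N2" for m n
  proof -
    have "p (f m + g m - (f n + g n)) \<le> p (f m - f n) + p (g m - g n)"
      using p_triangle[of "f m - f n" "g m - g n"] by (simp add: algebra_simps)
    also have "\<dots> < e / 2 + e / 2"
      using that by (intro add_strict_mono N1 N2) auto
    finally show ?thesis by simp
  qed
  thus "\<exists>N. \<forall>m\<ge>N. \<forall>n\<ge>N. p (f m + g m - (f n + g n)) < e" by blast
qed

lemma p_Cauchy_scale:
  assumes "f \<in> p_Cauchy p"
  shows "(\<lambda>n. cscale M c (f n)) \<in> p_Cauchy p"
  unfolding p_Cauchy_def
proof (intro CollectI allI impI)
  fix e :: real assume e: "e > 0"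
  have c: "cmod c + 1 > 0" by (simp add: add_nonneg_pos)
  hence "e / (cmod c + 1) > 0" using e by simp
  then obtain N where N: "\<And>m n. m \<ge> N \<Longrightarrow> n \<ge> N \<Longrightarrow> p (f m - f n) < e / (cmod c + 1)"
    using assms unfolding p_Cauchy_def by blast
  have "p (cscale M c (f m) - cscale M c (f n)) < e" if "m \<ge> N" "n \<ge> N" for m n
  proof -
    have "p (cscale M c (f m) - cscale M c (f n)) = cmod c * p (f m - f n)"
      by (simp add: p_scale flip: V.scale_right_diff_distrib)
    also have "\<dots> \<le> (cmod c + 1) * p (f m - f n)" by (simp add: mult_right_mono)
    also have "\<dots> < e" using N[OF that] c by (simp add: pos_less_divide_eq mult.commute)
    finally show ?thesis .
  qed
  thus "\<exists>N. \<forall>m\<ge>N. \<forall>n\<ge>N. p (cscale M c (f m) - cscale M c (f n)) < e" by blast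
qed

lemma p_Cauchy_minus: "f \<in> p_Cauchy p \<Longrightarrow> (\<lambda>n. - f n) \<in> p_Cauchy p"
  using p_Cauchy_scale[of f "-1"] by simp

lemma p_Cauchy_lipschitz_convergent:
  fixes \<phi> :: "'v \<Rightarrow> 'b::banach"
  assumes f: "f \<in> p_Cauchy p" and \<phi>: "\<And>v w. norm (\<phi> v - \<phi> w) \<le> C * p (v - w)"
  shows "convergent (\<lambda>n. \<phi> (f n))"
proof -
  have "Cauchy (\<lambda>n. \<phi> (f n))"
    unfolding Cauchy_iff
  proof (intro allI impI)
    fix e :: real assume e: "e > 0"
    have c: "\<bar>C\<bar> + 1 > 0" by (simp add: add_nonneg_pos)
    hence "e / (\<bar>C\<bar> + 1) > 0" using e by simp
    then obtain N where N: "\<And>m n. m \<ge> N \<Longrightarrow> n \<ge> N \<Longrightarrow> p (f m - f n) < e / (\<bar>C\<bar> + 1)"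
      using f unfolding p_Cauchy_def by blast
    have "norm (\<phi> (f m) - \<phi> (f n)) < e" if "m \<ge> N" "n \<ge> N" for m n
    proof -
      have "norm (\<phi> (f m) - \<phi> (f n)) \<le> (\<bar>C\<bar> + 1) * p (f m - f n)"
        by (rule order_trans[OF \<phi>]) (simp add: mult_right_mono)
      also have "\<dots> < e" using N[OF that] c by (simp add: pos_less_divide_eq mult.commute)
      finally show ?thesis .
    qed
    thus "\<exists>N. \<forall>m\<ge>N. \<forall>n\<ge>N. norm (\<phi> (f m) - \<phi> (f n)) < e" by blast
  qed
  thus ?thesis by (rule Cauchy_convergent)
qed

section \<open>Classes of Cauchy sequences and operations on them\<close>

abbreviation cls :: "(nat \<Rightarrow> 'v) \<Rightarrow> (nat \<Rightarrow> 'v) set" where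
  "cls f \<equiv> compl_rel p `` {f}"

lemma compl_rel_iff: "(f, g) \<in> compl_rel p \<longleftrightarrow> f \<in> p_Cauchy p \<and> g \<in> p_Cauchy p \<and> (\<lambda>n. p (f n - g n)) \<longlonglongrightarrow> 0"
  by (auto simp: compl_rel_def)

lemma null_trans:
  assumes "(\<lambda>n. p (f n - g n)) \<longlonglongrightarrow> 0" "(\<lambda>n. p (g n - h n)) \<longlonglongrightarrow> 0"
  shows "(\<lambda>n. p (f n - h n)) \<longlonglongrightarrow> 0"
proof (rule Lim_null_comparison)
  show "(\<lambda>n. p (f n - g n) + p (g n - h n)) \<longlonglongrightarrow> 0"
    using tendsto_add[OF assms] by simp
  show "\<forall>\<^sub>F n in sequentially. norm (p (f n - h n)) \<le> p (f n - g n) + p (g n - h n)"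
    by (simp add: p_triangle_sub)
qed

lemma cls_eqI:
  assumes f: "f \<in> p_Cauchy p" and g: "g \<in> p_Cauchy p" and fg: "(\<lambda>n. p (f n - g n)) \<longlonglongrightarrow> 0"
  shows "cls f = cls g"
proof -
  have gf: "(\<lambda>n. p (g n - f n)) \<longlonglongrightarrow> 0" using fg by (simp add: p_minus_commute)
  have "(\<lambda>n. p (f n - h n)) \<longlonglongrightarrow> 0 \<longleftrightarrow> (\<lambda>n. p (g n - h n)) \<longlonglongrightarrow> 0" for h
    using null_trans[OF fg, of h] null_trans[OF gf, of h] by (rule iffI[rotated])
  thus ?thesis using f g by (simp add: set_eq_iff compl_rel_iff)
qed

lemma self_in_cls: "f \<in> p_Cauchy p \<Longrightarrow> f \<in> cls f"
  by (simp add: compl_rel_iff)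

lemma cls_in_completion [simp, intro]: "f \<in> p_Cauchy p \<Longrightarrow> cls f \<in> banach_completion p"
  by (simp add: banach_completion_def quotientI)

lemma completionE:
  assumes "x \<in> banach_completion p"
  obtains f where "f \<in> p_Cauchy p" "x = cls f"
  using assms by (auto simp: banach_completion_def elim: quotientE)

lemma completionE2:
  assumes "x \<in> banach_completion p" "y \<in> banach_completion p"
  obtains f g where "f \<in> p_Cauchy p" "x = cls f" "g \<in> p_Cauchy p" "y = cls g"
proof -
  obtain f where f: "f \<in> p_Cauchy p" "x = cls f" using assms(1) by (rule completionE)
  obtain g where g: "g \<in> p_Cauchy p" "y = cls g" using assms(2) by (rule completionE)
  show ?thesis by (rule that[OF f g])
qed

lemma to_completion_eq: "to_completion p v = cls (\<lambda>_. v)"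
  by (simp add: to_completion_def)

lemma to_completion_in [simp, intro]: "to_completion p v \<in> banach_completion p"
  by (simp add: to_completion_eq)

lemma compl_add_cls:
  assumes f: "f \<in> p_Cauchy p" and g: "g \<in> p_Cauchy p"
  shows "compl_add p (cls f) (cls g) = cls (\<lambda>n. f n + g n)"
proof -
  have "cls (\<lambda>n. f' n + g' n) = cls (\<lambda>n. f n + g n)" if "f' \<in> cls f" "g' \<in> cls g" for f' g'
  proof (rule cls_eqI)
    have "(\<lambda>n. p (f n - f' n) + p (g n - g' n)) \<longlonglongrightarrow> 0 + 0"
      using that by (intro tendsto_add) (auto simp: compl_rel_iff)
    hence "(\<lambda>n. p (f n - f' n) + p (g n - g' n)) \<longlonglongrightarrow> 0" by simp
    thus "(\<lambda>n. p (f' n + g' n - (f n + g n))) \<longlonglongrightarrow> 0"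
    proof (rule Lim_null_comparison[rotated])
      show "\<forall>\<^sub>F n in sequentially. norm (p (f' n + g' n - (f n + g n))) \<le> p (f n - f' n) + p (g n - g' n)"
      proof (rule always_eventually, rule allI)
        fix n
        have "p (f' n + g' n - (f n + g n)) = p ((f n - f' n) + (g n - g' n))"
          by (subst p_minus_commute) (simp add: algebra_simps)
        thus "norm (p (f' n + g' n - (f n + g n))) \<le> p (f n - f' n) + p (g n - g' n)"
          using p_triangle by simp
      qed
    qed
  qed (use that f g in \<open>auto simp: compl_rel_iff intro: p_Cauchy_add\<close>)
  moreover have "f \<in> cls f" "g \<in> cls g" by (simp_all add: compl_rel_iff f g)
  ultimately show ?thesis unfolding compl_add_def by blast
qed

lemma compl_scale_cls:
  assumes f: "f \<in> p_Cauchy p"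
  shows "compl_scale M p c (cls f) = cls (\<lambda>n. cscale M c (f n))"
proof -
  have "cls (\<lambda>n. cscale M c (f' n)) = cls (\<lambda>n. cscale M c (f n))" if "f' \<in> cls f" for f'
  proof (rule cls_eqI)
    have "(\<lambda>n. cmod c * p (f n - f' n)) \<longlonglongrightarrow> cmod c * 0"
      using that by (intro tendsto_mult tendsto_const) (auto simp: compl_rel_iff)
    thus "(\<lambda>n. p (cscale M c (f' n) - cscale M c (f n))) \<longlonglongrightarrow> 0"
      by (simp add: p_minus_commute p_scale flip: V.scale_right_diff_distrib)
  qed (use that f in \<open>auto simp: compl_rel_iff intro: p_Cauchy_scale\<close>)
  moreover have "f \<in> cls f" by (simp add: compl_rel_iff f)
  ultimately show ?thesis unfolding compl_scale_def by blast
qed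

lemma compl_add_in [intro]: "x \<in> banach_completion p \<Longrightarrow> y \<in> banach_completion p \<Longrightarrow> compl_add p x y \<in> banach_completion p"
  by (auto elim!: completionE simp: compl_add_cls intro!: cls_in_completion p_Cauchy_add)

lemma to_completion_add: "to_completion p (v + w) = compl_add p (to_completion p v) (to_completion p w)"
  by (simp add: to_completion_eq compl_add_cls)

lemma to_completion_scale: "to_completion p (cscale M c v) = compl_scale M p c (to_completion p v)"
  by (simp add: to_completion_eq compl_scale_cls)

text \<open>Meaningful for Lipschitz \<open>\<phi>\<close>, for which the limit exists and is independent of the representative.\<close>

definition lip_ext :: "('v \<Rightarrow> 'b::topological_space) \<Rightarrow> (nat \<Rightarrow> 'v) set \<Rightarrow> 'b" where
  "lip_ext \<phi> x = (THE r. \<forall>f\<in>x. (\<lambda>n. \<phi> (f n)) \<longlonglongrightarrow> r)"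

lemma tendsto_lip_ext:
  fixes \<phi> :: "'v \<Rightarrow> 'b::banach"
  assumes f: "f \<in> p_Cauchy p" and \<phi>: "\<And>v w. norm (\<phi> v - \<phi> w) \<le> C * p (v - w)"
  shows "(\<lambda>n. \<phi> (f n)) \<longlonglongrightarrow> lip_ext \<phi> (cls f)"
proof -
  obtain r where r: "(\<lambda>n. \<phi> (f n)) \<longlonglongrightarrow> r"
    using p_Cauchy_lipschitz_convergent[OF f \<phi>] by (auto simp: convergent_def)
  have "(\<lambda>n. \<phi> (g n)) \<longlonglongrightarrow> r" if "g \<in> cls f" for g
  proof -
    have "(\<lambda>n. p (f n - g n)) \<longlonglongrightarrow> 0"
      using that by (simp add: compl_rel_iff)
    hence "(\<lambda>n. C * p (f n - g n)) \<longlonglongrightarrow> 0"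
      by (rule tendsto_mult_right_zero)
    hence "(\<lambda>n. \<phi> (f n) - \<phi> (g n)) \<longlonglongrightarrow> 0"
      by (rule Lim_null_comparison[rotated]) (simp add: \<phi>)
    from tendsto_diff[OF r this] show ?thesis by simp
  qed
  hence all: "\<forall>g\<in>cls f. (\<lambda>n. \<phi> (g n)) \<longlonglongrightarrow> r" by blast
  have "lip_ext \<phi> (cls f) = r"
    unfolding lip_ext_def
  proof (rule the_equality)
    fix r' assume "\<forall>g\<in>cls f. (\<lambda>n. \<phi> (g n)) \<longlonglongrightarrow> r'"
    hence "(\<lambda>n. \<phi> (f n)) \<longlonglongrightarrow> r'" using self_in_cls[OF f] by blast
    thus "r' = r" using r by (rule LIMSEQ_unique)
  qed (rule all)
  with r show ?thesis by simp
qed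

section \<open>Norm, metric and topology of the completion\<close>

lemma compl_norm_eq_lip_ext: "compl_norm p = lip_ext p"
  by (simp add: fun_eq_iff compl_norm_def lip_ext_def)

lemma tendsto_compl_norm: "f \<in> p_Cauchy p \<Longrightarrow> (\<lambda>n. p (f n)) \<longlonglongrightarrow> compl_norm p (cls f)"
  unfolding compl_norm_eq_lip_ext by (rule tendsto_lip_ext[where C = 1]) (auto simp: p_diff_bound)

lemma lip_ext_to_completion:
  fixes \<phi> :: "'v \<Rightarrow> 'b::banach"
  assumes "\<And>v w. norm (\<phi> v - \<phi> w) \<le> C * p (v - w)"
  shows "lip_ext \<phi> (to_completion p v) = \<phi> v"
  using tendsto_lip_ext[OF const_p_Cauchy assms, of v] unfolding to_completion_eq
  by (simp add: LIMSEQ_const_iff)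

lemma compl_norm_to_completion [simp]: "compl_norm p (to_completion p v) = p v"
  unfolding compl_norm_eq_lip_ext by (rule lip_ext_to_completion[where C = 1]) (auto simp: p_diff_bound)

text \<open>For any choice of representatives, \<open>f' n - g' n\<close> represents the same
  difference class, so the limits in the definition of the distance exist and agree. This makes the
  description there proper.\<close>

lemma compl_dist_eq_norm:
  assumes "x \<in> banach_completion p" "y \<in> banach_completion p"
  shows "compl_dist p x y = compl_norm p (compl_add p x (compl_scale M p (-1) y))"
proof -
  obtain f g where f: "f \<in> p_Cauchy p" "x = cls f" and g: "g \<in> p_Cauchy p" "y = cls g"
    by (rule completionE2[OF assms])
  define d where "d = compl_norm p (compl_add p x (compl_scale M p (-1) y))"
  have "(\<lambda>n. p (f' n - g' n)) \<longlonglongrightarrow> d" if "f' \<in> cls f" "g' \<in> cls g" for f' g'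
  proof -
    have f': "f' \<in> p_Cauchy p" "(\<lambda>n. p (f n - f' n)) \<longlonglongrightarrow> 0" and g': "g' \<in> p_Cauchy p" "(\<lambda>n. p (g n - g' n)) \<longlonglongrightarrow> 0"
      using that by (auto simp: compl_rel_iff)
    have *: "cls f' = cls f" "cls g' = cls g"
      using cls_eqI[OF f(1) f'] cls_eqI[OF g(1) g'] by simp_all
    note C = f'(1) g'(1)
    have "compl_add p x (compl_scale M p (-1) y) = cls (\<lambda>n. f' n + cscale M (-1) (g' n))"
      unfolding f(2) g(2) *[symmetric] using C by (simp add: compl_scale_cls compl_add_cls p_Cauchy_minus)
    moreover have "(\<lambda>n. p (f' n + cscale M (-1) (g' n))) \<longlonglongrightarrow> compl_norm p (cls (\<lambda>n. f' n + cscale M (-1) (g' n)))"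
      by (rule tendsto_compl_norm[OF p_Cauchy_add[OF C(1) p_Cauchy_scale[OF C(2)]]])
    ultimately show ?thesis by (simp add: d_def)
  qed
  hence all: "\<forall>f'\<in>x. \<forall>g'\<in>y. (\<lambda>n. p (f' n - g' n)) \<longlonglongrightarrow> d" by (auto simp: f g)
  have "(THE r. \<forall>f\<in>x. \<forall>g\<in>y. (\<lambda>n. p (f n - g n)) \<longlonglongrightarrow> r) = d"
  proof (rule the_equality)
    fix r assume "\<forall>f'\<in>x. \<forall>g'\<in>y. (\<lambda>n. p (f' n - g' n)) \<longlonglongrightarrow> r"
    hence "(\<lambda>n. p (f n - g n)) \<longlonglongrightarrow> r" "(\<lambda>n. p (f n - g n)) \<longlonglongrightarrow> d"
      using all self_in_cls[OF f(1)] self_in_cls[OF g(1)] by (auto simp: f g)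
    thus "r = d" by (rule LIMSEQ_unique)
  qed (rule all)
  thus ?thesis using assms by (simp add: compl_dist_def d_def)
qed

lemma tendsto_compl_dist:
  assumes "f \<in> p_Cauchy p" "g \<in> p_Cauchy p"
  shows "(\<lambda>n. p (f n - g n)) \<longlonglongrightarrow> compl_dist p (cls f) (cls g)"
proof -
  have *: "(\<lambda>n. f n + cscale M (-1) (g n)) \<in> p_Cauchy p"
    by (intro p_Cauchy_add p_Cauchy_scale assms)
  have "compl_dist p (cls f) (cls g) = compl_norm p (cls (\<lambda>n. f n + cscale M (-1) (g n)))"
    by (simp only: compl_dist_eq_norm[OF cls_in_completion[OF assms(1)] cls_in_completion[OF assms(2)]]
        compl_scale_cls[OF assms(2)] compl_add_cls[OF assms(1) p_Cauchy_scale[OF assms(2)]])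
  thus ?thesis using tendsto_compl_norm[OF *] by simp
qed

sublocale C: Metric_space "banach_completion p" "compl_dist p"
proof
  fix x y
  show "0 \<le> compl_dist p x y"
  proof (cases "x \<in> banach_completion p \<and> y \<in> banach_completion p")
    case True
    then obtain f g where "f \<in> p_Cauchy p" "x = cls f" "g \<in> p_Cauchy p" "y = cls g"
      by (elim conjE) (rule completionE2)
    hence "(\<lambda>n. p (f n - g n)) \<longlonglongrightarrow> compl_dist p x y" using tendsto_compl_dist by simp
    thus ?thesis by (rule tendsto_lowerbound) simp_all
  qed (auto simp: compl_dist_def)
  show "compl_dist p x y = compl_dist p y x"
  proof (cases "x \<in> banach_completion p \<and> y \<in> banach_completion p")
    case True
    then obtain f g where "f \<in> p_Cauchy p" "x = cls f" "g \<in> p_Cauchy p" "y = cls g"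
      by (elim conjE) (rule completionE2)
    hence "(\<lambda>n. p (f n - g n)) \<longlonglongrightarrow> compl_dist p x y" "(\<lambda>n. p (g n - f n)) \<longlonglongrightarrow> compl_dist p y x"
      using tendsto_compl_dist by simp_all
    moreover have "(\<lambda>n. p (g n - f n)) = (\<lambda>n. p (f n - g n))"
      by (rule ext) (rule p_minus_commute)
    ultimately show ?thesis using LIMSEQ_unique by metis
  qed (auto simp: compl_dist_def)
next
  fix x y assume "x \<in> banach_completion p" "y \<in> banach_completion p"
  then obtain f g where fg: "f \<in> p_Cauchy p" "x = cls f" "g \<in> p_Cauchy p" "y = cls g"
    by (rule completionE2)
  show "compl_dist p x y = 0 \<longleftrightarrow> x = y"
  proof
    assume "compl_dist p x y = 0"
    hence "(\<lambda>n. p (f n - g n)) \<longlonglongrightarrow> 0" using tendsto_compl_dist[OF fg(1,3)] fg by simp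
    thus "x = y" unfolding fg by (rule cls_eqI[OF fg(1,3)])
  next
    assume "x = y"
    thus "compl_dist p x y = 0" using tendsto_compl_dist[OF fg(1,1)] fg by (simp add: LIMSEQ_const_iff)
  qed
next
  fix x y z assume xyz: "x \<in> banach_completion p" "y \<in> banach_completion p" "z \<in> banach_completion p"
  obtain f g where fg: "f \<in> p_Cauchy p" "x = cls f" "g \<in> p_Cauchy p" "y = cls g"
    by (rule completionE2[OF xyz(1,2)])
  obtain h where h: "h \<in> p_Cauchy p" "z = cls h" by (rule completionE[OF xyz(3)])
  show "compl_dist p x z \<le> compl_dist p x y + compl_dist p y z"
    unfolding fg h
    by (rule LIMSEQ_le[OF tendsto_compl_dist[OF fg(1) h(1)] tendsto_add[OF tendsto_compl_dist[OF fg(1,3)] tendsto_compl_dist[OF fg(3) h(1)]]])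
       (simp add: p_triangle_sub)
qed

lemma topspace_compl_topology [simp]: "topspace (compl_topology p) = banach_completion p"
  by (simp add: compl_topology_def)

text \<open>Density of \<open>V\<close> along a given representative, in the form that carries
  identities from \<open>V\<close> to the completion by continuity.\<close>

lemma limitin_to_completion:
  assumes f: "f \<in> p_Cauchy p"
  shows "limitin (compl_topology p) (\<lambda>i. to_completion p (f i)) (cls f) sequentially"
  unfolding compl_topology_def C.limit_metric_sequentially
proof (intro conjI allI impI)
  fix e :: real assume "e > 0"
  hence "e / 2 > 0" by simp
  then obtain N where N: "\<And>m n. m \<ge> N \<Longrightarrow> n \<ge> N \<Longrightarrow> p (f m - f n) < e / 2"
    using p_CauchyD[OF f] by blast
  have "compl_dist p (to_completion p (f i)) (cls f) < e" if "i \<ge> N" for i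
  proof -
    have "(\<lambda>n. p (f i - f n)) \<longlonglongrightarrow> compl_dist p (to_completion p (f i)) (cls f)"
      unfolding to_completion_eq by (rule tendsto_compl_dist[OF const_p_Cauchy f])
    moreover have "\<forall>\<^sub>F n in sequentially. p (f i - f n) \<le> e / 2"
      using N[OF that] by (intro eventually_sequentiallyI[of N]) (simp add: less_imp_le)
    ultimately have "compl_dist p (to_completion p (f i)) (cls f) \<le> e / 2"
      by (rule tendsto_upperbound) auto
    thus ?thesis using \<open>e > 0\<close> by simp
  qed
  thus "\<exists>N. \<forall>n\<ge>N. to_completion p (f n) \<in> banach_completion p \<and> compl_dist p (to_completion p (f n)) (cls f) < e"
    by auto
qed (use f in auto)

text \<open>In the limit the extension inherits the Lipschitz constant of \<open>\<phi>\<close>;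
  balls of radius \<open>e / (\<bar>C\<bar> + 1)\<close> then suffice for every sign of
  \<open>C\<close>.\<close>

lemma continuous_map_lip_ext:
  fixes \<phi> :: "'v \<Rightarrow> 'b::banach"
  assumes \<phi>: "\<And>v w. norm (\<phi> v - \<phi> w) \<le> C * p (v - w)"
  shows "continuous_map (compl_topology p) euclidean (lip_ext \<phi>)"
proof -
  have lip: "norm (lip_ext \<phi> x - lip_ext \<phi> y) \<le> C * compl_dist p x y"
    if xy: "x \<in> banach_completion p" "y \<in> banach_completion p" for x y
  proof -
    from xy obtain f g where fg: "f \<in> p_Cauchy p" "x = cls f" "g \<in> p_Cauchy p" "y = cls g"
      by (rule completionE2)
    have 1: "(\<lambda>n. norm (\<phi> (f n) - \<phi> (g n))) \<longlonglongrightarrow> norm (lip_ext \<phi> x - lip_ext \<phi> y)"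
      unfolding fg by (rule tendsto_norm[OF tendsto_diff[OF tendsto_lip_ext[OF fg(1) \<phi>] tendsto_lip_ext[OF fg(3) \<phi>]]])
    have 2: "(\<lambda>n. C * p (f n - g n)) \<longlonglongrightarrow> C * compl_dist p x y"
      unfolding fg by (rule tendsto_mult_left[OF tendsto_compl_dist[OF fg(1,3)]])
    show ?thesis by (rule LIMSEQ_le[OF 1 2]) (simp add: \<phi>)
  qed
  show ?thesis
    unfolding continuous_map_def
  proof (intro conjI allI impI)
    fix U :: "'b set" assume "openin euclidean U"
    hence U: "open U" by simp
    show "openin (compl_topology p) {x \<in> topspace (compl_topology p). lip_ext \<phi> x \<in> U}"
      unfolding compl_topology_def C.openin_mtopology
    proof (intro conjI allI impI)
      fix x assume "x \<in> {x \<in> topspace C.mtopology. lip_ext \<phi> x \<in> U}"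
      hence x: "x \<in> banach_completion p" "lip_ext \<phi> x \<in> U" by auto
      then obtain e where e: "e > 0" "\<And>z. dist z (lip_ext \<phi> x) < e \<Longrightarrow> z \<in> U"
        using U by (auto simp: open_dist)
      define r where "r = e / (\<bar>C\<bar> + 1)"
      have r: "r > 0" using e by (simp add: r_def add_nonneg_pos)
      have "lip_ext \<phi> y \<in> U" if y: "y \<in> banach_completion p" "compl_dist p x y < r" for y
      proof (rule e(2))
        have "dist (lip_ext \<phi> y) (lip_ext \<phi> x) \<le> C * compl_dist p x y"
          using lip[OF x(1) y(1)] by (simp add: dist_norm norm_minus_commute)
        also have "\<dots> \<le> (\<bar>C\<bar> + 1) * compl_dist p x y" by (intro mult_right_mono) auto
        also have "\<dots> < e" using y(2) by (simp add: r_def field_simps add_nonneg_pos)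
        finally show "dist (lip_ext \<phi> y) (lip_ext \<phi> x) < e" .
      qed
      thus "\<exists>r>0. C.mball x r \<subseteq> {x \<in> topspace C.mtopology. lip_ext \<phi> x \<in> U}"
        using r by (intro exI[of _ r]) auto
    qed auto
  qed simp
qed

lemma lip_ext_add:
  fixes \<phi> :: "'v \<Rightarrow> 'b::banach"
  assumes \<phi>: "\<And>v w. norm (\<phi> v - \<phi> w) \<le> C * p (v - w)" and add: "\<And>v w. \<phi> (v + w) = \<phi> v + \<phi> w"
    and xy: "x \<in> banach_completion p" "y \<in> banach_completion p"
  shows "lip_ext \<phi> (compl_add p x y) = lip_ext \<phi> x + lip_ext \<phi> y"
proof -
  from xy obtain f g where fg: "f \<in> p_Cauchy p" "x = cls f" "g \<in> p_Cauchy p" "y = cls g"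
    by (rule completionE2)
  have 1: "(\<lambda>n. \<phi> (f n + g n)) \<longlonglongrightarrow> lip_ext \<phi> x + lip_ext \<phi> y"
    unfolding fg add by (rule tendsto_add[OF tendsto_lip_ext[OF fg(1) \<phi>] tendsto_lip_ext[OF fg(3) \<phi>]])
  have 2: "(\<lambda>n. \<phi> (f n + g n)) \<longlonglongrightarrow> lip_ext \<phi> (compl_add p x y)"
    unfolding fg(2,4) compl_add_cls[OF fg(1,3)] by (rule tendsto_lip_ext[OF p_Cauchy_add[OF fg(1,3)] \<phi>])
  show ?thesis using LIMSEQ_unique[OF 2 1] .
qed

lemma lip_ext_scale:
  fixes \<phi> :: "'v \<Rightarrow> complex"
  assumes \<phi>: "\<And>v w. norm (\<phi> v - \<phi> w) \<le> C * p (v - w)" and scale: "\<And>c v. \<phi> (cscale M c v) = c * \<phi> v"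
    and x: "x \<in> banach_completion p"
  shows "lip_ext \<phi> (compl_scale M p c x) = c * lip_ext \<phi> x"
proof -
  from x obtain f where f: "f \<in> p_Cauchy p" "x = cls f"
    by (rule completionE)
  have 1: "(\<lambda>n. \<phi> (cscale M c (f n))) \<longlonglongrightarrow> c * lip_ext \<phi> x"
    unfolding f(2) scale by (rule tendsto_mult_left[OF tendsto_lip_ext[OF f(1) \<phi>]])
  have 2: "(\<lambda>n. \<phi> (cscale M c (f n))) \<longlonglongrightarrow> lip_ext \<phi> (compl_scale M p c x)"
    unfolding f(2) compl_scale_cls[OF f(1)] by (rule tendsto_lip_ext[OF p_Cauchy_scale[OF f(1)] \<phi>])
  show ?thesis using LIMSEQ_unique[OF 2 1] .
qed

end

section \<open>Isometric globalizations\<close>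

lemma mexp_0: "mexp 0 = mat 1"
  using mexp_H[of 0] by (simp add: mat_1_mat2)

text \<open>Used for \<open>p\<close>, and also for \<open>q\<close>: there it provides the skewness
  of the Lie algebra action for the inner product.\<close>

locale isometric_globalization = normed_module M p
  for M :: "'v::ab_group_add gK" and p :: "'v \<Rightarrow> real" +
  fixes \<pi> :: "real^2^2 \<Rightarrow> (nat \<Rightarrow> 'v) set \<Rightarrow> (nat \<Rightarrow> 'v) set"
  assumes glob: "globalization M p \<pi>"
    and iso: "g \<in> SL2 \<Longrightarrow> compl_norm p (\<pi> g (to_completion p v)) = p v"
begin

lemma rep: "continuous_rep M p \<pi>"
  using glob unfolding globalization_def by (elim conjE)

lemmas rep_conjuncts = rep[unfolded continuous_rep_def]

lemma rep_in: "g \<in> SL2 \<Longrightarrow> x \<in> banach_completion p \<Longrightarrow> \<pi> g x \<in> banach_completion p"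
  by (rule bspec[OF bspec[OF rep_conjuncts[THEN conjunct1]]])

lemma rep_add: "\<lbrakk>g \<in> SL2; x \<in> banach_completion p; y \<in> banach_completion p\<rbrakk> \<Longrightarrow>
        \<pi> g (compl_add p x y) = compl_add p (\<pi> g x) (\<pi> g y)"
  by (rule bspec[OF bspec[OF bspec[OF rep_conjuncts[THEN conjunct2, THEN conjunct1]]]])

lemma rep_scale: "\<lbrakk>g \<in> SL2; x \<in> banach_completion p\<rbrakk> \<Longrightarrow>
        \<pi> g (compl_scale M p c x) = compl_scale M p c (\<pi> g x)"
  by (rule bspec[OF spec[OF bspec[OF rep_conjuncts[THEN conjunct2, THEN conjunct2, THEN conjunct1]]]])

lemma rep_one: "x \<in> banach_completion p \<Longrightarrow> \<pi> (mat 1) x = x"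
  by (rule bspec[OF rep_conjuncts[THEN conjunct2, THEN conjunct2, THEN conjunct2, THEN conjunct1]])

lemma rep_mult: "\<lbrakk>g \<in> SL2; h \<in> SL2; x \<in> banach_completion p\<rbrakk> \<Longrightarrow> \<pi> (g ** h) x = \<pi> g (\<pi> h x)"
  by (rule bspec[OF bspec[OF bspec[OF rep_conjuncts[THEN conjunct2, THEN conjunct2, THEN conjunct2, THEN conjunct2, THEN conjunct1]]]])

lemma rep_continuous: "continuous_map (prod_topology (top_of_set SL2) (compl_topology p)) (compl_topology p)
       (\<lambda>(g, x). \<pi> g x)"
  by (rule rep_conjuncts[THEN conjunct2, THEN conjunct2, THEN conjunct2, THEN conjunct2, THEN conjunct2])

lemma rep_K: "k \<in> SO2 \<Longrightarrow> \<pi> k (to_completion p v) = to_completion p (K_act M k v)"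
  by (rule spec[OF bspec[OF glob[unfolded globalization_def, THEN conjunct2, THEN conjunct2, THEN conjunct1]]])

lemma rep_derivative: "X \<in> sl2 \<Longrightarrow> limitin (compl_topology p)
        (\<lambda>t. compl_scale M p (complex_of_real (1 / t))
                (compl_add p (\<pi> (mexp (t *\<^sub>R X)) (to_completion p v)) (to_completion p (- v))))
        (to_completion p (lie_act M X v)) (at 0)"
  by (rule spec[OF bspec[OF glob[unfolded globalization_def, THEN conjunct2, THEN conjunct2, THEN conjunct2]]])

lemma continuous_map_rep:
  assumes "g \<in> SL2"
  shows "continuous_map (compl_topology p) (compl_topology p) (\<pi> g)"
proof -
  have "continuous_map (compl_topology p) (prod_topology (top_of_set SL2) (compl_topology p)) (\<lambda>x. (g, x))"
    using assms by (intro continuous_map_pairedI) auto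
  from continuous_map_compose[OF this rep_continuous] show ?thesis by (simp add: o_def)
qed

lemma p_K_act [simp]: "k \<in> SO2 \<Longrightarrow> p (K_act M k v) = p v"
  using iso[of k v] SO2_subset_SL2 by (auto simp: rep_K)

text \<open>The vector \<open>\<pi> g v\<close> lies in the completion and in general not in
  \<open>V\<close>, so \<open>\<phi>\<close> is applied through its continuous extension.\<close>

definition matrix_coeff :: "('v \<Rightarrow> complex) \<Rightarrow> real^2^2 \<Rightarrow> 'v \<Rightarrow> complex" where
  "matrix_coeff \<phi> g v = lip_ext \<phi> (\<pi> g (to_completion p v))"

text \<open>One sequence \<open>w\<close> in \<open>V\<close> approximates \<open>\<pi> g v\<close>
  for the norm and for all Lipschitz functionals at once. Estimates proved on \<open>V\<close> can
  thus be applied to \<open>w i\<close> before passing to the limit.\<close>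

lemma matrix_coeff_approx:
  assumes "g \<in> SL2"
  obtains w where "(\<lambda>i. p (w i)) \<longlonglongrightarrow> p v"
    "\<And>\<phi> C. (\<And>u u'. cmod (\<phi> u - \<phi> u') \<le> C * p (u - u')) \<Longrightarrow> (\<lambda>i. \<phi> (w i)) \<longlonglongrightarrow> matrix_coeff \<phi> g v"
proof -
  have "\<pi> g (to_completion p v) \<in> banach_completion p" by (intro rep_in assms to_completion_in)
  then obtain w where w: "w \<in> p_Cauchy p" "\<pi> g (to_completion p v) = cls w" by (rule completionE)
  show ?thesis
  proof (rule that[of w])
    show "(\<lambda>i. p (w i)) \<longlonglongrightarrow> p v"
      using tendsto_compl_norm[OF w(1)] iso[OF assms, of v] by (simp add: w)
    show "(\<lambda>i. \<phi> (w i)) \<longlonglongrightarrow> matrix_coeff \<phi> g v"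
      if "\<And>u u'. cmod (\<phi> u - \<phi> u') \<le> C * p (u - u')" for \<phi> C
      using tendsto_lip_ext[OF w(1) that] by (simp add: matrix_coeff_def w)
  qed
qed

context
  fixes \<phi> :: "'v \<Rightarrow> complex" and C :: real
  assumes \<phi>_add: "\<And>v w. \<phi> (v + w) = \<phi> v + \<phi> w"
    and \<phi>_scale: "\<And>c v. \<phi> (cscale M c v) = c * \<phi> v"
    and \<phi>_bound: "\<And>v. cmod (\<phi> v) \<le> C * p v"
begin

lemma \<phi>_lip: "cmod (\<phi> v - \<phi> w) \<le> C * p (v - w)"
proof -
  have "\<phi> (v - w) = \<phi> v + \<phi> (cscale M (-1) w)"
    using \<phi>_add[of v "- w"] by simp
  hence "\<phi> (v - w) = \<phi> v - \<phi> w" by (simp add: \<phi>_scale del: V.scale_minus_left)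
  thus ?thesis using \<phi>_bound[of "v - w"] by simp
qed

lemma matrix_coeff_one: "matrix_coeff \<phi> (mat 1) v = \<phi> v"
  by (simp add: matrix_coeff_def rep_one lip_ext_to_completion[OF \<phi>_lip])

lemma matrix_coeff_add: "g \<in> SL2 \<Longrightarrow> matrix_coeff \<phi> g (v + w) = matrix_coeff \<phi> g v + matrix_coeff \<phi> g w"
  by (simp add: matrix_coeff_def to_completion_add rep_add rep_in lip_ext_add[OF \<phi>_lip \<phi>_add])

lemma matrix_coeff_scale: "g \<in> SL2 \<Longrightarrow> matrix_coeff \<phi> g (cscale M c v) = c * matrix_coeff \<phi> g v"
  by (simp add: matrix_coeff_def to_completion_scale rep_scale rep_in lip_ext_scale[OF \<phi>_lip \<phi>_scale])

text \<open>The difference quotient converges in the completion to the action of \<open>X\<close>,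
  and \<open>lip_ext \<phi> \<circ> \<pi> g\<close> is linear and continuous. Translation on the
  right is what turns the derivative into the Lie algebra action on \<open>v\<close>.\<close>

lemma matrix_coeff_derivative:
  assumes X: "X \<in> sl2" "\<And>t. mexp (t *\<^sub>R X) \<in> SL2" and g: "g \<in> SL2"
  shows "((\<lambda>t. matrix_coeff \<phi> (g ** mexp (t *\<^sub>R X)) v) has_vector_derivative matrix_coeff \<phi> g (lie_act M X v)) (at 0)"
proof -
  define D where "D t = compl_scale M p (complex_of_real (1 / t))
                (compl_add p (\<pi> (mexp (t *\<^sub>R X)) (to_completion p v)) (to_completion p (- v)))" for t
  define f where "f t = matrix_coeff \<phi> (g ** mexp (t *\<^sub>R X)) v" for t
  have cont: "continuous_map (compl_topology p) euclidean (lip_ext \<phi> \<circ> \<pi> g)"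
    by (rule continuous_map_compose[OF continuous_map_rep[OF g] continuous_map_lip_ext[OF \<phi>_lip]])
  have lim: "((\<lambda>t. lip_ext \<phi> (\<pi> g (D t)))
     \<longlongrightarrow> matrix_coeff \<phi> g (lie_act M X v)) (at 0)"
    using continuous_map_limit[OF cont rep_derivative[OF X(1)], of v]
    by (simp add: o_def matrix_coeff_def D_def)
  have "lip_ext \<phi> (\<pi> g (D t))
      = complex_of_real (1 / t) * (f t - f 0)" for t
  proof -
    note in1 = rep_in[OF X(2) to_completion_in, of t v]
    note in2 = to_completion_in[of "- v"]
    have "lip_ext \<phi> (\<pi> g (D t))
      = complex_of_real (1 / t) * (lip_ext \<phi> (\<pi> g (\<pi> (mexp (t *\<^sub>R X)) (to_completion p v))) + lip_ext \<phi> (\<pi> g (to_completion p (- v))))"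
      by (simp only: D_def rep_scale[OF g compl_add_in[OF in1 in2]] rep_add[OF g in1 in2]
          lip_ext_scale[OF \<phi>_lip \<phi>_scale compl_add_in[OF rep_in[OF g in1] rep_in[OF g in2]]]
          lip_ext_add[OF \<phi>_lip \<phi>_add rep_in[OF g in1] rep_in[OF g in2]])
    also have "lip_ext \<phi> (\<pi> g (\<pi> (mexp (t *\<^sub>R X)) (to_completion p v))) = f t"
      by (simp add: f_def matrix_coeff_def rep_mult[OF g X(2)])
    also have "lip_ext \<phi> (\<pi> g (to_completion p (- v))) = matrix_coeff \<phi> g (cscale M (-1) v)"
      by (simp add: matrix_coeff_def)
    also have "\<dots> = - f 0"
      by (simp add: f_def matrix_coeff_scale[OF g] mexp_0 del: V.scale_minus_left)
    finally show ?thesis by simp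
  qed
  with lim have "((\<lambda>t. complex_of_real (1 / t) * (f t - f 0)) \<longlongrightarrow> matrix_coeff \<phi> g (lie_act M X v)) (at 0)"
    by simp
  from tendsto_norm_zero[OF LIM_zero[OF this]]
  have "((\<lambda>h. cmod (f h - f 0 - h *\<^sub>R matrix_coeff \<phi> g (lie_act M X v)) / \<bar>h\<bar>) \<longlongrightarrow> 0) (at 0)"
  proof (rule Lim_transform_eventually)
    have "cmod (complex_of_real (1 / h) * (f h - f 0) - L) = cmod (f h - f 0 - h *\<^sub>R L) / \<bar>h\<bar>" if "h \<noteq> 0" for h :: real and L
    proof -
      have "complex_of_real (1 / h) * (f h - f 0) - L = (f h - f 0 - h *\<^sub>R L) / complex_of_real h"
        using that by (simp add: scaleR_conv_of_real diff_divide_distrib)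
      thus ?thesis by (simp add: norm_divide)
    qed
    thus "\<forall>\<^sub>F h in at 0. cmod (complex_of_real (1 / h) * (f h - f 0) - matrix_coeff \<phi> g (lie_act M X v)) =
        cmod (f h - f 0 - h *\<^sub>R matrix_coeff \<phi> g (lie_act M X v)) / \<bar>h\<bar>"
      by (intro eventually_mono[OF eventually_neq_at_within]) simp
  qed
  hence "(f has_vector_derivative matrix_coeff \<phi> g (lie_act M X v)) (at 0)"
    by (simp add: has_vector_derivative_def has_derivative_at bounded_linear_scaleR_left)
  thus ?thesis unfolding f_def [abs_def] .
qed

text \<open>On \<open>V\<close> the operator \<open>\<pi> k\<close> is the module action, where
  equivariance is assumed; continuity of \<open>\<pi> k\<close> extends it to
  \<open>\<pi> g v\<close> by density.\<close>

lemma matrix_coeff_K_left: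
  assumes k: "k \<in> SO2" and z: "\<And>v. \<phi> (K_act M k v) = z * \<phi> v" and g: "g \<in> SL2"
  shows "matrix_coeff \<phi> (k ** g) v = z * matrix_coeff \<phi> g v"
proof -
  have k': "k \<in> SL2" using k SO2_subset_SL2 by blast
  have "\<pi> g (to_completion p v) \<in> banach_completion p" by (intro rep_in g to_completion_in)
  then obtain w where w: "w \<in> p_Cauchy p" "\<pi> g (to_completion p v) = cls w" by (rule completionE)
  have "limitin euclidean ((lip_ext \<phi> \<circ> \<pi> k) \<circ> (\<lambda>i. to_completion p (w i))) ((lip_ext \<phi> \<circ> \<pi> k) (cls w)) sequentially"
    by (rule continuous_map_limit[OF continuous_map_compose[OF continuous_map_rep[OF k'] continuous_map_lip_ext[OF \<phi>_lip]] limitin_to_completion[OF w(1)]])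
  hence "(\<lambda>i. z * \<phi> (w i)) \<longlonglongrightarrow> lip_ext \<phi> (\<pi> k (cls w))"
    by (simp add: o_def rep_K[OF k] lip_ext_to_completion[OF \<phi>_lip] z)
  moreover have "(\<lambda>i. z * \<phi> (w i)) \<longlonglongrightarrow> z * lip_ext \<phi> (cls w)"
    by (rule tendsto_mult_left[OF tendsto_lip_ext[OF w(1) \<phi>_lip]])
  ultimately have "lip_ext \<phi> (\<pi> k (cls w)) = z * lip_ext \<phi> (cls w)"
    by (rule LIMSEQ_unique)
  thus ?thesis
    by (simp add: matrix_coeff_def w(2) rep_mult[OF k' g to_completion_in])
qed

end

lemma compl_norm_diff_le:
  assumes "x \<in> banach_completion p" "y \<in> banach_completion p"
  shows "\<bar>compl_norm p x - compl_norm p y\<bar> \<le> compl_dist p x y"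
proof -
  obtain f g where fg: "f \<in> p_Cauchy p" "x = cls f" "g \<in> p_Cauchy p" "y = cls g"
    by (rule completionE2[OF assms])
  show ?thesis unfolding fg
    by (rule LIMSEQ_le[OF tendsto_rabs[OF tendsto_diff[OF tendsto_compl_norm[OF fg(1)] tendsto_compl_norm[OF fg(3)]]]
          tendsto_compl_dist[OF fg(1,3)]]) (simp add: p_diff_bound)
qed

text \<open>By isometry, \<open>p v\<close> is the norm of \<open>\<pi> (mexp (t X)) v = v + t X v + o(t)\<close>.\<close>

lemma p_first_order:
  assumes X: "X \<in> sl2" "\<And>t. mexp (t *\<^sub>R X) \<in> SL2"
  shows "((\<lambda>t. (p (v + cscale M (complex_of_real t) (lie_act M X v)) - p v) / t) \<longlongrightarrow> 0) (at 0)"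
proof -
  define D where "D t = compl_scale M p (complex_of_real (1 / t))
                (compl_add p (\<pi> (mexp (t *\<^sub>R X)) (to_completion p v)) (to_completion p (- v)))" for t
  define Z where "Z = to_completion p (lie_act M X v)"
  have "((\<lambda>t. compl_dist p (D t) Z) \<longlongrightarrow> 0) (at 0)"
    using rep_derivative[OF X(1), of v]
    unfolding compl_topology_def C.limitin_metric_dist_null D_def Z_def by simp
  moreover have "\<forall>\<^sub>F t in at 0. norm ((p (v + cscale M (complex_of_real t) (lie_act M X v)) - p v) / t) \<le> compl_dist p (D t) Z"
  proof (rule eventually_mono[OF eventually_at_ball'[of 1 "0::real" UNIV]])
    fix t :: real assume "t \<in> ball 0 1 \<and> t \<noteq> 0 \<and> t \<in> UNIV"
    hence t: "t \<noteq> 0" by simp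
    have "\<pi> (mexp (t *\<^sub>R X)) (to_completion p v) \<in> banach_completion p" by (intro rep_in X to_completion_in)
    then obtain f where f: "f \<in> p_Cauchy p" "\<pi> (mexp (t *\<^sub>R X)) (to_completion p v) = cls f" by (rule completionE)
    define u where "u = v + cscale M (complex_of_real t) (lie_act M X v)"
    have Df: "D t = cls (\<lambda>n. cscale M (complex_of_real (1 / t)) (f n + - v))"
      unfolding D_def f(2) unfolding to_completion_eq compl_add_cls[OF f(1) const_p_Cauchy]
      by (rule compl_scale_cls[OF p_Cauchy_add[OF f(1) const_p_Cauchy]])
    have "(\<lambda>n. p (cscale M (complex_of_real (1 / t)) (f n + - v) - lie_act M X v)) \<longlonglongrightarrow> compl_dist p (D t) Z"
      unfolding Df Z_def to_completion_eq
      by (rule tendsto_compl_dist[OF p_Cauchy_scale[OF p_Cauchy_add[OF f(1) const_p_Cauchy]] const_p_Cauchy])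
    hence "(\<lambda>n. \<bar>t\<bar> * p (cscale M (complex_of_real (1 / t)) (f n + - v) - lie_act M X v)) \<longlonglongrightarrow> \<bar>t\<bar> * compl_dist p (D t) Z"
      by (rule tendsto_mult_left)
    \<comment> \<open>Multiplication by \<open>t\<close> turns the distance between the difference
      quotient and \<open>lie_act M X v\<close> into the distance between
      \<open>\<pi> (mexp (t *\<^sub>R X)) v\<close> and \<open>u\<close>, elements of norm
      \<open>p v\<close> and \<open>p u\<close>.\<close>
    moreover have "\<bar>t\<bar> * p (cscale M (complex_of_real (1 / t)) (f n + - v) - lie_act M X v) = p (f n - u)" for n
    proof -
      have "\<bar>t\<bar> * p (cscale M (complex_of_real (1 / t)) (f n + - v) - lie_act M X v)
          = p (cscale M (complex_of_real t) (cscale M (complex_of_real (1 / t)) (f n + - v) - lie_act M X v))"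
        by (simp add: p_scale)
      also have "cscale M (complex_of_real t) (cscale M (complex_of_real (1 / t)) (f n + - v) - lie_act M X v) = f n - u"
        using t by (simp add: V.scale_right_diff_distrib u_def del: of_real_divide flip: of_real_mult)
      finally show ?thesis .
    qed
    ultimately have "(\<lambda>n. p (f n - u)) \<longlonglongrightarrow> \<bar>t\<bar> * compl_dist p (D t) Z" by simp
    moreover have "(\<lambda>n. p (f n - u)) \<longlonglongrightarrow> compl_dist p (cls f) (to_completion p u)"
      unfolding to_completion_eq by (rule tendsto_compl_dist[OF f(1) const_p_Cauchy])
    ultimately have *: "\<bar>t\<bar> * compl_dist p (D t) Z = compl_dist p (cls f) (to_completion p u)"
      by (rule LIMSEQ_unique)
    have "\<bar>p v - p u\<bar> \<le> compl_dist p (cls f) (to_completion p u)"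
      using compl_norm_diff_le[OF cls_in_completion[OF f(1)] to_completion_in[of u]] iso[OF X(2), of t v]
      by (simp add: f(2))
    hence "\<bar>p u - p v\<bar> \<le> \<bar>t\<bar> * compl_dist p (D t) Z" by (simp add: * abs_minus_commute)
    thus "norm ((p u - p v) / t) \<le> compl_dist p (D t) Z"
      using t by (simp add: abs_divide pos_divide_le_eq mult.commute)
  qed simp
  ultimately show ?thesis by (rule Lim_null_comparison[rotated])
qed

end

section \<open>The Lie algebra action on \<open>K\<close>-types\<close>

lemma cis_DERIV: "((\<lambda>t. cis (a * t)) has_vector_derivative (\<i> * a * cis (a * t))) (at t)"
proof -
  have "((\<lambda>t. exp (\<i> * complex_of_real (a * t))) has_vector_derivative (\<i> * a * exp (\<i> * complex_of_real (a * t)))) (at t)"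
    by (auto intro!: derivative_eq_intros has_vector_derivative_real_field simp: mult_ac)
  thus ?thesis by (simp add: cis_conv_exp)
qed

text \<open>Supplies the functionals used to test equality of vectors and membership in a
  finite-dimensional span, where \<open>V\<close> itself has no topology.\<close>

lemma (in vector_space) functional_extend:
  assumes B: "independent B" and x: "x \<notin> span B"
  shows "\<exists>l. (\<forall>v w. l (v + w) = l v + l w) \<and> (\<forall>c v. l (scale c v) = c * l v) \<and>
    (\<forall>v\<in>span B. l v = 0) \<and> l x = 1"
proof -
  interpret P: vector_space_pair scale "(*)"
    by unfold_locales (auto simp: algebra_simps)
  have "independent (insert x B)" using B x by (rule independent_insertI[rotated])
  from P.linear_independent_extend[OF this, of "\<lambda>b. if b = x then 1 else 0"]
  obtain l where l: "Vector_Spaces.linear scale (*) l" "\<forall>b\<in>insert x B. l b = (if b = x then 1 else 0)"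
    by blast
  interpret l: Vector_Spaces.linear scale "(*)" l by (rule l(1))
  have "x \<notin> B" using x span_base by blast
  hence "l b = 0" if "b \<in> B" for b using that l(2) by auto
  hence "l v = 0" if "v \<in> span B" for v using that l.eq_0_on_span by blast
  thus ?thesis using l(2) by (intro exI[of _ l]) (simp add: l.add l.scale)
qed

text \<open>Inside a finite-dimensional space the iterates of \<open>T\<close> on \<open>v\<close>
  satisfy a polynomial relation. In a relation of least degree split off a linear factor; the
  remaining factor, evaluated at \<open>T\<close> and applied to \<open>v\<close>, is a nonzero
  eigenvector. \<open>E P\<close> stands for \<open>P(T) v\<close>.\<close>

lemma (in vector_space) eigenvector_exists:
  fixes T :: "'b \<Rightarrow> 'b"
  assumes c: "(\<And>P :: 'a poly. degree P > 0 \<Longrightarrow> \<exists>z. poly P z = 0)"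
    and T: "\<And>v w. T (v + w) = T v + T w" "\<And>c v. T (scale c v) = scale c (T v)"
    and U: "subspace U" "\<And>v. v \<in> U \<Longrightarrow> T v \<in> U" "U \<subseteq> span B" "finite B"
    and v: "v \<in> U" "v \<noteq> 0"
  obtains u z where "u \<in> U" "u \<noteq> 0" "T u = scale z u"
proof -
  interpret T: Vector_Spaces.linear scale scale T
    by unfold_locales (auto simp: T)
  define E where "E P = (\<Sum>i\<le>degree P. scale (coeff P i) ((T ^^ i) v))" for P
  have E_le: "E P = (\<Sum>i\<le>n. scale (coeff P i) ((T ^^ i) v))" if "degree P \<le> n" for P n
    unfolding E_def using that by (intro sum.mono_neutral_left) (auto simp: coeff_eq_0)
  have E_add: "E (P + Q) = E P + E Q" for P Q
    using degree_add_le[of P "max (degree P) (degree Q)" Q]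
    by (simp add: E_le[of _ "max (degree P) (degree Q)"] scale_left_distrib sum.distrib)
  have E_smult: "E (smult c P) = scale c (E P)" for c P
    by (simp add: E_le[of _ "degree P"] scale_sum_right degree_smult_le)
  have E_pCons: "E (pCons 0 P) = T (E P)" for P
  proof -
    have "E (pCons 0 P) = (\<Sum>i\<le>Suc (degree P). scale (coeff (pCons 0 P) i) ((T ^^ i) v))"
      by (rule E_le) (rule degree_pCons_le)
    also have "\<dots> = T (E P)" by (simp add: sum.atMost_Suc_shift E_def T.sum T.scale del: sum.atMost_Suc)
    finally show ?thesis .
  qed
  have pow_U: "(T ^^ i) v \<in> U" for i by (induction i) (auto simp: U v)
  have E_U: "E P \<in> U" for P unfolding E_def by (intro subspace_sum subspace_scale U pow_U)
  \<comment> \<open>Dependence is a notion for sets, so a repetition among the iterates is treated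
    separately: it is annihilated by a difference of two monomials.\<close>
  have "\<exists>P. P \<noteq> 0 \<and> E P = 0"
  proof (cases "inj_on (\<lambda>i. (T ^^ i) v) {..card B}")
    case True
    let ?S = "(\<lambda>i. (T ^^ i) v) ` {..card B}"
    have "card ?S = card B + 1" using True by (simp add: card_image)
    moreover have "?S \<subseteq> span B" using pow_U U(3) by auto
    ultimately have "dependent ?S"
      using independent_span_bound[of B ?S] U(4) by auto
    then obtain a w where a: "w \<in> ?S" "a w \<noteq> 0" "(\<Sum>w\<in>?S. scale (a w) w) = 0"
      using dependent_finite[of ?S] by auto
    define P where "P = (\<Sum>i\<le>card B. monom (a ((T ^^ i) v)) i)"
    have co: "coeff P i = (if i \<le> card B then a ((T ^^ i) v) else 0)" for i
      by (simp add: P_def coeff_sum if_distrib sum.delta cong: if_cong)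
    have "degree P \<le> card B" by (rule degree_le) (simp add: co)
    hence "E P = (\<Sum>i\<le>card B. scale (a ((T ^^ i) v)) ((T ^^ i) v))"
      by (simp add: E_le co)
    also have "\<dots> = 0" using a(3) True by (simp add: sum.reindex)
    finally have "E P = 0" .
    moreover have "P \<noteq> 0" using a(1,2) co by (metis (no_types, lifting) coeff_0 imageE atMost_iff)
    ultimately show ?thesis by blast
  next
    case False
    then obtain i j where ij: "i \<noteq> j" "(T ^^ i) v = (T ^^ j) v" by (auto simp: inj_on_def)
    have m: "E (monom 1 i) = (T ^^ i) v" for i
      unfolding E_def by (simp add: degree_monom_eq) (subst sum.remove[of _ i], auto)
    have "E (monom 1 i + smult (-1) (monom 1 j)) = 0"
      using ij(2) by (simp only: E_add E_smult m) simp
    moreover have "monom 1 i + smult (-1) (monom 1 j) \<noteq> (0 :: 'a poly)"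
    proof
      assume "monom 1 i + smult (-1) (monom 1 j) = (0 :: 'a poly)"
      hence "coeff (monom 1 i + smult (-1) (monom 1 j)) i = (0 :: 'a)" by simp
      thus False using ij(1) by simp
    qed
    ultimately show ?thesis by blast
  qed
  then obtain P where P: "P \<noteq> 0" "E P = 0" and minP: "\<And>Q. Q \<noteq> 0 \<Longrightarrow> E Q = 0 \<Longrightarrow> degree P \<le> degree Q"
    using exists_least_iff[of "\<lambda>n. \<exists>P. P \<noteq> 0 \<and> E P = 0 \<and> degree P = n"]
    by (metis (mono_tags, lifting) not_le)
  have "degree P > 0"
  proof (rule ccontr)
    assume "\<not> degree P > 0"
    then obtain a where a: "P = [:a:]" by (meson degree_eq_zeroE gr0I)
    thus False using P v by (simp add: E_def)
  qed
  with c obtain z where z: "poly P z = 0" by blast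
  then obtain Q where Q: "P = [:- z, 1:] * Q" by (metis dvdE poly_eq_0_iff_dvd)
  have Q0: "Q \<noteq> 0" using P Q by auto
  hence "degree P = degree Q + 1" unfolding Q by (subst degree_mult_eq) auto
  hence "E Q \<noteq> 0" using minP[OF Q0] by auto
  moreover have "T (E Q) = scale z (E Q)"
  proof -
    have "P = smult (- z) Q + pCons 0 Q" by (simp add: Q)
    hence "E P = scale (- z) (E Q) + T (E Q)" by (simp only: E_add E_smult E_pCons)
    thus ?thesis using P(2) by simp
  qed
  ultimately show ?thesis using that E_U by blast
qed

context gK_module
begin

sublocale V: vector_space "cscale M"
  by (rule vector_space)

lemma lie_plus: "X \<in> sl2 \<Longrightarrow> lie_act M X (v + w) = lie_act M X v + lie_act M X w"
  and lie_scale: "X \<in> sl2 \<Longrightarrow> lie_act M X (cscale M c v) = cscale M c (lie_act M X v)"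
  using lie_linear[of X] by (simp_all add: Vector_Spaces.linear_iff)

lemma K_plus: "k \<in> SO2 \<Longrightarrow> K_act M k (v + w) = K_act M k v + K_act M k w"
  and K_scale: "k \<in> SO2 \<Longrightarrow> K_act M k (cscale M c v) = cscale M c (K_act M k v)"
  using K_linear[of k] by (simp_all add: Vector_Spaces.linear_iff)

lemma lie_minus: "X \<in> sl2 \<Longrightarrow> lie_act M X (v - w) = lie_act M X v - lie_act M X w"
  using lie_plus[of X "v - w" w] by (simp add: eq_diff_eq)

lemma K_zero [simp]: "k \<in> SO2 \<Longrightarrow> K_act M k 0 = 0"
  using K_scale[of k 0 0] by simp

lemma K_minus: "k \<in> SO2 \<Longrightarrow> K_act M k (v - w) = K_act M k v - K_act M k w"
  using K_plus[of k "v - w" w] by (simp add: eq_diff_eq)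

text \<open>Reduces identities in \<open>V\<close> to identities between complex numbers.\<close>

lemma functional_eqI:
  assumes "\<And>l. (\<And>v w. l (v + w) = l v + l w) \<Longrightarrow> (\<And>c v. l (cscale M c v) = c * l v) \<Longrightarrow>
      (\<And>v w. l (v - w) = l v - l w) \<Longrightarrow> l v = (l w :: complex)"
  shows "v = w"
proof (rule ccontr)
  assume "v \<noteq> w"
  hence "v - w \<notin> V.span {}" by simp
  from V.functional_extend[OF V.independent_empty this]
  obtain l where l': "\<forall>v w. l (v + w) = l v + l w" "\<forall>c v. l (cscale M c v) = c * l v" "l (v - w) = 1"
    by (elim exE conjE)
  note l = l'(1,2)[rule_format] l'(3)
  have d: "l (a - b) = l a - l b" for a b using l(1)[of "a - b" b] by simp
  show False using assms[of l, OF l(1,2) d] d[of v w] l(3) by simp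
qed

text \<open>The module axiom differentiates the orbit at the identity only; writing
  \<open>rot t\<close> as \<open>rot (t - \<theta>)\<close> times \<open>rot \<theta>\<close> moves
  this to any angle. A functional \<open>l\<close> makes the derivative a scalar one.\<close>

lemma K_orbit_derivative:
  fixes l :: "'v \<Rightarrow> complex"
  assumes l: "\<And>v w. l (v + w) = l v + l w" "\<And>c v. l (cscale M c v) = c * l v"
  shows "((\<lambda>t. l (K_act M (rot t) u)) has_vector_derivative l (lie_act M mat_J (K_act M (rot \<theta>) u))) (at \<theta>)"
proof -
  have l0: "l 0 = 0" using l(1)[of 0 0] by simp
  have l_sum: "l (\<Sum>b\<in>B. cscale M (a b) b) = (\<Sum>b\<in>B. a b * l b)" for a B
    by (induction B rule: infinite_finite_induct) (auto simp: l l0)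
  have *: "((\<lambda>t. l (K_act M (rot t) w)) has_vector_derivative l (lie_act M mat_J w)) (at 0)" for w
  proof -
    from K_finite_differential[of w]
    obtain B a where B: "\<forall>k\<in>SO2. K_act M k w = (\<Sum>b\<in>B. cscale M (a b k) b)"
      and D: "\<forall>X\<in>so2. \<exists>d. lie_act M X w = (\<Sum>b\<in>B. cscale M (d b) b) \<and>
             (\<forall>b\<in>B. ((\<lambda>t. a b (mexp (t *\<^sub>R X))) has_vector_derivative d b) (at 0))"
      by (elim exE conjE)
    from bspec[OF D J_in_so2] obtain d where d: "lie_act M mat_J w = (\<Sum>b\<in>B. cscale M (d b) b)"
      "\<forall>b\<in>B. ((\<lambda>t. a b (rot t)) has_vector_derivative d b) (at 0)"
      unfolding mexp_J by (elim exE conjE)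
    have K: "l (K_act M (rot t) w) = (\<Sum>b\<in>B. a b (rot t) * l b)" for t
      using bspec[OF B rot_in_SO2, of t] by (simp only: l_sum)
    have "((\<lambda>t. \<Sum>b\<in>B. a b (rot t) * l b) has_vector_derivative (\<Sum>b\<in>B. d b * l b)) (at 0)"
      using d(2) by (intro has_vector_derivative_sum has_vector_derivative_mult_left) blast
    thus ?thesis by (simp only: d(1) l_sum K)
  qed
  have "K_act M (rot t) u = K_act M (rot (t - \<theta>)) (K_act M (rot \<theta>) u)" for t
    by (simp add: K_mult[symmetric] rot_add[symmetric])
  hence "(\<lambda>t. l (K_act M (rot t) u)) = (\<lambda>t. l (K_act M (rot t) (K_act M (rot \<theta>) u))) \<circ> (\<lambda>t. t - \<theta>)"
    unfolding o_def by (intro ext arg_cong[where f = l])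
  moreover have "((\<lambda>t. l (K_act M (rot t) (K_act M (rot \<theta>) u))) \<circ> (\<lambda>t. t - \<theta>) has_vector_derivative
      1 *\<^sub>R l (lie_act M mat_J (K_act M (rot \<theta>) u))) (at \<theta>)"
  proof (rule vector_diff_chain_at)
    show "((\<lambda>t. t - \<theta>) has_vector_derivative 1) (at \<theta>)"
      by (auto intro!: derivative_eq_intros)
    show "((\<lambda>t. l (K_act M (rot t) (K_act M (rot \<theta>) u))) has_vector_derivative
        l (lie_act M mat_J (K_act M (rot \<theta>) u))) (at (\<theta> - \<theta>))"
      using * by simp
  qed
  ultimately show ?thesis by simp
qed

lemma K_typeD: "v \<in> K_type M n \<Longrightarrow> K_act M (rot \<theta>) v = cscale M (cis (of_int n * \<theta>)) v"
  by (simp add: K_type_def)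

lemma J_K_type:
  assumes "v \<in> K_type M n"
  shows "lie_act M mat_J v = cscale M (\<i> * of_int n) v"
proof (rule functional_eqI)
  fix l :: "'v \<Rightarrow> complex" assume l: "\<And>v w. l (v + w) = l v + l w" "\<And>c v. l (cscale M c v) = c * l v"
  have "((\<lambda>t. l (K_act M (rot t) v)) has_vector_derivative l (lie_act M mat_J v)) (at 0)"
    using K_orbit_derivative[OF l, of v 0] by (simp add: rot_0 K_one)
  hence "((\<lambda>t. cis (of_int n * t) * l v) has_vector_derivative l (lie_act M mat_J v)) (at 0)"
    by (simp add: K_typeD[OF assms] l)
  moreover have "((\<lambda>t. cis (of_int n * t) * l v) has_vector_derivative (\<i> * of_int n * cis (of_int n * 0)) * l v) (at 0)"
    using cis_DERIV[of "of_int n" 0] by (intro has_vector_derivative_mult_left) simp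
  ultimately have "l (lie_act M mat_J v) = (\<i> * of_int n * cis (of_int n * 0)) * l v"
    by (rule vector_derivative_unique_at)
  thus "l (lie_act M mat_J v) = l (cscale M (\<i> * of_int n) v)"
    by (simp add: l)
qed

lemma K_act_J: "K_act M (rot \<theta>) (lie_act M mat_J v) = lie_act M mat_J (K_act M (rot \<theta>) v)"
  using K_Ad[of "rot \<theta>" mat_J v] by (simp add: Ad_rot_J J_H_S_in_sl2)

text \<open>On a finite-dimensional \<open>K\<close>-stable space \<open>mat_J\<close> has an
  eigenvector \<open>u\<close>. The orbit of \<open>u\<close> solves a linear differential equation,
  so \<open>K\<close> acts on it by an exponential, and periodicity of \<open>rot\<close> forces the
  eigenvalue to be an integer multiple of \<open>\<i>\<close>.\<close>

lemma K_type_nonempty: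
  assumes "(v :: 'v) \<noteq> 0"
  shows "\<exists>n. \<exists>u\<in>K_type M n. u \<noteq> 0"
proof -
  obtain B a where B: "finite B" "V.independent B" "\<forall>k\<in>SO2. K_act M k v = (\<Sum>b\<in>B. cscale M (a b k) b)"
    using K_finite_differential[of v] by blast
  \<comment> \<open>The span of \<open>B\<close> need not be stable under \<open>K\<close>;
    \<open>U\<close> is its largest \<open>K\<close>-stable subspace.\<close>
  define U where "U = {u. \<forall>\<theta>. K_act M (rot \<theta>) u \<in> V.span B}"
  have U: "V.subspace U"
    unfolding V.subspace_def U_def
    by (simp add: K_plus K_scale V.span_add V.span_scale V.span_zero)
  have "v \<in> U" using B(3) by (auto simp: U_def intro: V.span_sum V.span_scale V.span_base)
  have UB: "u \<in> V.span B" if "u \<in> U" for u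
    using that by (auto simp: U_def dest: spec[of _ 0] simp: rot_0 K_one)
  \<comment> \<open>A functional vanishing on \<open>V.span B\<close> vanishes along the whole orbit
    of \<open>u\<close>, hence also on the derivative of the orbit.\<close>
  have JB: "lie_act M mat_J u \<in> V.span B" if u: "u \<in> U" for u
  proof (rule ccontr)
    assume "lie_act M mat_J u \<notin> V.span B"
    from V.functional_extend[OF B(2) this]
    obtain l where l': "\<forall>v w. l (v + w) = l v + l w" "\<forall>c v. l (cscale M c v) = c * l v"
      "\<forall>v\<in>V.span B. l v = 0" "l (lie_act M mat_J u) = 1"
      by (elim exE conjE)
    note l = l'(1,2)[rule_format] l'(3)[rule_format] l'(4)
    have "((\<lambda>t. 0) has_vector_derivative l (lie_act M mat_J u)) (at 0)"
      using K_orbit_derivative[OF l(1,2), of u 0] u l(3) by (simp add: rot_0 K_one U_def)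
    from vector_derivative_unique_at[OF this has_vector_derivative_const]
    have "l (lie_act M mat_J u) = 0" .
    thus False using l(4) by simp
  qed
  have JU: "lie_act M mat_J u \<in> U" if "u \<in> U" for u
  proof -
    have "K_act M (rot \<theta>) u \<in> U" for \<theta>
      using that by (simp add: U_def K_mult[symmetric] rot_add[symmetric])
    thus ?thesis using JB by (simp add: U_def K_act_J)
  qed
  obtain u z where u: "u \<in> U" "u \<noteq> 0" "lie_act M mat_J u = cscale M z u"
  proof (rule V.eigenvector_exists[of "lie_act M mat_J" U B v])
    show "\<exists>z. poly P z = 0" if "degree P > 0" for P :: "complex poly"
      using that fundamental_theorem_of_algebra[of P] by (simp add: constant_degree)
  qed (use U UB JU B(1) \<open>v \<in> U\<close> assms in \<open>auto simp: lie_plus lie_scale J_H_S_in_sl2\<close>)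
  have Ku: "K_act M (rot \<theta>) u = cscale M (exp (z * of_real \<theta>)) u" for \<theta>
  proof (rule functional_eqI)
    fix l :: "'v \<Rightarrow> complex" assume l: "\<And>v w. l (v + w) = l v + l w" "\<And>c v. l (cscale M c v) = c * l v"
    \<comment> \<open>Dividing the orbit by the expected exponential gives a function with
      derivative 0.\<close>
    define g where "g t = exp (- (z * of_real t)) * l (K_act M (rot t) u)" for t
    have e: "((\<lambda>t. exp (- (z * of_real t))) has_vector_derivative (- z * exp (- (z * of_real t)))) (at t)" for t :: real
      by (auto intro!: derivative_eq_intros has_vector_derivative_real_field)
    have "(g has_vector_derivative 0) (at t)" for t
    proof -
      have "l (lie_act M mat_J (K_act M (rot t) u)) = z * l (K_act M (rot t) u)"
        by (simp add: K_act_J[symmetric] u K_scale l)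
      with has_vector_derivative_mult[OF e[of t] K_orbit_derivative[OF l, of u t]]
      show ?thesis unfolding g_def by simp
    qed
    hence "(g has_vector_derivative 0) (at t within UNIV)" for t by simp
    then obtain c where "\<And>t. t \<in> UNIV \<Longrightarrow> g t = c"
      using has_vector_derivative_zero_constant[OF convex_UNIV, of g] by blast
    hence "g \<theta> = g 0" by simp
    thus "l (K_act M (rot \<theta>) u) = l (cscale M (exp (z * of_real \<theta>)) u)"
      by (simp add: g_def rot_0 K_one l exp_minus field_simps)
  qed
  have "rot (2 * pi) = rot 0" by (simp add: rot_mat2)
  hence "cscale M (exp (z * of_real (2 * pi))) u = u" using Ku[of "2 * pi"] by (simp add: rot_0 K_one)
  hence "exp (z * of_real (2 * pi)) = 1" using u(2) V.scale_cancel_right[of _ u 1] by simp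
  then obtain n :: int where n: "Re (z * of_real (2 * pi)) = 0" "Im (z * of_real (2 * pi)) = of_int (2 * n) * pi"
    unfolding exp_eq_1 by blast
  hence "z = \<i> * of_int n" by (simp add: complex_eq_iff)
  hence "u \<in> K_type M n" using Ku by (simp add: K_type_def cis_conv_exp mult_ac)
  thus ?thesis using u(2) by blast
qed

text \<open>The action of \<open>(mat_H - \<i> \<sigma> mat_S) / 2\<close> from the complexified Lie
  algebra, formed inside \<open>V\<close> because only real matrices act. For
  \<open>\<sigma> = 1\<close> it is the raising operator, for \<open>\<sigma> = -1\<close> the
  lowering operator.\<close>

definition ladder :: "int \<Rightarrow> 'v \<Rightarrow> 'v" where
  "ladder \<sigma> v = cscale M (1 / 2) (lie_act M mat_H v - cscale M (\<i> * of_int \<sigma>) (lie_act M mat_S v))"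

lemma ladder_scale: "ladder \<sigma> (cscale M c v) = cscale M c (ladder \<sigma> v)"
  by (rule functional_eqI) (simp add: ladder_def lie_scale J_H_S_in_sl2 algebra_simps)

lemma H_eq_ladder: "lie_act M mat_H v = ladder \<sigma> v + ladder (- \<sigma>) v"
  by (rule functional_eqI) (simp add: ladder_def algebra_simps)

lemma S_eq_ladder:
  assumes "\<sigma> = 1 \<or> \<sigma> = -1"
  shows "lie_act M mat_S v = cscale M (\<i> * of_int \<sigma>) (ladder \<sigma> v - ladder (- \<sigma>) v)"
  using assms by (intro functional_eqI) (auto simp: ladder_def algebra_simps)

lemma K_ladder:
  assumes "\<sigma> = 1 \<or> \<sigma> = -1"
  shows "K_act M (rot \<theta>) (ladder \<sigma> v) = cscale M (cis (2 * of_int \<sigma> * \<theta>)) (ladder \<sigma> (K_act M (rot \<theta>) v))"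
proof (rule functional_eqI)
  fix l :: "'v \<Rightarrow> complex" assume l: "\<And>v w. l (v + w) = l v + l w" "\<And>c v. l (cscale M c v) = c * l v"
    "\<And>v w. l (v - w) = l v - l w"
  define c s where "c = complex_of_real (cos (2 * \<theta>))" and "s = complex_of_real (sin (2 * \<theta>))"
  define lh ls where "lh = l (lie_act M mat_H (K_act M (rot \<theta>) v))" and "ls = l (lie_act M mat_S (K_act M (rot \<theta>) v))"
  have 1: "l (K_act M (rot \<theta>) (lie_act M mat_H v)) = c * lh + s * ls"
    unfolding K_Ad[OF rot_in_SO2 J_H_S_in_sl2(2)] Ad_rot_H lie_add[OF sl2_scaleR[OF J_H_S_in_sl2(2)] sl2_scaleR[OF J_H_S_in_sl2(3)]]
      lie_scaleR[OF J_H_S_in_sl2(2)] lie_scaleR[OF J_H_S_in_sl2(3)] l c_def s_def lh_def ls_def ..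
  have 2: "l (K_act M (rot \<theta>) (lie_act M mat_S v)) = - s * lh + c * ls"
    unfolding K_Ad[OF rot_in_SO2 J_H_S_in_sl2(3)] Ad_rot_S lie_add[OF sl2_scaleR[OF J_H_S_in_sl2(2)] sl2_scaleR[OF J_H_S_in_sl2(3)]]
      lie_scaleR[OF J_H_S_in_sl2(2)] lie_scaleR[OF J_H_S_in_sl2(3)] l c_def s_def lh_def ls_def of_real_minus ..
  have 3: "cis (2 * of_int \<sigma> * \<theta>) = c + \<i> * of_int \<sigma> * s"
    using assms by (auto simp: complex_eq_iff c_def s_def)
  have "l (K_act M (rot \<theta>) (ladder \<sigma> v)) = 1 / 2 * ((c * lh + s * ls) - \<i> * of_int \<sigma> * (- s * lh + c * ls))"
    by (simp only: ladder_def K_scale[OF rot_in_SO2] K_minus[OF rot_in_SO2] l 1 2)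
  also have "\<dots> = (c + \<i> * of_int \<sigma> * s) * (1 / 2 * (lh - \<i> * of_int \<sigma> * ls))"
    using assms by (elim disjE) (simp_all add: algebra_simps)
  also have "\<dots> = l (cscale M (cis (2 * of_int \<sigma> * \<theta>)) (ladder \<sigma> (K_act M (rot \<theta>) v)))"
    by (simp only: ladder_def l 3 lh_def ls_def)
  finally show "l (K_act M (rot \<theta>) (ladder \<sigma> v)) = l (cscale M (cis (2 * of_int \<sigma> * \<theta>)) (ladder \<sigma> (K_act M (rot \<theta>) v)))" .
qed

lemma ladder_K_type:
  assumes "\<sigma> = 1 \<or> \<sigma> = -1" "v \<in> K_type M n"
  shows "ladder \<sigma> v \<in> K_type M (n + 2 * \<sigma>)"
  using assms(2) unfolding K_type_def
  by (simp add: K_ladder[OF assms(1)] ladder_scale cis_mult algebra_simps)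

text \<open>The bracket of the two ladder elements is \<open>- \<i> \<sigma> mat_J\<close>, and
  \<open>mat_J\<close> acts on the type \<open>n\<close> by \<open>\<i> * n\<close>.\<close>

lemma ladder_commutator:
  assumes \<sigma>: "\<sigma> = 1 \<or> \<sigma> = -1" and v: "v \<in> K_type M n"
  shows "ladder \<sigma> (ladder (- \<sigma>) v) = ladder (- \<sigma>) (ladder \<sigma> v) + cscale M (of_int (\<sigma> * n)) v"
proof (rule functional_eqI)
  fix l :: "'v \<Rightarrow> complex" assume l: "\<And>v w. l (v + w) = l v + l w" "\<And>c v. l (cscale M c v) = c * l v"
    "\<And>v w. l (v - w) = l v - l w"
  define hh hs sh ss where "hh = l (lie_act M mat_H (lie_act M mat_H v))" and "hs = l (lie_act M mat_H (lie_act M mat_S v))"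
    and "sh = l (lie_act M mat_S (lie_act M mat_H v))" and "ss = l (lie_act M mat_S (lie_act M mat_S v))"
  have "hs - sh = l (lie_act M ((-2) *\<^sub>R mat_J) v)"
    using lie_bracket[OF J_H_S_in_sl2(2,3), of v] by (simp only: lie_bracket_J_H_S hs_def sh_def l)
  also have "\<dots> = - 2 * (\<i> * of_int n * l v)"
    unfolding lie_scaleR[OF J_H_S_in_sl2(1)] J_K_type[OF v] l by simp
  finally have hs: "hs = sh - 2 * (\<i> * of_int n * l v)" by (simp add: algebra_simps)
  have e: "l (ladder \<tau> (ladder \<rho> v)) = 1/4 * (hh - \<i> * of_int \<rho> * hs - \<i> * of_int \<tau> * (sh - \<i> * of_int \<rho> * ss))" for \<tau> \<rho>
    by (simp add: ladder_def hh_def hs_def sh_def ss_def lie_minus lie_scale J_H_S_in_sl2 l)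
  show "l (ladder \<sigma> (ladder (- \<sigma>) v)) = l (ladder (- \<sigma>) (ladder \<sigma> v) + cscale M (of_int (\<sigma> * n)) v)"
    unfolding l e hs using \<sigma> by (elim disjE) (simp_all add: field_simps)
qed

end

section \<open>Unitary irreducible modules\<close>

definition unity_root :: "nat \<Rightarrow> nat \<Rightarrow> int \<Rightarrow> complex" where
  "unity_root N k n = cis (2 * pi * real k * of_int n / real N)"

text \<open>Since the indices differ by less than \<open>N\<close>, distinct ones stay distinct
  modulo \<open>N\<close>; averaging over the finite group then separates them exactly, and no
  integral over \<open>K\<close> has to be formed.\<close>

lemma dft_inversion:
  fixes c :: "int \<Rightarrow> complex"
  assumes "finite S" "N > 0" "\<And>n. n \<in> S \<Longrightarrow> \<bar>j - n\<bar> < int N"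
  shows "(\<Sum>k<N. (\<Sum>n\<in>S. c n * cnj (unity_root N k n)) * unity_root N k j)
     = of_nat N * (if j \<in> S then c j else 0)"
proof -
  have e: "cnj (unity_root N k n) * unity_root N k j =
      unity_root N k (j - n)" for k n
    by (simp add: unity_root_def cis_cnj cis_mult diff_divide_distrib ring_distribs)
  have s: "(\<Sum>k<N. unity_root N k (j - n)) = (if n = j then of_nat N else 0)" if "n \<in> S" for n
  proof (cases "n = j")
    case False
    have "\<not> int N dvd (j - n)"
    proof
      assume "int N dvd (j - n)"
      hence "int N dvd \<bar>j - n\<bar>" by simp
      hence "int N \<le> \<bar>j - n\<bar>" using False by (intro zdvd_imp_le) auto
      thus False using assms(3)[OF that] by simp
    qed
    from sum_cis_roots[OF assms(2) this] False show ?thesis by (simp add: unity_root_def del: of_int_diff)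
  qed (simp add: unity_root_def)
  have "(\<Sum>k<N. (\<Sum>n\<in>S. c n * cnj (unity_root N k n)) * unity_root N k j)
     = (\<Sum>k<N. \<Sum>n\<in>S. c n * unity_root N k (j - n))"
    unfolding sum_distrib_right by (intro sum.cong refl) (simp only: mult.assoc[of "c _"] e)
  also have "\<dots> = (\<Sum>n\<in>S. c n * (\<Sum>k<N. unity_root N k (j - n)))"
    unfolding sum_distrib_left by (rule sum.swap)
  also have "\<dots> = (\<Sum>n\<in>S. if n = j then of_nat N * c j else 0)"
    using s by (intro sum.cong) auto
  also have "\<dots> = of_nat N * (if j \<in> S then c j else 0)"
    using assms(1) by (simp add: sum.delta)
  finally show ?thesis .
qed

lemma dft_parseval:
  fixes c :: "int \<Rightarrow> complex"
  assumes "finite S" "N > 0" "\<And>n j. n \<in> S \<Longrightarrow> j \<in> S \<Longrightarrow> \<bar>j - n\<bar> < int N"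
  shows "(\<Sum>k<N. (cmod (\<Sum>n\<in>S. c n * cnj (unity_root N k n)))\<^sup>2) = N * (\<Sum>n\<in>S. (cmod (c n))\<^sup>2)"
proof -
  define C where "C k = (\<Sum>n\<in>S. c n * cnj (unity_root N k n))" for k
  have "cnj (C k) = (\<Sum>j\<in>S. cnj (c j) * unity_root N k j)" for k
    by (simp add: C_def)
  hence "of_real (\<Sum>k<N. (cmod (C k))\<^sup>2) = (\<Sum>k<N. C k * (\<Sum>j\<in>S. cnj (c j) * unity_root N k j))"
    by (simp add: complex_norm_square del: of_real_power flip: of_real_power)
  also have "\<dots> = (\<Sum>j\<in>S. cnj (c j) * (\<Sum>k<N. C k * unity_root N k j))"
    unfolding sum_distrib_left by (subst sum.swap) (simp add: mult_ac)
  also have "\<dots> = (\<Sum>j\<in>S. cnj (c j) * (of_nat N * c j))"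
    unfolding C_def using assms by (intro sum.cong refl) (subst dft_inversion, auto)
  also have "\<dots> = of_real (N * (\<Sum>n\<in>S. (cmod (c n))\<^sup>2))"
    by (simp add: sum_distrib_left complex_norm_square mult_ac del: of_real_power flip: of_real_power)
  finally show ?thesis unfolding C_def of_real_eq_iff .
qed

text \<open>Unitarity enters on the algebraic level: invariance of \<open>b\<close> under
  \<open>K\<close> and skewness of \<open>mat_H\<close> and \<open>mat_S\<close>, all on
  \<open>V\<close> itself.\<close>

locale unitary_gK_module = gK_module M
  for M :: "'v::ab_group_add gK" +
  fixes b :: "'v \<Rightarrow> 'v \<Rightarrow> complex" and q :: "'v \<Rightarrow> real" and e :: "int \<Rightarrow> 'v"
  assumes q_norm: "is_norm M q"
    and b_add: "b (u + v) w = b u w + b v w"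
    and b_scale: "b (cscale M c v) w = c * b v w"
    and b_cnj: "b w v = cnj (b v w)"
    and b_norm: "b v v = complex_of_real ((q v)\<^sup>2)"
    and b_K: "k \<in> SO2 \<Longrightarrow> b (K_act M k v) (K_act M k w) = b v w"
    and b_skew: "X \<in> {mat_H, mat_S} \<Longrightarrow> b (lie_act M X v) w = - b v (lie_act M X w)"
    and irreducible: "gK_irreducible M"
    and e: "n \<in> spec_K M \<Longrightarrow> V.span {e n} = K_type M n" "n \<in> spec_K M \<Longrightarrow> q (e n) = 1"
begin

sublocale Q: normed_module M q
  by unfold_locales (rule q_norm)

lemma b_add_right: "b w (u + v) = b w u + b w v"
  by (subst (1 2 3) b_cnj) (simp add: b_add)

lemma b_scale_right: "b w (cscale M c v) = cnj c * b w v"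
  by (subst (1 2) b_cnj) (simp add: b_scale)

lemma b_zero [simp]: "b 0 v = 0" "b v 0 = 0"
  using b_scale[of 0 0 v] b_scale_right[of v 0 0] by simp_all

lemma b_sum: "b (\<Sum>i\<in>I. f i) w = (\<Sum>i\<in>I. b (f i) w)"
  by (induction I rule: infinite_finite_induct) (simp_all add: b_add)

lemma b_minus: "b (u - v) w = b u w - b v w"
  using b_add[of "u - v" v w] by simp

lemma b_minus_right: "b w (u - v) = b w u - b w v"
  using b_add_right[of w "u - v" v] by simp

text \<open>Both \<open>mat_H\<close> and \<open>mat_S\<close> are skew, and moving
  \<open>\<i>\<close> to the second argument conjugates it, which exchanges the two ladder
  operators.\<close>

lemma b_ladder:
  assumes "\<sigma> = 1 \<or> \<sigma> = -1"
  shows "b (ladder \<sigma> v) w = - b v (ladder (- \<sigma>) w)"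
  using assms by (elim disjE)
    (simp_all add: ladder_def b_scale b_scale_right b_minus b_minus_right b_add_right b_add b_skew, simp_all add: field_simps)

lemma e_K_type: "n \<in> spec_K M \<Longrightarrow> e n \<in> K_type M n"
  using e(1)[of n] V.span_base[of "e n" "{e n}"] by simp

lemma b_K_types:
  assumes "v \<in> K_type M n" "w \<in> K_type M j" "n \<noteq> j"
  shows "b v w = 0"
proof -
  \<comment> \<open>At this angle the two characters have quotient -1, so invariance gives
    \<open>b v w = - b v w\<close>.\<close>
  define \<theta> where "\<theta> = pi / of_int (n - j)"
  have "b v w = b (K_act M (rot \<theta>) v) (K_act M (rot \<theta>) w)" by (simp add: b_K)
  also have "\<dots> = cis (of_int n * \<theta>) * (cis (- (of_int j * \<theta>)) * b v w)"
    by (simp add: K_typeD[OF assms(1)] K_typeD[OF assms(2)] b_scale b_scale_right cis_cnj)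
  also have "\<dots> = cis (of_int n * \<theta> - of_int j * \<theta>) * b v w"
    by (simp only: mult.assoc[symmetric] cis_mult) simp
  also have "of_int n * \<theta> - of_int j * \<theta> = of_int (n - j) * \<theta>"
    by (simp add: left_diff_distrib)
  also have "\<dots> = pi"
    using assms(3) by (simp add: \<theta>_def)
  finally show ?thesis by simp
qed

section \<open>Coordinates in the orthonormal basis\<close>

definition coord :: "int \<Rightarrow> 'v \<Rightarrow> complex" where
  "coord n v = b v (e n)"

lemma coord_add: "coord n (v + w) = coord n v + coord n w"
  and coord_scale: "coord n (cscale M c v) = c * coord n v"
  and coord_zero [simp]: "coord n 0 = 0"
  and coord_sum: "coord n (\<Sum>i\<in>I. f i) = (\<Sum>i\<in>I. coord n (f i))"
  by (simp_all add: coord_def b_add b_scale b_sum)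

lemma coord_K_type: "v \<in> K_type M j \<Longrightarrow> n \<in> spec_K M \<Longrightarrow> n \<noteq> j \<Longrightarrow> coord n v = 0"
  unfolding coord_def using b_K_types[OF _ e_K_type] by blast

lemma coord_e: "n \<in> spec_K M \<Longrightarrow> j \<in> spec_K M \<Longrightarrow> coord n (e j) = (if n = j then 1 else 0)"
  using coord_K_type[OF e_K_type, of j n] e(2)[of n] by (auto simp: coord_def b_norm)

lemma coord_lincomb:
  assumes "finite S" "S \<subseteq> spec_K M" "n \<in> spec_K M"
  shows "coord n (\<Sum>j\<in>S. cscale M (c j) (e j)) = (if n \<in> S then c n else 0)"
proof -
  have "coord n (\<Sum>j\<in>S. cscale M (c j) (e j)) = (\<Sum>j\<in>S. if j = n then c j else 0)"
    unfolding coord_sum coord_scale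
  proof (intro sum.cong refl)
    fix j assume "j \<in> S"
    hence "j \<in> spec_K M" using assms(2) by blast
    thus "c j * coord n (e j) = (if j = n then c j else 0)" using coord_e[OF assms(3)] by simp
  qed
  thus ?thesis using assms(1) by simp
qed

lemma coord_K:
  assumes "n \<in> spec_K M"
  shows "coord n (K_act M (rot \<theta>) v) = cis (of_int n * \<theta>) * coord n v"
proof -
  have "K_act M (rot \<theta>) (cscale M (cis (- (of_int n * \<theta>))) (e n)) = e n"
    by (simp add: K_scale K_typeD[OF e_K_type[OF assms]] cis_mult)
  hence "coord n (K_act M (rot \<theta>) v) = b (K_act M (rot \<theta>) v) (K_act M (rot \<theta>) (cscale M (cis (- (of_int n * \<theta>))) (e n)))"
    by (simp add: coord_def)
  also have "\<dots> = cis (of_int n * \<theta>) * coord n v"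
    by (simp add: b_K b_scale_right coord_def cis_cnj)
  finally show ?thesis .
qed

lemma K_type_eq_coord:
  assumes "n \<in> spec_K M" "v \<in> K_type M n"
  shows "v = cscale M (coord n v) (e n)"
proof -
  obtain c where c: "v = cscale M c (e n)"
    using assms e(1)[of n] by (auto simp: V.span_singleton)
  hence "coord n v = c" by (simp add: coord_scale coord_e assms)
  with c show ?thesis by simp
qed

lemma q_K_type: "n \<in> spec_K M \<Longrightarrow> v \<in> K_type M n \<Longrightarrow> q v = cmod (coord n v)"
  using K_type_eq_coord[of n v] e(2)[of n] by (metis Q.p_scale mult.right_neutral)

lemma not_spec: "n \<notin> spec_K M \<Longrightarrow> v \<in> K_type M n \<Longrightarrow> v = 0"
  by (auto simp: spec_K_def)

lemma in_spec: "v \<in> K_type M n \<Longrightarrow> v \<noteq> 0 \<Longrightarrow> n \<in> spec_K M"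
  using not_spec by blast

text \<open>Take \<open>l\<close> of least absolute value. If \<open>\<sigma> * l > 2\<close>, then
  \<open>l - 2 * \<sigma>\<close> is closer to 0 and hence no \<open>K\<close>-type, so
  \<open>ladder (- \<sigma>)\<close> kills \<open>e l\<close>. The alternative is the sign condition
  of \<open>singular_system_lower_bound\<close>.\<close>

lemma minimal_K_type:
  obtains l where "l \<in> spec_K M" "\<forall>\<sigma>\<in>{1, -1}. \<sigma> * l \<le> 2 \<or> ladder (- \<sigma>) (e l) = 0"
proof -
  obtain v :: 'v where "v \<noteq> 0" using irreducible by (auto simp: gK_irreducible_def)
  from K_type_nonempty[OF this] obtain n u where "u \<in> K_type M n" "u \<noteq> 0" by blast
  hence "n \<in> spec_K M" by (rule in_spec)
  define l where "l = arg_min (\<lambda>n. nat \<bar>n\<bar>) (\<lambda>n. n \<in> spec_K M)"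
  have l: "l \<in> spec_K M" unfolding l_def by (rule arg_min_natI) fact
  have l_min: "\<bar>l\<bar> \<le> \<bar>j\<bar>" if "j \<in> spec_K M" for j
    using arg_min_nat_le[of "\<lambda>n. n \<in> spec_K M" j "\<lambda>n. nat \<bar>n\<bar>"] that by (simp add: l_def)
  show ?thesis
  proof (rule that[OF l], rule ballI)
    fix \<sigma> :: int assume "\<sigma> \<in> {1, -1}"
    hence \<sigma>: "\<sigma> = 1 \<or> \<sigma> = -1" by simp
    show "\<sigma> * l \<le> 2 \<or> ladder (- \<sigma>) (e l) = 0"
    proof (cases "\<sigma> * l \<le> 2")
      case False
      have "ladder (- \<sigma>) (e l) \<in> K_type M (l + 2 * (- \<sigma>))"
        using \<sigma> by (intro ladder_K_type e_K_type l) auto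
      moreover have "l + 2 * (- \<sigma>) \<notin> spec_K M"
        using l_min[of "l + 2 * (- \<sigma>)"] False \<sigma> by auto
      ultimately show ?thesis using not_spec by blast
    qed simp
  qed
qed

section \<open>Towers over a fixed K-type\<close>

definition tower :: "int \<Rightarrow> int \<Rightarrow> nat \<Rightarrow> 'v" where
  "tower l \<sigma> m = (ladder \<sigma> ^^ m) (e l)"

text \<open>This is \<open>(k + 1) * (k + \<sigma> * l)\<close>, the sum of the commutator values
  \<open>\<sigma> * l + 2 * j\<close> for \<open>j \<le> k\<close>, plus the squared norm of
  \<open>ladder (- \<sigma>) (e l)\<close>. The expanded form fits
  \<open>quadratic_product_growth\<close> with \<open>s = \<sigma> * l - 1\<close>.\<close>

definition tower_factor :: "int \<Rightarrow> int \<Rightarrow> nat \<Rightarrow> real" where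
  "tower_factor l \<sigma> k = (real k)\<^sup>2 + (real_of_int (\<sigma> * l) + 1) * real k
     + (real_of_int (\<sigma> * l) + (q (ladder (- \<sigma>) (e l)))\<^sup>2)"

lemma tower_0 [simp]: "tower l \<sigma> 0 = e l"
  and tower_Suc: "tower l \<sigma> (Suc m) = ladder \<sigma> (tower l \<sigma> m)"
  by (simp_all add: tower_def)

context
  fixes l \<sigma> :: int
  assumes l: "l \<in> spec_K M" and \<sigma>: "\<sigma> = 1 \<or> \<sigma> = -1"
begin

lemma tower_K_type: "tower l \<sigma> m \<in> K_type M (l + 2 * \<sigma> * int m)"
proof (induction m)
  case (Suc m)
  from ladder_K_type[OF \<sigma> this] show ?case by (simp add: tower_Suc algebra_simps)
qed (simp add: e_K_type l)

text \<open>The composite preserves the line of \<open>e l\<close>, so it is a scalar, and the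
  adjoint relation identifies the scalar. This identity closes the system of differential
  equations.\<close>

lemma ladder_ladder_e:
  "ladder \<sigma> (ladder (- \<sigma>) (e l)) = cscale M (- of_real ((q (ladder (- \<sigma>) (e l)))\<^sup>2)) (e l)"
proof -
  have m\<sigma>: "- \<sigma> = 1 \<or> - \<sigma> = -1" using \<sigma> by auto
  have "ladder \<sigma> (ladder (- \<sigma>) (e l)) \<in> K_type M (l + 2 * (- \<sigma>) + 2 * \<sigma>)"
    by (intro ladder_K_type \<sigma> m\<sigma> e_K_type l)
  hence "ladder \<sigma> (ladder (- \<sigma>) (e l)) = cscale M (coord l (ladder \<sigma> (ladder (- \<sigma>) (e l)))) (e l)"
    by (intro K_type_eq_coord l) simp
  also have "coord l (ladder \<sigma> (ladder (- \<sigma>) (e l))) = - of_real ((q (ladder (- \<sigma>) (e l)))\<^sup>2)"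
    by (simp only: coord_def b_ladder[OF \<sigma>] b_norm)
  finally show ?thesis .
qed

text \<open>Commuting the backward operator past one more forward step adds
  \<open>\<sigma> * l + 2 * int (Suc m)\<close>, the increment of
  \<open>tower_factor\<close>.\<close>

lemma ladder_tower_Suc:
  "ladder (- \<sigma>) (tower l \<sigma> (Suc m)) =
     cscale M (- of_real (tower_factor l \<sigma> m))
       (tower l \<sigma> m)"
proof (induction m)
  case 0
  let ?k = "(q (ladder (- \<sigma>) (e l)))\<^sup>2"
  have "ladder (- \<sigma>) (ladder \<sigma> (e l)) = ladder \<sigma> (ladder (- \<sigma>) (e l)) - cscale M (of_int (\<sigma> * l)) (e l)"
    using ladder_commutator[OF \<sigma> e_K_type[OF l]] by (simp only: eq_diff_eq)
  also have "\<dots> = cscale M (- of_real ?k - of_int (\<sigma> * l)) (e l)"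
    unfolding ladder_ladder_e V.scale_left_diff_distrib ..
  also have "- complex_of_real ?k - of_int (\<sigma> * l) = - of_real ((real 0)\<^sup>2 + (real_of_int (\<sigma> * l) + 1) * real 0 + (real_of_int (\<sigma> * l) + ?k))"
    by simp
  finally show ?case by (simp add: tower_Suc tower_factor_def)
next
  case (Suc m)
  let ?k = "(q (ladder (- \<sigma>) (e l)))\<^sup>2"
  have "ladder \<sigma> (ladder (- \<sigma>) (tower l \<sigma> (Suc m))) =
      cscale M (- of_real (tower_factor l \<sigma> m)) (tower l \<sigma> (Suc m))"
    unfolding Suc.IH by (simp only: ladder_scale tower_Suc)
  moreover have "ladder \<sigma> (ladder (- \<sigma>) (tower l \<sigma> (Suc m))) = ladder (- \<sigma>) (tower l \<sigma> (Suc (Suc m)))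
      + cscale M (of_int (\<sigma> * (l + 2 * \<sigma> * int (Suc m)))) (tower l \<sigma> (Suc m))"
    unfolding tower_Suc[of _ _ "Suc m"] by (rule ladder_commutator[OF \<sigma> tower_K_type])
  moreover have "\<sigma> * (l + 2 * \<sigma> * int (Suc m)) = \<sigma> * l + 2 * int (Suc m)" using \<sigma> by auto
  ultimately have "ladder (- \<sigma>) (tower l \<sigma> (Suc (Suc m))) =
      cscale M (- of_real (tower_factor l \<sigma> m) - of_int (\<sigma> * l + 2 * int (Suc m)))
        (tower l \<sigma> (Suc m))"
    by (simp only: V.scale_left_diff_distrib eq_diff_eq)
  also have "- complex_of_real (tower_factor l \<sigma> m) - of_int (\<sigma> * l + 2 * int (Suc m))
      = - of_real (tower_factor l \<sigma> (Suc m))"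
    by (simp add: tower_factor_def power2_eq_square algebra_simps)
  finally show ?case .
qed

lemma q_tower_Suc:
  "(q (tower l \<sigma> (Suc m)))\<^sup>2 =
     (tower_factor l \<sigma> m) * (q (tower l \<sigma> m))\<^sup>2"
proof -
  have "complex_of_real ((q (tower l \<sigma> (Suc m)))\<^sup>2) = - b (tower l \<sigma> m) (ladder (- \<sigma>) (tower l \<sigma> (Suc m)))"
    unfolding b_norm[symmetric] tower_Suc by (rule b_ladder[OF \<sigma>])
  also have "\<dots> = of_real ((tower_factor l \<sigma> m) * (q (tower l \<sigma> m))\<^sup>2)"
    unfolding ladder_tower_Suc b_scale_right b_norm complex_cnj_minus complex_cnj_complex_of_real of_real_mult
    by (simp only: mult_minus_left minus_minus)
  finally show ?thesis unfolding of_real_eq_iff .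
qed

lemma q_tower_prod:
  "(q (tower l \<sigma> m))\<^sup>2 =
     (\<Prod>k<m. tower_factor l \<sigma> k)"
  by (induction m) (simp_all add: q_tower_Suc e l mult.commute)

text \<open>A tower that vanishes once vanishes from there on. Below a nonzero member each factor is
  therefore a quotient of squares of positive norms.\<close>

lemma tower_factor_pos:
  assumes "tower l \<sigma> m \<noteq> 0" "k < m"
  shows "tower_factor l \<sigma> k > 0"
proof -
  have nz: "tower l \<sigma> j \<noteq> 0" if "j \<le> m" for j
  proof
    assume *: "tower l \<sigma> j = 0"
    have "ladder \<sigma> 0 = 0" using ladder_scale[of \<sigma> 0 0] by simp
    hence "tower l \<sigma> (j + i) = 0" for i by (induction i) (simp_all add: * tower_Suc)
    from this[of "m - j"] show False using that assms(1) by simp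
  qed
  have "(q (tower l \<sigma> k))\<^sup>2 > 0" "(q (tower l \<sigma> (Suc k)))\<^sup>2 > 0"
    using nz[of k] nz[of "Suc k"] assms(2) by simp_all
  thus ?thesis unfolding q_tower_Suc[of k] by (simp add: zero_less_mult_iff)
qed

end

text \<open>A ladder operator against the direction of a tower goes back one step up to a scalar, or
  at \<open>e l\<close> enters the other tower. Hence the span is stable under the Lie algebra and
  \<open>K\<close>, and irreducibility applies.\<close>

lemma span_towers:
  assumes l: "l \<in> spec_K M"
  shows "V.span {tower l \<sigma> m | \<sigma> m. \<sigma> = 1 \<or> \<sigma> = -1} = UNIV"
proof -
  define T where "T = {tower l \<sigma> m | \<sigma> m. \<sigma> = 1 \<or> \<sigma> = -1}"
  have lin: "f ` V.span T \<subseteq> V.span T"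
    if f: "\<And>v w. f (v + w) = f v + f w" "\<And>c v. f (cscale M c v) = cscale M c (f v)" "\<And>v. v \<in> T \<Longrightarrow> f v \<in> V.span T" for f
  proof (rule image_subsetI)
    fix v assume "v \<in> V.span T"
    thus "f v \<in> V.span T"
    proof (induction rule: V.span_induct_alt)
      case base
      have "f 0 = 0" using f(2)[of 0 0] by simp
      thus ?case by (simp add: V.span_zero)
    qed (simp add: f V.span_add V.span_scale)
  qed
  have ladder_T: "ladder \<tau> v \<in> V.span T" if \<tau>: "\<tau> = 1 \<or> \<tau> = -1" and v: "v \<in> T" for \<tau> v
  proof -
    from v obtain \<sigma> m where v: "v = tower l \<sigma> m" and \<sigma>: "\<sigma> = 1 \<or> \<sigma> = -1" by (auto simp: T_def)
    show ?thesis
    proof (cases "\<tau> = \<sigma>")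
      case True
      hence "ladder \<tau> v = tower l \<sigma> (Suc m)" by (simp add: v tower_Suc)
      thus ?thesis using \<sigma> by (auto simp: T_def intro!: V.span_base)
    next
      case False
      hence \<tau>': "\<tau> = - \<sigma>" using \<tau> \<sigma> by auto
      show ?thesis
      proof (cases m)
        case 0
        hence "ladder \<tau> v = tower l \<tau> (Suc 0)" by (simp add: v tower_Suc)
        thus ?thesis using \<tau> by (auto simp: T_def intro!: V.span_base)
      next
        case (Suc k)
        show ?thesis unfolding v \<tau>' Suc ladder_tower_Suc[OF l \<sigma>]
          using \<sigma> by (intro V.span_scale V.span_base) (auto simp: T_def)
      qed
    qed
  qed
  have K_T: "\<exists>n. v \<in> K_type M n" if "v \<in> T" for v
    using that tower_K_type[OF l] by (auto simp: T_def)
  have H: "lie_act M mat_H ` V.span T \<subseteq> V.span T"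
  proof (rule lin)
    fix v assume "v \<in> T"
    thus "lie_act M mat_H v \<in> V.span T"
      unfolding H_eq_ladder[of v 1] by (intro V.span_add ladder_T) simp_all
  qed (simp_all add: lie_plus lie_scale J_H_S_in_sl2)
  have S: "lie_act M mat_S ` V.span T \<subseteq> V.span T"
  proof (rule lin)
    fix v assume "v \<in> T"
    thus "lie_act M mat_S v \<in> V.span T"
      unfolding S_eq_ladder[of 1 v, OF disjI1[OF refl]] by (intro V.span_scale V.span_diff ladder_T) simp_all
  qed (simp_all add: lie_plus lie_scale J_H_S_in_sl2)
  have J: "lie_act M mat_J ` V.span T \<subseteq> V.span T"
  proof (rule lin)
    fix v assume v: "v \<in> T"
    then obtain n where "v \<in> K_type M n" using K_T by blast
    from J_K_type[OF this] show "lie_act M mat_J v \<in> V.span T"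
      using v by (simp add: V.span_scale V.span_base)
  qed (simp_all add: lie_plus lie_scale J_H_S_in_sl2)
  have "lie_act M X ` V.span T \<subseteq> V.span T" if X: "X \<in> sl2" for X
  proof (rule image_subsetI)
    fix v assume v: "v \<in> V.span T"
    from X obtain r s t where X': "X = r *\<^sub>R mat_H + s *\<^sub>R mat_S + t *\<^sub>R mat_J" by (rule sl2_decomposition)
    have "lie_act M X v = cscale M (of_real r) (lie_act M mat_H v) + cscale M (of_real s) (lie_act M mat_S v) + cscale M (of_real t) (lie_act M mat_J v)"
      unfolding X' by (simp only: lie_add sl2_scaleR sl2_add lie_scaleR J_H_S_in_sl2)
    also have "\<dots> \<in> V.span T" using H S J v by (intro V.span_add V.span_scale) auto
    finally show "lie_act M X v \<in> V.span T" .
  qed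
  moreover have "K_act M k ` V.span T \<subseteq> V.span T" if k: "k \<in> SO2" for k
  proof (rule lin)
    fix v assume "v \<in> T"
    then obtain n where "v \<in> K_type M n" using K_T by blast
    moreover obtain \<theta> where "k = rot \<theta>" using k by (auto simp: SO2_eq_range_rot)
    ultimately show "K_act M k v \<in> V.span T"
      using \<open>v \<in> T\<close> by (simp add: K_typeD V.span_scale V.span_base)
  qed (use k in \<open>auto simp: K_plus K_scale\<close>)
  moreover have "V.subspace (V.span T)" by (rule V.subspace_span)
  ultimately have "V.span T = {0} \<or> V.span T = UNIV"
    using irreducible unfolding gK_irreducible_def by blast
  moreover have "tower l 1 0 \<in> T" unfolding T_def by blast
  hence "e l \<in> V.span T" using V.span_base[of "tower l 1 0" T] by simp
  moreover have "e l \<noteq> 0"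
  proof
    assume "e l = 0"
    hence "q (e l) = 0" by simp
    thus False using e(2)[OF l] by simp
  qed
  ultimately have "V.span T = UNIV" by auto
  thus ?thesis unfolding T_def .
qed

text \<open>Otherwise \<open>coord n\<close> would vanish on all members of the towers, thus on
  their span, which contains \<open>e n\<close>.\<close>

lemma spec_tower:
  assumes l: "l \<in> spec_K M" and n: "n \<in> spec_K M"
  obtains \<sigma> m where "\<sigma> = 1 \<or> \<sigma> = -1" "n = l + 2 * \<sigma> * int m" "tower l \<sigma> m \<noteq> 0"
proof (rule ccontr)
  note obt = that
  assume neg: "\<not> thesis"
  have "coord n v = 0" if "v \<in> V.span {tower l \<sigma> m | \<sigma> m. \<sigma> = 1 \<or> \<sigma> = -1}" for v
    using that
  proof (induction rule: V.span_induct_alt)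
    case (step c x y)
    then obtain \<sigma> m where x: "x = tower l \<sigma> m" and \<sigma>: "\<sigma> = 1 \<or> \<sigma> = -1" by blast
    have "coord n x = 0"
    proof (cases "x = 0")
      case False
      hence "n \<noteq> l + 2 * \<sigma> * int m" using neg obt[of \<sigma> m] x \<sigma> by blast
      thus ?thesis using coord_K_type[OF tower_K_type[OF l \<sigma>] n] x by blast
    qed simp
    with step show ?case by (simp add: coord_add coord_scale)
  qed simp
  hence "coord n (e n) = 0" unfolding span_towers[OF l] by blast
  thus False using coord_e[OF n n] by simp
qed

text \<open>Every tower member is a multiple of some \<open>e n\<close> or 0. \<open>S\<close> only
  has to contain the support, so one \<open>S\<close> can serve several vectors.\<close>

lemma coord_expansion:
  obtains S where "finite S" "S \<subseteq> spec_K M" "\<forall>n\<in>spec_K M - S. coord n v = 0"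
    "v = (\<Sum>n\<in>S. cscale M (coord n v) (e n))"
proof -
  obtain l where l: "l \<in> spec_K M" by (rule minimal_K_type)
  have "v \<in> V.span {tower l \<sigma> m | \<sigma> m. \<sigma> = 1 \<or> \<sigma> = -1}" unfolding span_towers[OF l] by blast
  hence "\<exists>S. finite S \<and> S \<subseteq> spec_K M \<and> (\<exists>c. v = (\<Sum>n\<in>S. cscale M (c n) (e n)))"
  proof (induction rule: V.span_induct_alt)
    case base
    show ?case by (intro exI[of _ "{}"]) simp
  next
    case (step a x y)
    then obtain \<sigma> m where x: "x = tower l \<sigma> m" and \<sigma>: "\<sigma> = 1 \<or> \<sigma> = -1" by blast
    from step obtain S c where S: "finite S" "S \<subseteq> spec_K M" "y = (\<Sum>n\<in>S. cscale M (c n) (e n))" by blast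
    define j where "j = l + 2 * \<sigma> * int m"
    have xj: "x \<in> K_type M j" unfolding x j_def by (rule tower_K_type[OF l \<sigma>])
    show ?case
    proof (cases "j \<in> spec_K M")
      case False
      hence "x = 0" using xj not_spec by blast
      thus ?thesis using S by auto
    next
      case True
      define c' where "c' n = (if n \<in> S then c n else 0) + (if n = j then a * coord j x else 0)" for n
      have "(\<Sum>n\<in>insert j S. cscale M (c' n) (e n)) = (\<Sum>n\<in>insert j S. cscale M (if n \<in> S then c n else 0) (e n))
          + (\<Sum>n\<in>insert j S. cscale M (if n = j then a * coord j x else 0) (e n))"
        by (simp add: c'_def V.scale_left_distrib sum.distrib)
      also have "(\<Sum>n\<in>insert j S. cscale M (if n \<in> S then c n else 0) (e n)) = y"
        unfolding S(3) using S(1) by (intro sum.mono_neutral_cong_right) auto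
      also have "(\<Sum>n\<in>insert j S. cscale M (if n = j then a * coord j x else 0) (e n)) = cscale M (a * coord j x) (e j)"
        using S(1) by (subst sum.remove[of _ j]) (auto intro!: sum.neutral)
      also have "cscale M (a * coord j x) (e j) = cscale M a x"
        using K_type_eq_coord[OF True xj] by (metis V.scale_scale)
      finally show ?thesis using S True by (intro exI[of _ "insert j S"]) (auto intro!: exI[of _ c'] simp: add.commute)
    qed
  qed
  then obtain S c where S: "finite S" "S \<subseteq> spec_K M" "v = (\<Sum>n\<in>S. cscale M (c n) (e n))" by blast
  have co: "coord n v = (if n \<in> S then c n else 0)" if "n \<in> spec_K M" for n
    unfolding S(3) by (rule coord_lincomb[OF S(1,2) that])
  show ?thesis
  proof (rule that[of S])
    show "v = (\<Sum>n\<in>S. cscale M (coord n v) (e n))"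
      by (subst S(3), intro sum.cong refl) (use co S(2) in auto)
  qed (use S co in auto)
qed

lemma q_sum:
  assumes S: "finite S" "S \<subseteq> spec_K M"
  shows "(q (\<Sum>n\<in>S. cscale M (c n) (e n)))\<^sup>2 = (\<Sum>n\<in>S. (cmod (c n))\<^sup>2)"
proof -
  define v where "v = (\<Sum>n\<in>S. cscale M (c n) (e n))"
  have co: "coord n v = c n" if "n \<in> S" for n
    unfolding v_def using coord_lincomb[OF S, of n c] S(2) that by auto
  have "complex_of_real ((q v)\<^sup>2) = (\<Sum>n\<in>S. c n * b (e n) v)"
    unfolding b_norm[symmetric] by (subst (1) v_def) (simp add: b_sum b_scale)
  also have "\<dots> = (\<Sum>n\<in>S. c n * cnj (c n))"
    by (intro sum.cong refl) (simp add: b_cnj[of "e _" v] co[unfolded coord_def])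
  also have "\<dots> = of_real (\<Sum>n\<in>S. (cmod (c n))\<^sup>2)"
    by (simp add: complex_norm_square del: of_real_power flip: of_real_power)
  finally show ?thesis unfolding v_def of_real_eq_iff .
qed

text \<open>Averaging \<open>w\<close> over the \<open>N\<close>-th roots of unity in \<open>K\<close>, weighted by the trigonometric polynomial
  with coefficients \<open>c\<close>, multiplies its coordinates by \<open>c\<close>; by Parseval and Cauchy-Schwarz, the mean
  modulus of the weight is at most the Euclidean norm of \<open>c\<close>.\<close>

lemma coord_multiplier_bound:
  assumes p: "is_norm M p" "\<And>k v. k \<in> SO2 \<Longrightarrow> p (K_act M k v) = p v"
    and S: "finite S" "S \<subseteq> spec_K M"
  shows "p (\<Sum>n\<in>S. cscale M (c n * coord n w) (e n)) \<le> sqrt (\<Sum>n\<in>S. (cmod (c n))\<^sup>2) * p w"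
proof -
  interpret P: normed_module M p by unfold_locales (rule p)
  obtain R where R: "finite R" "R \<subseteq> spec_K M" "\<forall>n\<in>spec_K M - R. coord n w = 0"
    "w = (\<Sum>n\<in>R. cscale M (coord n w) (e n))"
    by (rule coord_expansion)
  \<comment> \<open>More than twice every index that occurs, so that all differences of indices stay
    below \<open>N\<close> in absolute value.\<close>
  define N where "N = nat (2 * Max (insert 0 (abs ` (R \<union> S))) + 1)"
  have bd: "\<bar>j\<bar> \<le> Max (insert 0 (abs ` (R \<union> S)))" if "j \<in> R \<union> S" for j
    using that R(1) S(1) by (intro Max_ge) auto
  have M0: "Max (insert 0 (abs ` (R \<union> S))) \<ge> 0" using R(1) S(1) by (intro Max_ge) auto
  have N: "N > 0" "\<And>j n. j \<in> R \<union> S \<Longrightarrow> n \<in> R \<union> S \<Longrightarrow> \<bar>j - n\<bar> < int N"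
  proof -
    show "N > 0" using M0 by (simp add: N_def)
    fix j n assume "j \<in> R \<union> S" "n \<in> R \<union> S"
    from bd[OF this(1)] bd[OF this(2)] M0 show "\<bar>j - n\<bar> < int N" by (simp add: N_def)
  qed
  define C where "C k = (\<Sum>n\<in>S. c n * cnj (unity_root N k n))" for k
  define k\<theta> where "k\<theta> k = rot (2 * pi * real k / N)" for k :: nat
  have K_sum: "K_act M (k\<theta> k) (\<Sum>n\<in>T. f n) = (\<Sum>n\<in>T. K_act M (k\<theta> k) (f n))" for k T and f :: "int \<Rightarrow> 'v"
    by (induction T rule: infinite_finite_induct) (simp_all add: k\<theta>_def K_plus)
  have Kw: "K_act M (k\<theta> k) w = (\<Sum>n\<in>R. cscale M (coord n w * unity_root N k n) (e n))" for k
  proof -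
    have "K_act M (k\<theta> k) w = (\<Sum>n\<in>R. K_act M (k\<theta> k) (cscale M (coord n w) (e n)))"
      by (subst R(4)) (rule K_sum)
    also have "\<dots> = (\<Sum>n\<in>R. cscale M (coord n w * unity_root N k n) (e n))"
    proof (intro sum.cong refl)
      fix n assume "n \<in> R"
      hence "e n \<in> K_type M n" using R(2) e_K_type by blast
      thus "K_act M (k\<theta> k) (cscale M (coord n w) (e n)) = cscale M (coord n w * unity_root N k n) (e n)"
        by (simp add: k\<theta>_def unity_root_def K_scale K_typeD mult_ac)
    qed
    finally show ?thesis .
  qed
  have "(\<Sum>k<N. cscale M (C k) (K_act M (k\<theta> k) w)) =
      (\<Sum>n\<in>R. cscale M (coord n w * (\<Sum>k<N. C k * unity_root N k n)) (e n))"
    unfolding Kw V.scale_sum_right V.scale_scale sum_distrib_left V.scale_sum_left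
    by (subst sum.swap) (simp add: mult_ac)
  also have "\<dots> = (\<Sum>n\<in>R. cscale M (coord n w * (of_nat N * (if n \<in> S then c n else 0))) (e n))"
    unfolding C_def using N S(1) by (intro sum.cong refl) (subst dft_inversion, auto)
  also have "\<dots> = (\<Sum>n\<in>R \<inter> S. cscale M (of_nat N * (c n * coord n w)) (e n))"
    using R(1) by (intro sum.mono_neutral_cong_right) (auto simp: mult_ac)
  also have "\<dots> = (\<Sum>n\<in>S. cscale M (of_nat N * (c n * coord n w)) (e n))"
    using S R(3) by (intro sum.mono_neutral_left) auto
  also have "\<dots> = cscale M (of_nat N) (\<Sum>n\<in>S. cscale M (c n * coord n w) (e n))"
    by (simp add: V.scale_sum_right)
  finally have avg: "cscale M (of_nat N) (\<Sum>n\<in>S. cscale M (c n * coord n w) (e n)) = (\<Sum>k<N. cscale M (C k) (K_act M (k\<theta> k) w))" ..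
  have "N * p (\<Sum>n\<in>S. cscale M (c n * coord n w) (e n)) = p (\<Sum>k<N. cscale M (C k) (K_act M (k\<theta> k) w))"
    unfolding avg[symmetric] P.p_scale by simp
  also have "\<dots> \<le> (\<Sum>k<N. p (cscale M (C k) (K_act M (k\<theta> k) w)))" by (rule P.p_sum)
  also have "\<dots> = (\<Sum>k<N. cmod (C k)) * p w"
    by (simp add: P.p_scale p(2) k\<theta>_def sum_distrib_right)
  also have "(\<Sum>k<N. cmod (C k)) \<le> N * sqrt (\<Sum>n\<in>S. (cmod (c n))\<^sup>2)"
  proof (rule power2_le_imp_le)
    have "(\<Sum>k<N. cmod (C k))\<^sup>2 \<le> (\<Sum>k<N. (cmod (C k))\<^sup>2) * N"
      using Cauchy_Schwarz_ineq_sum[of "\<lambda>k. cmod (C k)" "\<lambda>_. 1" "{..<N}"] by simp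
    also have "(\<Sum>k<N. (cmod (C k))\<^sup>2) = N * (\<Sum>n\<in>S. (cmod (c n))\<^sup>2)"
      unfolding C_def using N S(1) by (intro dft_parseval) auto
    finally show "(\<Sum>k<N. cmod (C k))\<^sup>2 \<le> (N * sqrt (\<Sum>n\<in>S. (cmod (c n))\<^sup>2))\<^sup>2"
      by (simp add: power_mult_distrib sum_nonneg power2_eq_square mult_ac)
  qed (simp add: sum_nonneg)
  finally have "N * p (\<Sum>n\<in>S. cscale M (c n * coord n w) (e n)) \<le> N * (sqrt (\<Sum>n\<in>S. (cmod (c n))\<^sup>2) * p w)"
    by (simp add: mult_right_mono mult.assoc)
  thus ?thesis using N(1) by simp
qed

end

section \<open>Matrix coefficients along the diagonal subgroup\<close>

text \<open>The functions \<open>g k\<close> are the successive derivatives of \<open>g 0\<close>.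
  Closeness of \<open>g m\<close> to its value at 0 is integrated \<open>m\<close> times, each time
  using that the next lower derivative vanishes at 0.\<close>

lemma taylor_leading_term:
  fixes g :: "nat \<Rightarrow> real \<Rightarrow> complex"
  assumes d: "\<And>k t. (g k has_vector_derivative g (Suc k) t) (at t)"
    and z: "\<And>k. k < m \<Longrightarrow> g k 0 = 0"
  shows "((\<lambda>t. g 0 t / of_real t ^ m) \<longlongrightarrow> g m 0 / fact m) (at_right 0)"
proof (rule tendstoI)
  fix \<epsilon> :: real assume \<epsilon>: "\<epsilon> > 0"
  have "isCont (g m) 0" using has_vector_derivative_continuous[OF d] .
  then obtain \<delta> where \<delta>: "\<delta> > 0" "\<And>t. dist t 0 < \<delta> \<Longrightarrow> dist (g m t) (g m 0) < \<epsilon> / 2"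
    using \<epsilon> unfolding continuous_at_eps_delta by (metis half_gt_zero)
  have bound: "norm (g (m - j) t - g m 0 * of_real (t ^ j / fact j)) \<le> \<epsilon> / 2 * (t ^ j / fact j)"
    if "j \<le> m" "0 \<le> t" "t < \<delta>" for j t
    using that
  proof (induction j arbitrary: t)
    case 0
    thus ?case using \<delta>(2)[of t] by (simp add: dist_norm)
  next
    case (Suc j)
    have Sj: "Suc (m - Suc j) = m - j" using Suc.prems by simp
    show ?case
    proof (cases "t = 0")
      case True
      thus ?thesis using z[of "m - Suc j"] Suc.prems by simp
    next
      case False
      have pd: "((\<lambda>t. t ^ Suc j / fact (Suc j)) has_real_derivative (x ^ j / fact j)) (at x)" for x :: real
        by (rule derivative_eq_intros refl | simp)+
      have "norm ((g (m - Suc j) t - g m 0 * of_real (t ^ Suc j / fact (Suc j))) -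
          (g (m - Suc j) 0 - g m 0 * of_real (0 ^ Suc j / fact (Suc j))))
          \<le> \<epsilon> / 2 * (t ^ Suc j / fact (Suc j)) - \<epsilon> / 2 * (0 ^ Suc j / fact (Suc j))"
      proof (rule differentiable_bound_general[where a = 0 and b = t])
        have dd: "((\<lambda>x. g (m - Suc j) x - g m 0 * of_real (x ^ Suc j / fact (Suc j))) has_vector_derivative
            (g (m - j) x - g m 0 * of_real (x ^ j / fact j))) (at x)" for x
        proof -
          have "((\<lambda>x. g m 0 * complex_of_real (x ^ Suc j / fact (Suc j))) has_vector_derivative g m 0 * of_real (x ^ j / fact j)) (at x)"
            by (rule has_vector_derivative_mult_right[OF has_vector_derivative_of_real[OF pd]])
          from has_vector_derivative_diff[OF d[of "m - Suc j" x, unfolded Sj] this] show ?thesis .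
        qed
        show "continuous_on {0..t} (\<lambda>x. g (m - Suc j) x - g m 0 * of_real (x ^ Suc j / fact (Suc j)))"
          by (intro continuous_at_imp_continuous_on ballI has_vector_derivative_continuous[OF dd])
        show "continuous_on {0..t} (\<lambda>x. \<epsilon> / 2 * (x ^ Suc j / fact (Suc j)))"
          by (intro continuous_intros) simp
        fix x assume x: "0 < x" "x < t"
        show "((\<lambda>x. g (m - Suc j) x - g m 0 * of_real (x ^ Suc j / fact (Suc j))) has_vector_derivative
            (g (m - j) x - g m 0 * of_real (x ^ j / fact j))) (at x)" by (rule dd)
        show "((\<lambda>x. \<epsilon> / 2 * (x ^ Suc j / fact (Suc j))) has_vector_derivative \<epsilon> / 2 * (x ^ j / fact j)) (at x)"
          by (rule DERIV_cmult[OF pd, unfolded has_real_derivative_iff_has_vector_derivative])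
        show "norm (g (m - j) x - g m 0 * of_real (x ^ j / fact j)) \<le> \<epsilon> / 2 * (x ^ j / fact j)"
          using Suc.IH[of x] Suc.prems x by simp
      qed (use Suc.prems False in auto)
      thus ?thesis using z[of "m - Suc j"] Suc.prems by simp
    qed
  qed
  have "dist (g 0 t / of_real t ^ m) (g m 0 / fact m) < \<epsilon>" if t: "0 < t" "t < \<delta>" for t
  proof -
    have "g 0 t / of_real t ^ m - g m 0 / fact m = (g 0 t - g m 0 * of_real (t ^ m / fact m)) / of_real t ^ m"
      using t by (simp add: field_simps)
    hence "dist (g 0 t / of_real t ^ m) (g m 0 / fact m) = norm (g 0 t - g m 0 * of_real (t ^ m / fact m)) / t ^ m"
      using t by (simp add: dist_norm norm_divide norm_power)
    also have "\<dots> \<le> \<epsilon> / 2 * (t ^ m / fact m) / t ^ m"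
      using bound[of m t] t by (intro divide_right_mono) auto
    also have "\<dots> = \<epsilon> / 2 / fact m" using t by simp
    also have "\<dots> \<le> \<epsilon> / 2 / 1" using \<epsilon> by (intro divide_left_mono) (auto simp: fact_ge_1)
    also have "\<dots> < \<epsilon>" using \<epsilon> by simp
    finally show ?thesis .
  qed
  thus "\<forall>\<^sub>F t in at_right 0. dist (g 0 t / of_real t ^ m) (g m 0 / fact m) < \<epsilon>"
    unfolding eventually_at_right_field using \<delta>(1) by blast
qed

locale unitary_isometric = unitary_gK_module M b q e + isometric_globalization M p \<pi>
  for M :: "'v::ab_group_add gK" and b q e p \<pi>
begin

lemma e_nonzero: "n \<in> spec_K M \<Longrightarrow> e n \<noteq> 0"
  using e(2)[of n] Q.p_zero by (metis zero_neq_one)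

text \<open>The multiplier bound with a single coefficient 1: the projection to a
  \<open>K\<close>-type is an average over \<open>K\<close> and does not increase \<open>p\<close>.
  Thus coordinates defined through \<open>q\<close> are continuous for \<open>p\<close>.\<close>

lemma coord_bound:
  assumes n: "n \<in> spec_K M"
  shows "cmod (coord n v) \<le> 1 / p (e n) * p v"
proof -
  have "p (\<Sum>j\<in>{n}. cscale M (1 * coord j v) (e j)) \<le> sqrt (\<Sum>j\<in>{n}. (cmod 1)\<^sup>2) * p v"
    by (rule coord_multiplier_bound) (use n in \<open>auto simp: is_norm\<close>)
  hence "cmod (coord n v) * p (e n) \<le> p v" by (simp add: p_scale)
  moreover have "p (e n) > 0" using e_nonzero[OF n] p_ge_0[of "e n"] p_eq_0_iff[of "e n"] by linarith
  ultimately show ?thesis by (simp add: field_simps)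
qed

lemma coord_lipschitz:
  assumes n: "n \<in> spec_K M"
  shows "cmod (coord n v - coord n w) \<le> 1 / p (e n) * p (v - w)"
  using coord_bound[OF n, of "v - w"] by (simp add: coord_def b_minus)

section \<open>Coefficients of the diagonal subgroup and their differential equations\<close>

definition F :: "int \<Rightarrow> real \<Rightarrow> 'v \<Rightarrow> complex" where
  "F n t v = matrix_coeff (coord n) (mat_A t) v"

context
  fixes n :: int
  assumes n: "n \<in> spec_K M"
begin

lemma F_0: "F n 0 v = coord n v"
  using matrix_coeff_one[OF coord_add coord_scale coord_bound[OF n], of v]
  by (simp add: F_def mat_1_mat2)

lemma F_add: "F n t (v + w) = F n t v + F n t w"
  and F_scale: "F n t (cscale M c v) = c * F n t v"
  unfolding F_def
  by (rule matrix_coeff_add[OF coord_add coord_scale coord_bound[OF n] mat_A_in_SL2]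
           matrix_coeff_scale[OF coord_add coord_scale coord_bound[OF n] mat_A_in_SL2])+

lemma F_diff: "F n t (v - w) = F n t v - F n t w"
  using F_add[of t "v - w" w] by simp

lemma F_derivative: "((\<lambda>t. F n t v) has_vector_derivative F n t (lie_act M mat_H v)) (at t)"
proof -
  have "((\<lambda>s. matrix_coeff (coord n) (mat_A t ** mexp (s *\<^sub>R mat_H)) v) has_vector_derivative F n t (lie_act M mat_H v)) (at 0)"
    unfolding F_def
    by (rule matrix_coeff_derivative[OF coord_add coord_scale coord_bound[OF n] _ _ mat_A_in_SL2])
       (simp_all add: J_H_S_in_sl2 mexp_in_SL2)
  hence "((\<lambda>s. F n (t + s) v) has_vector_derivative F n t (lie_act M mat_H v)) (at (t - t))"
    by (simp only: F_def mexp_H mat_A_add diff_self)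
  moreover have "((\<lambda>s. s - t) has_vector_derivative 1) (at t)"
    by (auto intro!: derivative_eq_intros)
  ultimately have "((\<lambda>s. F n (t + s) v) \<circ> (\<lambda>s. s - t) has_vector_derivative 1 *\<^sub>R F n t (lie_act M mat_H v)) (at t)"
    by (intro vector_diff_chain_at)
  thus ?thesis by (simp add: o_def)
qed

text \<open>Both sides are the derivative at \<open>s = 0\<close> of the matrix coefficient at \<open>rot s ** mat_A t\<close>:
  on the left by equivariance under \<open>K\<close>, on the right by moving \<open>rot s\<close> past \<open>mat_A t\<close>.\<close>

lemma F_rotation:
  "\<i> * of_int n * F n t v =
    complex_of_real (cosh (2 * t)) * F n t (lie_act M mat_J v) + complex_of_real (sinh (2 * t)) * F n t (lie_act M mat_S v)"
proof -
  define X where "X = cosh (2 * t) *\<^sub>R mat_J + sinh (2 * t) *\<^sub>R mat_S"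
  have X: "X \<in> sl2"
    by (simp add: X_def mat2_scaleR mat2_add mat2_in_sl2)
  have mexp: "mexp (s *\<^sub>R X) \<in> SL2" for s
  proof -
    have "det (mat_A t ** mexp (s *\<^sub>R X)) = det (rot s ** mat_A t)"
      unfolding X_def mat_A_mult_mexp ..
    thus ?thesis
      using mat_A_in_SL2[of t] subsetD[OF SO2_subset_SL2 rot_in_SO2, of s] by (simp add: SL2_def det_mul)
  qed
  have "((\<lambda>s. matrix_coeff (coord n) (mat_A t ** mexp (s *\<^sub>R X)) v) has_vector_derivative F n t (lie_act M X v)) (at 0)"
    unfolding F_def
    by (rule matrix_coeff_derivative[OF coord_add coord_scale coord_bound[OF n] X mexp mat_A_in_SL2])
  moreover have "matrix_coeff (coord n) (mat_A t ** mexp (s *\<^sub>R X)) v = cis (of_int n * s) * F n t v" for s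
    unfolding X_def mat_A_mult_mexp F_def
    by (rule matrix_coeff_K_left[OF coord_add coord_scale coord_bound[OF n] rot_in_SO2 coord_K[OF n] mat_A_in_SL2])
  ultimately have "((\<lambda>s. cis (of_int n * s) * F n t v) has_vector_derivative F n t (lie_act M X v)) (at 0)"
    by simp
  moreover have "((\<lambda>s. cis (of_int n * s) * F n t v) has_vector_derivative (\<i> * of_int n * cis (of_int n * 0)) * F n t v) (at 0)"
    using cis_DERIV[of "of_int n" 0] by (intro has_vector_derivative_mult_left) simp
  ultimately have "F n t (lie_act M X v) = (\<i> * of_int n * cis (of_int n * 0)) * F n t v"
    by (rule vector_derivative_unique_at)
  moreover have "lie_act M X v = cscale M (of_real (cosh (2 * t))) (lie_act M mat_J v) + cscale M (of_real (sinh (2 * t))) (lie_act M mat_S v)"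
    unfolding X_def lie_add[OF sl2_scaleR[OF J_H_S_in_sl2(1)] sl2_scaleR[OF J_H_S_in_sl2(3)]] lie_scaleR[OF J_H_S_in_sl2(1)] lie_scaleR[OF J_H_S_in_sl2(3)] ..
  ultimately show ?thesis by (simp add: F_add F_scale)
qed

text \<open>Express \<open>mat_S\<close> in \<open>F_rotation\<close> by the ladder operators and
  solve for their difference; the division by \<open>sinh (2 * t)\<close> is the source of the
  singularity at 0. The sum of the two ladder terms is the derivative in \<open>t\<close>.\<close>

lemma F_ladder_diff:
  assumes \<sigma>: "\<sigma> = 1 \<or> \<sigma> = -1" and v: "v \<in> K_type M j" and t: "t > 0"
  shows "F n t (ladder \<sigma> v) - F n t (ladder (- \<sigma>) v) =
    of_real (of_int \<sigma> * (of_int n - of_int j * cosh (2 * t)) / sinh (2 * t)) * F n t v"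
proof -
  define D where "D = F n t (ladder \<sigma> v) - F n t (ladder (- \<sigma>) v)"
  have "\<i> * of_int n * F n t v = complex_of_real (cosh (2 * t)) * (\<i> * of_int j * F n t v) + complex_of_real (sinh (2 * t)) * (\<i> * of_int \<sigma> * D)"
    unfolding F_rotation J_K_type[OF v] S_eq_ladder[OF \<sigma>] F_scale F_diff D_def ..
  hence "\<i> * (of_int \<sigma> * D * of_real (sinh (2 * t))) = \<i> * ((of_int n - of_int j * of_real (cosh (2 * t))) * F n t v)"
    by (simp add: algebra_simps)
  hence "of_int \<sigma> * D * of_real (sinh (2 * t)) = (of_int n - of_int j * of_real (cosh (2 * t))) * F n t v"
    by (subst (asm) mult_cancel_left) simp
  moreover have "sinh (2 * t) \<noteq> 0" using t by simp
  ultimately have "of_int \<sigma> * D = of_real ((of_int n - of_int j * cosh (2 * t)) / sinh (2 * t)) * F n t v"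
    by (simp add: field_simps)
  hence "of_int \<sigma> * (of_int \<sigma> * D) = of_int \<sigma> * (of_real ((of_int n - of_int j * cosh (2 * t)) / sinh (2 * t)) * F n t v)"
    by simp
  moreover have "of_int \<sigma> * (of_int \<sigma> * D) = D" using \<sigma> by auto
  ultimately show ?thesis unfolding D_def by simp
qed

text \<open>Expand each \<open>mat_H\<close> into the two ladder operators. Each moves the type by 2
  in one direction, so \<open>n\<close> is reached in at most \<open>m\<close> steps only by
  \<open>m\<close> steps towards it.\<close>

lemma coord_H_power:
  assumes \<sigma>: "\<sigma> = 1 \<or> \<sigma> = -1"
  shows "v \<in> K_type M j \<Longrightarrow> n = j + 2 * \<sigma> * int m \<Longrightarrow> k \<le> m \<Longrightarrow>
    coord n ((lie_act M mat_H ^^ k) v) = (if k = m then coord n ((ladder \<sigma> ^^ m) v) else 0)"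
proof (induction k arbitrary: v j m)
  case 0
  show ?case
  proof (cases "m = 0")
    case False
    hence "n \<noteq> j" using 0 \<sigma> by auto
    thus ?thesis using coord_K_type[OF "0.prems"(1) n] False by simp
  qed simp
next
  case (Suc k)
  have Hadd: "(lie_act M mat_H ^^ k) (u + w) = (lie_act M mat_H ^^ k) u + (lie_act M mat_H ^^ k) w" for u w
    by (induction k) (simp_all add: lie_plus J_H_S_in_sl2)
  obtain m' where m': "m = Suc m'" using Suc.prems(3) by (cases m) auto
  have m\<sigma>: "- \<sigma> = 1 \<or> - \<sigma> = -1" using \<sigma> by auto
  have 1: "coord n ((lie_act M mat_H ^^ k) (ladder \<sigma> v)) = (if k = m' then coord n ((ladder \<sigma> ^^ m') (ladder \<sigma> v)) else 0)"
    by (rule Suc.IH[OF ladder_K_type[OF \<sigma> Suc.prems(1)]]) (use Suc.prems m' in \<open>auto simp: algebra_simps\<close>)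
  \<comment> \<open>From the type \<open>j - 2 * \<sigma>\<close> the target is \<open>Suc m\<close>
    steps away, out of reach for \<open>k < m\<close>.\<close>
  have 2: "coord n ((lie_act M mat_H ^^ k) (ladder (- \<sigma>) v)) = (if k = Suc m then coord n ((ladder \<sigma> ^^ Suc m) (ladder (- \<sigma>) v)) else 0)"
    by (rule Suc.IH[OF ladder_K_type[OF m\<sigma> Suc.prems(1)]]) (use Suc.prems m' in \<open>auto simp: algebra_simps\<close>)
  have "(lie_act M mat_H ^^ Suc k) v = (lie_act M mat_H ^^ k) (ladder \<sigma> v) + (lie_act M mat_H ^^ k) (ladder (- \<sigma>) v)"
    unfolding funpow_Suc_right o_apply by (subst H_eq_ladder[of v \<sigma>]) (rule Hadd)
  thus ?case using 1 2 Suc.prems(3) m' by (simp add: coord_add funpow_swap1)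
qed

text \<open>The derivative is the sum of two ladder terms and \<open>F_ladder_diff\<close> gives
  their difference. Eliminating \<open>ladder \<sigma> (e l)\<close> in the first equation and
  \<open>ladder (- \<sigma>) u\<close> in the second leaves \<open>e l\<close> and \<open>u\<close>
  as the only vectors.\<close>

lemma F_lower_bound:
  assumes \<sigma>: "\<sigma> = 1 \<or> \<sigma> = -1" and l: "l \<in> spec_K M" and nl: "n = l + 2 * \<sigma> * int m"
    and L: "\<sigma> * l \<le> 2 \<or> ladder (- \<sigma>) (e l) = 0"
    and T: "T > 0" "3 * (q (ladder (- \<sigma>) (e l)))\<^sup>2 * (sinh T)\<^sup>2 \<le> real (m + 1)"
  shows "q (tower l \<sigma> m) / fact m / 2 * tanh T ^ m * cosh T powr (- real_of_int (\<sigma> * l)) \<le> cmod (F n T (e l))"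
proof -
  define u where "u = ladder (- \<sigma>) (e l)"
  define \<kappa> :: complex where "\<kappa> = - of_real ((q u)\<^sup>2)"
  define B where "B = coord n (tower l \<sigma> m) / fact m"
  have m\<sigma>: "- \<sigma> = 1 \<or> - \<sigma> = -1" using \<sigma> by auto
  have u: "u \<in> K_type M (l + 2 * (- \<sigma>))"
    unfolding u_def by (rule ladder_K_type[OF m\<sigma> e_K_type[OF l]])
  have coeff: "of_int \<sigma> * (of_int n - of_int j * cosh (2 * t)) / sinh (2 * t) =
      (real_of_int (\<sigma> * n) - real_of_int (\<sigma> * j)) / 2 / (sinh t * cosh t) - real_of_int (\<sigma> * j) * tanh t"
    if "t > 0" for t :: real and j
  proof -
    have "cosh (2 * t) = 1 + 2 * (sinh t)\<^sup>2" by (simp add: cosh_double cosh_square_eq)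
    moreover have "sinh t > 0" "cosh t > 0" using that by simp_all
    ultimately show ?thesis
      unfolding sinh_double tanh_def by (simp add: field_simps power2_eq_square)
  qed
  have coeff_l: "of_int \<sigma> * (of_int n - of_int l * cosh (2 * t)) / sinh (2 * t) =
      real m / (sinh t * cosh t) - real_of_int (\<sigma> * l) * tanh t" if "t > 0" for t
  proof -
    have "\<sigma> * n - \<sigma> * l = 2 * int m" using \<sigma> nl by auto
    hence "real_of_int (\<sigma> * n) - real_of_int (\<sigma> * l) = 2 * real m" by linarith
    thus ?thesis unfolding coeff[OF that] by simp
  qed
  \<comment> \<open>Seen from the type of \<open>u\<close> the target is \<open>m + 1\<close> steps
    away; the growth exponent drops by 2.\<close>
  have coeff_u: "of_int \<sigma> * (of_int n - of_int (l + 2 * (- \<sigma>)) * cosh (2 * t)) / sinh (2 * t) =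
      real (m + 1) / (sinh t * cosh t) - (real_of_int (\<sigma> * l) - 2) * tanh t" if "t > 0" for t
  proof -
    have a: "\<sigma> * (l + 2 * (- \<sigma>)) = \<sigma> * l - 2" "\<sigma> * n - (\<sigma> * l - 2) = 2 * int (m + 1)" using \<sigma> nl by auto
    hence "real_of_int (\<sigma> * n) - real_of_int (\<sigma> * l - 2) = 2 * real (m + 1)" by linarith
    hence h: "(real_of_int (\<sigma> * n) - real_of_int (\<sigma> * l - 2)) / 2 = real (m + 1)" by simp
    show ?thesis unfolding coeff[OF that] a h by simp
  qed
  have "cmod B / 2 * tanh T ^ m * cosh T powr (- real_of_int (\<sigma> * l)) \<le> cmod (F n T (e l))"
  proof (rule singular_system_lower_bound[where y = "\<lambda>t. F n t u" and \<kappa> = \<kappa>])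
    fix t :: real assume t: "t > 0"
    have "F n t (lie_act M mat_H (e l)) = (F n t (ladder \<sigma> (e l)) - F n t (ladder (- \<sigma>) (e l))) + 2 * F n t (ladder (- \<sigma>) (e l))"
      unfolding H_eq_ladder[of "e l" \<sigma>] F_add by simp
    also have "\<dots> = of_real (m / (sinh t * cosh t) - real_of_int (\<sigma> * l) * tanh t) * F n t (e l) + 2 * F n t u"
      unfolding F_ladder_diff[OF \<sigma> e_K_type[OF l] t] coeff_l[OF t] u_def ..
    finally show "((\<lambda>t. F n t (e l)) has_vector_derivative
        of_real (m / (sinh t * cosh t) - real_of_int (\<sigma> * l) * tanh t) * F n t (e l) + 2 * F n t u) (at t)"
      using F_derivative[of "e l" t] by simp
    have "F n t (lie_act M mat_H u) = 2 * F n t (ladder \<sigma> u) - (F n t (ladder \<sigma> u) - F n t (ladder (- \<sigma>) u))"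
      unfolding H_eq_ladder[of u \<sigma>] F_add by simp
    also have "F n t (ladder \<sigma> u) = \<kappa> * F n t (e l)"
      unfolding u_def ladder_ladder_e[OF l \<sigma>] F_scale \<kappa>_def ..
    also have "\<kappa> * F n t (e l) - F n t (ladder (- \<sigma>) u) = F n t (ladder \<sigma> u) - F n t (ladder (- \<sigma>) u)"
      unfolding u_def ladder_ladder_e[OF l \<sigma>] F_scale \<kappa>_def ..
    also have "\<dots> = of_real (real (m + 1) / (sinh t * cosh t) - (real_of_int (\<sigma> * l) - 2) * tanh t) * F n t u"
      unfolding F_ladder_diff[OF \<sigma> u t] coeff_u[OF t] ..
    finally show "((\<lambda>t. F n t u) has_vector_derivative
        2 * \<kappa> * F n t (e l) - of_real (real (m + 1) / (sinh t * cosh t) - (real_of_int (\<sigma> * l) - 2) * tanh t) * F n t u) (at t)"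
      using F_derivative[of u t] by (simp add: mult.assoc)
  next
    show "isCont (\<lambda>t. F n t u) 0" by (rule has_vector_derivative_continuous[OF F_derivative])
    have c: "coord n ((lie_act M mat_H ^^ k) (e l)) = (if k = m then coord n (tower l \<sigma> m) else 0)" if "k \<le> m" for k
      using coord_H_power[OF \<sigma> e_K_type[OF l] nl that] by (simp add: tower_def)
    have "((\<lambda>t. F n t ((lie_act M mat_H ^^ 0) (e l)) / of_real t ^ m) \<longlongrightarrow> F n 0 ((lie_act M mat_H ^^ m) (e l)) / fact m) (at_right 0)"
    proof (rule taylor_leading_term)
      show "((\<lambda>t. F n t ((lie_act M mat_H ^^ k) (e l))) has_vector_derivative F n t ((lie_act M mat_H ^^ Suc k) (e l))) (at t)" for k t
        using F_derivative[of "(lie_act M mat_H ^^ k) (e l)" t] by simp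
    qed (simp add: F_0 c)
    thus "((\<lambda>t. F n t (e l) / of_real t ^ m) \<longlongrightarrow> B) (at_right 0)"
      by (simp add: F_0 c B_def)
    show "real_of_int (\<sigma> * l) \<le> 2 \<or> \<kappa> = 0"
      using L by (auto simp: \<kappa>_def u_def simp del: of_int_mult)
    show "3 * cmod \<kappa> * (sinh T)\<^sup>2 \<le> real (m + 1)" using T(2) by (simp add: \<kappa>_def u_def norm_power)
  qed (rule T)
  moreover have "cmod B = q (tower l \<sigma> m) / fact m"
    using q_K_type[OF n] tower_K_type[OF l \<sigma>, of m] by (simp add: B_def norm_divide nl)
  ultimately show ?thesis by simp
qed

end

end

section \<open>Dyadic blocks of \<open>K\<close>-types\<close>

text \<open>The sign of \<open>s\<close> decides which endpoint gives the smaller power; the minimum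
  covers both cases.\<close>

lemma powr_between:
  fixes a b x s N :: real
  assumes "0 < a" "0 < N" "a * N \<le> x" "x \<le> b * N"
  shows "min (a powr s) (b powr s) * N powr s \<le> x powr s"
proof -
  have x: "0 < x" using assms by (smt (verit) mult_pos_pos)
  have "0 < b * N" using x assms(4) by linarith
  hence b: "0 < b" using assms(2) by (simp add: zero_less_mult_iff)
  show ?thesis
  proof (cases "s \<ge> 0")
    case True
    have "min (a powr s) (b powr s) * N powr s \<le> a powr s * N powr s"
      by (intro mult_right_mono) auto
    also have "\<dots> = (a * N) powr s" using assms by (simp add: powr_mult)
    also have "\<dots> \<le> x powr s" using True assms by (intro powr_mono2) auto
    finally show ?thesis .
  next
    case False
    have "min (a powr s) (b powr s) * N powr s \<le> b powr s * N powr s"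
      by (intro mult_right_mono) auto
    also have "\<dots> = (b * N) powr s" using assms b by (simp add: powr_mult)
    also have "\<dots> \<le> x powr s" using False assms x by (intro powr_mono2') auto
    finally show ?thesis .
  qed
qed

context unitary_isometric
begin

text \<open>The time \<open>T\<close> with \<open>(sinh T)\<^sup>2 = c\<^sub>0 N\<close> works simultaneously for all \<open>K\<close>-types in a dyadic block.\<close>

lemma F_block_lower_bound:
  assumes \<sigma>: "\<sigma> = 1 \<or> \<sigma> = -1" and l: "l \<in> spec_K M"
    and L: "\<sigma> * l \<le> 2 \<or> ladder (- \<sigma>) (e l) = 0"
  shows "\<exists>C>0. \<exists>c\<^sub>0. \<forall>N m n. 1 \<le> N \<and> N \<le> m + 1 \<and> m + 1 \<le> 2 * N \<and> n = l + 2 * \<sigma> * int m \<and> n \<in> spec_K M \<longrightarrow>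
      C / sqrt (real N) \<le> cmod (F n (arsinh (sqrt (c\<^sub>0 * real N))) (e l))"
proof -
  define k0 where "k0 = (q (ladder (- \<sigma>) (e l)))\<^sup>2"
  define L' where "L' = real_of_int (\<sigma> * l)"
  \<comment> \<open>Gives \<open>3 * k0 * (sinh T)\<^sup>2 \<le> N \<le> m + 1\<close>, as the
    perturbation estimate requires; the summand 1 keeps the quotient meaningful for
    \<open>k0 = 0\<close>.\<close>
  define c\<^sub>0 where "c\<^sub>0 = 1 / (3 * (k0 + 1))"
  have k0: "k0 \<ge> 0" by (simp add: k0_def)
  hence c\<^sub>0: "c\<^sub>0 > 0" by (simp add: c\<^sub>0_def)
  obtain cg where cg: "cg > 0" "\<And>m. (\<forall>k<m. 0 < (real k)\<^sup>2 + (L' - 1 + 2) * real k + (L' + k0)) \<Longrightarrow>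
      cg * real (m + 1) powr (L' - 1) \<le> (\<Prod>k<m. (real k)\<^sup>2 + (L' - 1 + 2) * real k + (L' + k0)) / (fact m)\<^sup>2"
    using quadratic_product_growth[of "L' - 1" "L' + k0"] by blast
  define d1 where "d1 = min (1 powr (L' - 1)) (2 powr (L' - 1))"
  define d2 where "d2 = min (c\<^sub>0 powr (- L')) ((1 + c\<^sub>0) powr (- L'))"
  \<comment> \<open>Lower bound for the square of the product in \<open>F_lower_bound\<close>: the
    factors stand for the tower norm with its factor 1/2, the power of \<open>tanh\<close> and the
    power of \<open>cosh\<close>.\<close>
  define C2 where "C2 = cg * d1 / 4 * exp (- 2 / c\<^sub>0) * d2"
  have d: "d1 > 0" "d2 > 0" using c\<^sub>0 by (auto simp: d1_def d2_def)
  have C2: "C2 > 0" using d cg(1) by (simp add: C2_def)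
  show ?thesis
  proof (rule exI[of _ "sqrt C2"], intro exI[of _ c\<^sub>0] conjI allI impI; (elim conjE)?)
    show "sqrt C2 > 0" using C2 by simp
    fix N m :: nat and n :: int
    assume N: "1 \<le> N" "N \<le> m + 1" "m + 1 \<le> 2 * N" and nl: "n = l + 2 * \<sigma> * int m" and n: "n \<in> spec_K M"
    define T where "T = arsinh (sqrt (c\<^sub>0 * real N))"
    have cN: "c\<^sub>0 * real N > 0" using c\<^sub>0 N by simp
    have T: "T > 0" using cN by (simp add: T_def)
    have sT: "(sinh T)\<^sup>2 = c\<^sub>0 * real N" using cN by (simp add: T_def)
    have cT: "(cosh T)\<^sup>2 = 1 + c\<^sub>0 * real N" by (simp add: cosh_square_eq sT)
    \<comment> \<open>The tower supplied by \<open>spec_tower\<close> must be the given one; for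
      \<open>m = 0\<close> the type does not determine the direction, but the member is
      \<open>e l\<close>.\<close>
    have nz: "tower l \<sigma> m \<noteq> 0"
    proof (cases "m = 0")
      case True thus ?thesis using e_nonzero[OF l] by simp
    next
      case False
      obtain \<sigma>' m' where *: "\<sigma>' = 1 \<or> \<sigma>' = -1" "n = l + 2 * \<sigma>' * int m'" "tower l \<sigma>' m' \<noteq> 0"
        by (rule spec_tower[OF l n])
      have "\<sigma>' * int m' = \<sigma> * int m" using *(2) nl by simp
      hence "\<sigma>' = \<sigma> \<and> m' = m" using *(1) \<sigma> False by auto
      thus ?thesis using *(3) by simp
    qed
    have "3 * k0 * c\<^sub>0 \<le> 1" using k0 by (simp add: c\<^sub>0_def field_simps)
    hence "3 * k0 * c\<^sub>0 * real N \<le> 1 * real N" by (intro mult_right_mono) auto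
    hence "3 * k0 * (sinh T)\<^sup>2 \<le> real (m + 1)" using N(2) by (simp add: sT mult.assoc)
    hence lb: "q (tower l \<sigma> m) / fact m / 2 * tanh T ^ m * cosh T powr (- L') \<le> cmod (F n T (e l))"
      unfolding L'_def by (intro F_lower_bound[OF n \<sigma> l nl L T]) (simp add: k0_def)
    have LL: "L' - 1 + 2 = L' + 1" by simp
    have A: "cg * d1 * real N powr (L' - 1) \<le> (q (tower l \<sigma> m) / fact m)\<^sup>2"
    proof -
      have "\<forall>k<m. 0 < (real k)\<^sup>2 + (L' - 1 + 2) * real k + (L' + k0)"
        unfolding LL using tower_factor_pos[OF l \<sigma> nz] unfolding tower_factor_def L'_def[symmetric] k0_def[symmetric] by blast
      from cg(2)[OF this, unfolded LL] have "cg * real (m + 1) powr (L' - 1) \<le> (q (tower l \<sigma> m) / fact m)\<^sup>2"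
        unfolding power_divide q_tower_prod[OF l \<sigma>] tower_factor_def L'_def[symmetric] k0_def[symmetric] .
      moreover have "d1 * real N powr (L' - 1) \<le> real (m + 1) powr (L' - 1)"
        unfolding d1_def by (rule powr_between) (use N in auto)
      hence "cg * (d1 * real N powr (L' - 1)) \<le> cg * real (m + 1) powr (L' - 1)"
        using cg(1) by (intro mult_left_mono) auto
      ultimately show ?thesis by simp
    qed
    \<comment> \<open>With \<open>x = 1 / (c\<^sub>0 * N)\<close>,
      \<open>(tanh T)\<^sup>2 = 1 / (1 + x)\<close> is at least \<open>exp (- x)\<close>, and at
      most \<open>2 * N\<close> such factors occur.\<close>
    have Bd: "exp (- 2 / c\<^sub>0) \<le> (tanh T ^ m)\<^sup>2"
    proof -
      have th: "(tanh T)\<^sup>2 = c\<^sub>0 * real N / (1 + c\<^sub>0 * real N)"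
        by (simp add: tanh_def power_divide sT cT)
      have "1 + 1 / (c\<^sub>0 * real N) \<le> exp (1 / (c\<^sub>0 * real N))" by (rule exp_ge_add_one_self)
      hence "inverse (exp (1 / (c\<^sub>0 * real N))) \<le> inverse (1 + 1 / (c\<^sub>0 * real N))"
        using cN by (intro le_imp_inverse_le) (auto simp: add_pos_pos)
      also have "inverse (1 + 1 / (c\<^sub>0 * real N)) = (tanh T)\<^sup>2"
      proof -
        have "1 + 1 / (c\<^sub>0 * real N) = (1 + c\<^sub>0 * real N) / (c\<^sub>0 * real N)"
          using c\<^sub>0 N by (simp add: add_divide_distrib)
        thus ?thesis unfolding th by simp
      qed
      finally have e1: "exp (- (1 / (c\<^sub>0 * real N))) \<le> (tanh T)\<^sup>2" by (simp add: exp_minus)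
      have "exp (- 2 / c\<^sub>0) = exp (real (2 * N) * - (1 / (c\<^sub>0 * real N)))"
        using N c\<^sub>0 by (simp add: field_simps)
      also have "\<dots> = exp (- (1 / (c\<^sub>0 * real N))) ^ (2 * N)"
        by (rule exp_of_nat_mult)
      also have "\<dots> \<le> ((tanh T)\<^sup>2) ^ (2 * N)"
        using e1 by (intro power_mono) auto
      also have "\<dots> \<le> ((tanh T)\<^sup>2) ^ m"
      proof (rule power_decreasing)
        show "(tanh T)\<^sup>2 \<le> 1" unfolding th using cN by simp
      qed (use N in auto)
      also have "\<dots> = (tanh T ^ m)\<^sup>2" by (simp add: mult.commute flip: power_mult)
      finally show ?thesis .
    qed
    have Cd: "d2 * real N powr (- L') \<le> (cosh T powr (- L'))\<^sup>2"
    proof -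
      have "d2 * real N powr (- L') \<le> (1 + c\<^sub>0 * real N) powr (- L')"
        unfolding d2_def by (rule powr_between) (use N c\<^sub>0 in \<open>auto simp: algebra_simps\<close>)
      also have "\<dots> = (cosh T powr (- L'))\<^sup>2"
        unfolding cT[symmetric] power2_eq_square by (rule powr_mult)
      finally show ?thesis .
    qed
    \<comment> \<open>Whatever \<open>l\<close> is, the exponents \<open>L' - 1\<close> of the tower
      norms and \<open>- L'\<close> of \<open>cosh\<close> add up to -1. This is the origin of the
      power 1/2 in the final bounds.\<close>
    have "C2 / real N = (cg * d1 * real N powr (L' - 1)) / 4 * exp (- 2 / c\<^sub>0) * (d2 * real N powr (- L'))"
    proof -
      have "real N powr (L' - 1) * real N powr (- L') = real N powr (-1)"
        by (subst powr_add[symmetric]) simp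
      also have "\<dots> = 1 / real N" using N by (simp add: powr_minus_divide)
      finally have "C2 / real N = C2 * (real N powr (L' - 1) * real N powr (- L'))" by simp
      thus ?thesis by (simp add: C2_def mult_ac)
    qed
    also have "\<dots> \<le> (q (tower l \<sigma> m) / fact m)\<^sup>2 / 4 * (tanh T ^ m)\<^sup>2 * (cosh T powr (- L'))\<^sup>2"
      using A Bd Cd d cg(1) by (intro mult_mono divide_right_mono) auto
    also have "\<dots> = (q (tower l \<sigma> m) / fact m / 2 * tanh T ^ m * cosh T powr (- L'))\<^sup>2"
      by (simp add: power_mult_distrib power_divide)
    also have "\<dots> \<le> (cmod (F n T (e l)))\<^sup>2"
      using T by (intro power_mono lb) auto
    finally have "sqrt (C2 / real N) \<le> cmod (F n T (e l))"
      by (rule real_le_lsqrt[OF norm_ge_zero])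
    thus "sqrt C2 / sqrt (real N) \<le> cmod (F n (arsinh (sqrt (c\<^sub>0 * real N))) (e l))"
      by (simp add: real_sqrt_divide T_def)
  qed
qed

text \<open>Apply the multiplier bound to approximations \<open>w\<close> of the image of \<open>e l\<close> under \<open>mat_A T\<close>, with
  multipliers \<open>c n / F n T (e l)\<close>.\<close>

lemma F_multiplier_bound:
  assumes S: "finite S" "S \<subseteq> spec_K M" and nz: "\<And>n. n \<in> S \<Longrightarrow> \<delta> \<le> cmod (F n T v)" and \<delta>: "\<delta> > 0"
  shows "p (\<Sum>n\<in>S. cscale M (c n) (e n)) \<le> sqrt (\<Sum>n\<in>S. (cmod (c n))\<^sup>2) / \<delta> * p v"
proof (rule matrix_coeff_approx[OF mat_A_in_SL2, of v T])
  fix w assume w: "(\<lambda>i. p (w i)) \<longlonglongrightarrow> p v"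
    "\<And>\<phi> C. (\<And>u u'. cmod (\<phi> u - \<phi> u') \<le> C * p (u - u')) \<Longrightarrow> (\<lambda>i. \<phi> (w i)) \<longlonglongrightarrow> matrix_coeff \<phi> (mat_A T) v"
  define d where "d n = c n / F n T v" for n
  define x where "x i = (\<Sum>n\<in>S. cscale M (d n * coord n (w i)) (e n))" for i
  define y where "y = (\<Sum>n\<in>S. cscale M (c n) (e n))"
  have Fnz: "F n T v \<noteq> 0" if "n \<in> S" for n using nz[OF that] \<delta> by auto
  have cw: "(\<lambda>i. coord n (w i)) \<longlonglongrightarrow> F n T v" if "n \<in> S" for n
    unfolding F_def using that S(2) by (intro w(2)[OF coord_lipschitz]) auto
  \<comment> \<open>As \<open>S\<close> is finite, convergence of the coordinates gives convergence
    of \<open>x i\<close> to \<open>y\<close> in the norm \<open>p\<close>.\<close>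
  have "(\<lambda>i. \<Sum>n\<in>S. cmod (d n * coord n (w i) - c n) * p (e n)) \<longlonglongrightarrow> (\<Sum>n\<in>S. cmod (d n * F n T v - c n) * p (e n))"
    by (rule tendsto_sum)
       (rule tendsto_mult_right[OF tendsto_norm[OF tendsto_diff[OF tendsto_mult_left[OF cw] tendsto_const]]])
  moreover have "(\<Sum>n\<in>S. cmod (d n * F n T v - c n) * p (e n)) = 0"
    using Fnz by (intro sum.neutral) (simp add: d_def)
  ultimately have null: "(\<lambda>i. \<Sum>n\<in>S. cmod (d n * coord n (w i) - c n) * p (e n)) \<longlonglongrightarrow> 0" by simp
  have diff: "norm (p (x i) - p y) \<le> (\<Sum>n\<in>S. cmod (d n * coord n (w i) - c n) * p (e n))" for i
  proof -
    have "norm (p (x i) - p y) \<le> p (x i - y)" using p_diff_bound by simp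
    also have "x i - y = (\<Sum>n\<in>S. cscale M (d n * coord n (w i) - c n) (e n))"
      by (simp add: x_def y_def sum_subtractf V.scale_left_diff_distrib)
    also have "p \<dots> \<le> (\<Sum>n\<in>S. p (cscale M (d n * coord n (w i) - c n) (e n)))" by (rule p_sum)
    finally show ?thesis by (simp add: p_scale)
  qed
  have "(\<lambda>i. p (x i) - p y) \<longlonglongrightarrow> 0"
    by (rule Lim_null_comparison[OF _ null]) (simp only: diff eventually_True)
  hence 1: "(\<lambda>i. p (x i)) \<longlonglongrightarrow> p y" by (simp add: LIM_zero_iff)
  have 2: "(\<lambda>i. sqrt (\<Sum>n\<in>S. (cmod (d n))\<^sup>2) * p (w i)) \<longlonglongrightarrow> sqrt (\<Sum>n\<in>S. (cmod (d n))\<^sup>2) * p v"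
    by (rule tendsto_mult_left[OF w(1)])
  have "p (x i) \<le> sqrt (\<Sum>n\<in>S. (cmod (d n))\<^sup>2) * p (w i)" for i
    unfolding x_def by (rule coord_multiplier_bound[OF is_norm p_K_act S])
  hence "p y \<le> sqrt (\<Sum>n\<in>S. (cmod (d n))\<^sup>2) * p v"
    by (intro LIMSEQ_le[OF 1 2] exI[of _ 0] allI impI)
  also have "(\<Sum>n\<in>S. (cmod (d n))\<^sup>2) \<le> (\<Sum>n\<in>S. (cmod (c n))\<^sup>2 / \<delta>\<^sup>2)"
  proof (intro sum_mono)
    fix n assume "n \<in> S"
    hence "\<delta>\<^sup>2 \<le> (cmod (F n T v))\<^sup>2" "F n T v \<noteq> 0" using nz Fnz \<delta> by (auto intro: power_mono)
    thus "(cmod (d n))\<^sup>2 \<le> (cmod (c n))\<^sup>2 / \<delta>\<^sup>2"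
      unfolding d_def norm_divide power_divide using \<delta> by (intro divide_left_mono) auto
  qed
  also have "\<dots> = (\<Sum>n\<in>S. (cmod (c n))\<^sup>2) / \<delta>\<^sup>2" by (simp add: sum_divide_distrib)
  also have "sqrt ((\<Sum>n\<in>S. (cmod (c n))\<^sup>2) / \<delta>\<^sup>2) = sqrt (\<Sum>n\<in>S. (cmod (c n))\<^sup>2) / \<delta>"
    using \<delta> by (simp add: real_sqrt_divide)
  finally show ?thesis by (simp add: y_def mult_right_mono)
qed

definition block_constant :: "int \<Rightarrow> int \<Rightarrow> real \<Rightarrow> bool" where
  "block_constant l \<sigma> C \<longleftrightarrow> (\<forall>N S c. 1 \<le> N \<and> finite S \<and> S \<subseteq> spec_K M \<and>
      (\<forall>n\<in>S. \<exists>m. n = l + 2 * \<sigma> * int m \<and> N \<le> m + 1 \<and> m + 1 \<le> 2 * N) \<longrightarrow>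
      p (\<Sum>n\<in>S. cscale M (c n) (e n)) \<le> C * sqrt (real N) * sqrt (\<Sum>n\<in>S. (cmod (c n))\<^sup>2))"

lemma block_bound:
  assumes \<sigma>: "\<sigma> = 1 \<or> \<sigma> = -1" and l: "l \<in> spec_K M"
    and L: "\<sigma> * l \<le> 2 \<or> ladder (- \<sigma>) (e l) = 0"
  shows "\<exists>C>0. block_constant l \<sigma> C"
proof -
  obtain C c\<^sub>0 where C: "C > 0"
    "\<forall>N m n. 1 \<le> N \<and> N \<le> m + 1 \<and> m + 1 \<le> 2 * N \<and> n = l + 2 * \<sigma> * int m \<and> n \<in> spec_K M \<longrightarrow>
      C / sqrt (real N) \<le> cmod (F n (arsinh (sqrt (c\<^sub>0 * real N))) (e l))"
    using F_block_lower_bound[OF \<sigma> l L] by (elim exE conjE)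
  have pe: "p (e l) > 0" using e_nonzero[OF l] p_ge_0[of "e l"] p_eq_0_iff[of "e l"] by linarith
  show ?thesis unfolding block_constant_def
  proof (intro exI[of _ "p (e l) / C"] conjI allI impI; (elim conjE)?)
    show "p (e l) / C > 0" using pe C(1) by simp
    fix N :: nat and S :: "int set" and c :: "int \<Rightarrow> complex"
    assume N: "1 \<le> N" and S: "finite S" "S \<subseteq> spec_K M"
      "\<forall>n\<in>S. \<exists>m. n = l + 2 * \<sigma> * int m \<and> N \<le> m + 1 \<and> m + 1 \<le> 2 * N"
    have "p (\<Sum>n\<in>S. cscale M (c n) (e n)) \<le> sqrt (\<Sum>n\<in>S. (cmod (c n))\<^sup>2) / (C / sqrt (real N)) * p (e l)"
    proof (rule F_multiplier_bound[OF S(1,2)])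
      fix n assume n: "n \<in> S"
      with S(3) obtain m where "n = l + 2 * \<sigma> * int m" "N \<le> m + 1" "m + 1 \<le> 2 * N" by blast
      thus "C / sqrt (real N) \<le> cmod (F n (arsinh (sqrt (c\<^sub>0 * real N))) (e l))"
        using C(2) N n S(2) by blast
    qed (use C(1) N in auto)
    thus "p (\<Sum>n\<in>S. cscale M (c n) (e n)) \<le> p (e l) / C * sqrt (real N) * sqrt (\<Sum>n\<in>S. (cmod (c n))\<^sup>2)"
      by (simp add: mult_ac)
  qed
qed

end

section \<open>Sobolev norms and the main estimate\<close>

lemma (in normed_module) compl_norm_nonneg:
  assumes "x \<in> banach_completion p"
  shows "0 \<le> compl_norm p x"
proof -
  obtain f where f: "f \<in> p_Cauchy p" "x = cls f" using assms by (rule completionE)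
  show ?thesis unfolding f(2)
    by (rule tendsto_lowerbound[OF tendsto_compl_norm[OF f(1)]]) simp_all
qed

text \<open>By \<open>p_first_order\<close> the norm of \<open>v + t X v\<close> has derivative 0 at
  \<open>t = 0\<close>, whereas its square has derivative \<open>2 * Re (b v (X v))\<close>. So this
  real part vanishes, and polarization gives skewness.\<close>

lemma (in isometric_globalization) isometric_imp_skew:
  fixes b :: "'v \<Rightarrow> 'v \<Rightarrow> complex"
  assumes b_add: "\<And>u v w. b (u + v) w = b u w + b v w"
    and b_scale: "\<And>c v w. b (cscale M c v) w = c * b v w"
    and b_cnj: "\<And>v w. b w v = cnj (b v w)"
    and b_norm: "\<And>v. b v v = complex_of_real ((p v)\<^sup>2)"
    and X: "X \<in> sl2" "\<And>t. mexp (t *\<^sub>R X) \<in> SL2"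
    and lie: "\<And>v w. lie_act M X (v + w) = lie_act M X v + lie_act M X w"
      "\<And>c v. lie_act M X (cscale M c v) = cscale M c (lie_act M X v)"
  shows "b (lie_act M X v) w = - b v (lie_act M X w)"
proof -
  have b_add_right: "b w (u + v) = b w u + b w v" for u v w
    by (subst (1 2 3) b_cnj) (simp add: b_add)
  have b_scale_right: "b w (cscale M c v) = cnj c * b w v" for c v w
    by (subst (1 2) b_cnj) (simp add: b_scale)
  have Re0: "Re (b v (lie_act M X v)) = 0" for v
  proof -
    define u where "u = lie_act M X v"
    define r where "r t = p (v + cscale M (of_real t) u)" for t :: real
    have sq: "(r t)\<^sup>2 = (p v)\<^sup>2 + 2 * t * Re (b v u) + t\<^sup>2 * (p u)\<^sup>2" for t
    proof -
      have "b (v + cscale M (of_real t) u) (v + cscale M (of_real t) u) = b v v + of_real t * (b v u + b u v) + of_real (t\<^sup>2) * b u u"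
        by (simp add: b_add b_add_right b_scale b_scale_right power2_eq_square algebra_simps)
      hence "complex_of_real ((r t)\<^sup>2) = of_real ((p v)\<^sup>2) + of_real t * (b v u + b u v) + of_real (t\<^sup>2) * of_real ((p u)\<^sup>2)"
        by (simp only: b_norm r_def)
      also have "b v u + b u v = of_real (2 * Re (b v u))"
        by (subst (2) b_cnj) (simp add: complex_eq_iff)
      also have "of_real ((p v)\<^sup>2) + of_real t * of_real (2 * Re (b v u)) + of_real (t\<^sup>2) * of_real ((p u)\<^sup>2)
          = complex_of_real ((p v)\<^sup>2 + 2 * t * Re (b v u) + t\<^sup>2 * (p u)\<^sup>2)"
        by simp
      finally show ?thesis unfolding of_real_eq_iff .
    qed
    have "((\<lambda>t. \<bar>t\<bar> * p u) \<longlongrightarrow> \<bar>0\<bar> * p u) (at 0)" by (intro tendsto_intros)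
    hence null: "((\<lambda>t. \<bar>t\<bar> * p u) \<longlongrightarrow> 0) (at 0)" by simp
    have "((\<lambda>t. r t - p v) \<longlongrightarrow> 0) (at 0)"
    proof (rule Lim_null_comparison[OF _ null])
      have "norm (r t - p v) \<le> \<bar>t\<bar> * p u" for t
        using p_diff_bound[of "v + cscale M (of_real t) u" v] by (simp add: r_def p_scale)
      thus "\<forall>\<^sub>F t in at 0. norm (r t - p v) \<le> \<bar>t\<bar> * p u" by simp
    qed
    hence "((\<lambda>t. r t) \<longlongrightarrow> p v) (at 0)" by (simp add: LIM_zero_iff)
    hence "((\<lambda>t. r t + p v) \<longlongrightarrow> p v + p v) (at 0)"
      by (rule tendsto_add[OF _ tendsto_const])
    \<comment> \<open>The product of difference and sum is the difference of squares, for which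
      \<open>sq\<close> is an exact formula.\<close>
    from tendsto_mult[OF p_first_order[OF X, of v] this]
    have 1: "((\<lambda>t. (r t - p v) / t * (r t + p v)) \<longlongrightarrow> 0) (at 0)"
      by (simp add: r_def u_def)
    have 2: "((\<lambda>t. 2 * Re (b v u) + t * (p u)\<^sup>2) \<longlongrightarrow> 2 * Re (b v u) + 0 * (p u)\<^sup>2) (at 0)"
      by (intro tendsto_intros)
    have "((\<lambda>t. 2 * Re (b v u) + t * (p u)\<^sup>2) \<longlongrightarrow> 0) (at 0)"
    proof (rule Lim_transform_eventually[OF 1])
      have "(r t - p v) / t * (r t + p v) = 2 * Re (b v u) + t * (p u)\<^sup>2"
        if "t \<noteq> 0" for t :: real
      proof -
        have "(r t - p v) / t * (r t + p v) =
            ((r t)\<^sup>2 - (p v)\<^sup>2) / t"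
          by (simp add: power2_eq_square algebra_simps diff_divide_distrib)
        also have "\<dots> = 2 * Re (b v u) + t * (p u)\<^sup>2"
          unfolding sq using that by (simp add: add_divide_distrib power2_eq_square)
        finally show ?thesis .
      qed
      thus "\<forall>\<^sub>F t in at 0. (r t - p v) / t * (r t + p v) = 2 * Re (b v u) + t * (p u)\<^sup>2"
        by (intro eventually_mono[OF eventually_neq_at_within])
    qed
    from tendsto_unique[OF _ this 2] show ?thesis by (simp add: u_def)
  qed
  have pol: "Re (b v (lie_act M X w) + b (lie_act M X v) w) = 0" for v w
  proof -
    have "Re (b w (lie_act M X v)) = Re (b (lie_act M X v) w)" by (subst b_cnj) simp
    thus ?thesis using Re0[of "v + w"] Re0[of v] Re0[of w] by (simp add: lie b_add b_add_right)
  qed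
  \<comment> \<open>Replacing \<open>v\<close> by \<open>\<i>\<close> times \<open>v\<close> turns
    the imaginary part into a real part.\<close>
  have "Im (b v (lie_act M X w) + b (lie_act M X v) w) = 0"
    using pol[of "cscale M \<i> v" w] by (simp add: lie b_scale)
  with pol[of v w] have "b v (lie_act M X w) + b (lie_act M X v) w = 0"
    by (simp add: complex_eq_iff)
  thus ?thesis by (simp add: add_eq_0_iff2)
qed

section \<open>Sobolev norms as weighted sums over K-types\<close>

context unitary_gK_module
begin

text \<open>The explicit candidate for the operator that \<open>sobolev_op\<close> singles out by a
  description. The sum runs over the support of \<open>v\<close>, which is finite.\<close>

definition diagonal_op :: "(int \<Rightarrow> real) \<Rightarrow> 'v \<Rightarrow> 'v" where
  "diagonal_op W v = (\<Sum>n | n \<in> spec_K M \<and> coord n v \<noteq> 0. cscale M (of_real (W n) * coord n v) (e n))"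

lemma diagonal_op_eq:
  assumes S: "finite S" "S \<subseteq> spec_K M" "\<forall>n\<in>spec_K M - S. coord n v = 0"
  shows "diagonal_op W v = (\<Sum>n\<in>S. cscale M (of_real (W n) * coord n v) (e n))"
  unfolding diagonal_op_def using S by (intro sum.mono_neutral_left) auto

lemma diagonal_op_linear: "Vector_Spaces.linear (cscale M) (cscale M) (diagonal_op W)"
  unfolding Vector_Spaces.linear_iff
proof (intro conjI allI vector_space)
  fix v w
  obtain S where S: "finite S" "S \<subseteq> spec_K M" "\<forall>n\<in>spec_K M - S. coord n v = 0"
    "v = (\<Sum>n\<in>S. cscale M (coord n v) (e n))"
    by (rule coord_expansion)
  obtain R where R: "finite R" "R \<subseteq> spec_K M" "\<forall>n\<in>spec_K M - R. coord n w = 0"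
    "w = (\<Sum>n\<in>R. cscale M (coord n w) (e n))"
    by (rule coord_expansion)
  have "diagonal_op W u = (\<Sum>n\<in>S \<union> R. cscale M (of_real (W n) * coord n u) (e n))" if "u \<in> {v, w, v + w}" for u
    using that S R by (intro diagonal_op_eq) (auto simp: coord_add)
  thus "diagonal_op W (v + w) = diagonal_op W v + diagonal_op W w"
    by (simp add: coord_add distrib_left V.scale_left_distrib sum.distrib)
next
  fix c v
  obtain S where S: "finite S" "S \<subseteq> spec_K M" "\<forall>n\<in>spec_K M - S. coord n v = 0"
    "v = (\<Sum>n\<in>S. cscale M (coord n v) (e n))"
    by (rule coord_expansion)
  have "diagonal_op W (cscale M c v) = (\<Sum>n\<in>S. cscale M (of_real (W n) * coord n (cscale M c v)) (e n))"
    by (rule diagonal_op_eq) (use S in \<open>auto simp: coord_scale\<close>)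
  also have "\<dots> = cscale M c (diagonal_op W v)"
    unfolding diagonal_op_eq[OF S(1-3)] by (simp add: coord_scale V.scale_sum_right mult_ac)
  finally show "diagonal_op W (cscale M c v) = cscale M c (diagonal_op W v)" .
qed

text \<open>On the type \<open>n\<close> the square of the generator acts by
  \<open>- (n * y)\<^sup>2\<close>. Thus \<open>diagonal_op\<close> satisfies the description, and
  it is the only such operator because the \<open>e n\<close> span \<open>V\<close>.\<close>

lemma sobolev_op_eq:
  "sobolev_op M (y *\<^sub>R mat_J) s = diagonal_op (\<lambda>n. (1 + (of_int n * y)\<^sup>2) powr (s / 2))"
proof -
  define W where "W = (\<lambda>n. (1 + (real_of_int n * y)\<^sup>2) powr (s / 2))"
  have Y2: "- lie_act M (y *\<^sub>R mat_J) (lie_act M (y *\<^sub>R mat_J) v) = cscale M (of_real ((of_int n * y)\<^sup>2)) v"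
    if "v \<in> K_type M n" for n v
  proof -
    have "lie_act M (y *\<^sub>R mat_J) v = cscale M (of_real y * (\<i> * of_int n)) v"
      by (simp add: lie_scaleR[OF J_H_S_in_sl2(1)] J_K_type[OF that])
    moreover have "y *\<^sub>R mat_J \<in> sl2" by (simp add: mat2_scaleR mat2_in_sl2)
    ultimately have "lie_act M (y *\<^sub>R mat_J) (lie_act M (y *\<^sub>R mat_J) v) = cscale M ((of_real y * (\<i> * of_int n)) * (of_real y * (\<i> * of_int n))) v"
      by (simp add: lie_scale)
    also have "(of_real y * (\<i> * of_int n)) * (of_real y * (\<i> * of_int n)) = - complex_of_real ((of_int n * y)\<^sup>2)"
      by (simp add: power2_eq_square algebra_simps)
    finally show ?thesis by simp
  qed
  have "sobolev_op M (y *\<^sub>R mat_J) s = diagonal_op W"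
    unfolding sobolev_op_def
  proof (rule the_equality)
    show "Vector_Spaces.linear (cscale M) (cscale M) (diagonal_op W) \<and>
     (\<forall>n. \<forall>v\<in>K_type M n. \<forall>r::real.
        - lie_act M (y *\<^sub>R mat_J) (lie_act M (y *\<^sub>R mat_J) v) = cscale M (complex_of_real r) v \<longrightarrow>
        diagonal_op W v = cscale M (complex_of_real ((1 + r) powr (s / 2))) v)"
    proof (intro conjI allI ballI impI diagonal_op_linear)
      fix n v and r :: real
      assume v: "v \<in> K_type M n"
        and r: "- lie_act M (y *\<^sub>R mat_J) (lie_act M (y *\<^sub>R mat_J) v) = cscale M (complex_of_real r) v"
      show "diagonal_op W v = cscale M (complex_of_real ((1 + r) powr (s / 2))) v"
      \<comment> \<open>For \<open>v = 0\<close> every \<open>r\<close> satisfies the premise; for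
        any other \<open>v\<close> the premise determines \<open>r\<close>.\<close>
      proof (cases "v = 0")
        case True
        thus ?thesis by (simp add: diagonal_op_def)
      next
        case False
        hence n: "n \<in> spec_K M" using v by (intro in_spec)
        have "cscale M (complex_of_real r) v = cscale M (of_real ((of_int n * y)\<^sup>2)) v"
          by (rule trans[OF r[symmetric] Y2[OF v]])
        hence "complex_of_real r = of_real ((of_int n * y)\<^sup>2)"
          using False V.scale_cancel_right by blast
        hence r: "r = (of_int n * y)\<^sup>2" unfolding of_real_eq_iff .
        have "diagonal_op W v = (\<Sum>j\<in>{n}. cscale M (of_real (W j) * coord j v) (e j))"
          by (rule diagonal_op_eq) (use n coord_K_type[OF v] in auto)
        also have "\<dots> = cscale M (of_real (W n)) (cscale M (coord n v) (e n))" by simp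
        also have "\<dots> = cscale M (of_real (W n)) v"
          using K_type_eq_coord[OF n v] by simp
        finally show ?thesis by (simp add: W_def r)
      qed
    qed
  next
    fix D assume D: "Vector_Spaces.linear (cscale M) (cscale M) D \<and>
     (\<forall>n. \<forall>v\<in>K_type M n. \<forall>r::real.
        - lie_act M (y *\<^sub>R mat_J) (lie_act M (y *\<^sub>R mat_J) v) = cscale M (complex_of_real r) v \<longrightarrow>
        D v = cscale M (complex_of_real ((1 + r) powr (s / 2))) v)"
    interpret D: Vector_Spaces.linear "cscale M" "cscale M" D using D by blast
    have De: "D (e n) = cscale M (of_real (W n)) (e n)" if "n \<in> spec_K M" for n
      using D e_K_type[OF that] Y2[OF e_K_type[OF that]] by (simp add: W_def del: of_real_power)
    show "D = diagonal_op W"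
    proof
      fix v
      obtain S where S: "finite S" "S \<subseteq> spec_K M" "\<forall>n\<in>spec_K M - S. coord n v = 0"
        "v = (\<Sum>n\<in>S. cscale M (coord n v) (e n))"
        by (rule coord_expansion)
      have "D v = (\<Sum>n\<in>S. cscale M (coord n v) (D (e n)))"
        by (subst S(4)) (simp add: D.sum D.scale)
      also have "\<dots> = diagonal_op W v"
        unfolding diagonal_op_eq[OF S(1-3)] using S(2) De
        by (intro sum.cong refl) (auto simp: mult_ac)
      finally show "D v = diagonal_op W v" .
    qed
  qed
  thus ?thesis by (simp add: W_def)
qed

lemma sobolev_norm_eq:
  assumes S: "finite S" "S \<subseteq> spec_K M" "\<forall>n\<in>spec_K M - S. coord n v = 0"
  shows "sobolev_norm M (y *\<^sub>R mat_J) q s v = sqrt (\<Sum>n\<in>S. (1 + (of_int n * y)\<^sup>2) powr s * (cmod (coord n v))\<^sup>2)"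
proof -
  have "(sobolev_norm M (y *\<^sub>R mat_J) q s v)\<^sup>2 =
      (\<Sum>n\<in>S. (cmod (of_real ((1 + (of_int n * y)\<^sup>2) powr (s / 2)) * coord n v))\<^sup>2)"
    unfolding sobolev_norm_def sobolev_op_eq diagonal_op_eq[OF S] by (rule q_sum[OF S(1,2)])
  also have "\<dots> = (\<Sum>n\<in>S. (1 + (of_int n * y)\<^sup>2) powr s * (cmod (coord n v))\<^sup>2)"
  proof (intro sum.cong refl)
    fix n
    have "((1 + (real_of_int n * y)\<^sup>2) powr (s / 2))\<^sup>2 = (1 + (of_int n * y)\<^sup>2) powr s"
      unfolding power2_eq_square by (subst powr_add[symmetric]) simp
    thus "(cmod (of_real ((1 + (of_int n * y)\<^sup>2) powr (s / 2)) * coord n v))\<^sup>2 = (1 + (of_int n * y)\<^sup>2) powr s * (cmod (coord n v))\<^sup>2"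
      by (simp add: norm_mult power_mult_distrib)
  qed
  finally show ?thesis
    by (intro real_sqrt_unique[symmetric]) (simp_all add: sobolev_norm_def)
qed

end

lemma ladder_index_bound:
  fixes n l \<sigma> :: int
  assumes "\<sigma> = 1 \<or> \<sigma> = -1" "n = l + 2 * \<sigma> * int m"
  shows "real (m + 1) \<le> (1 + real_of_int \<bar>l\<bar>) * (1 + real_of_int \<bar>n\<bar>)"
proof -
  have "2 * int m \<le> \<bar>n\<bar> + \<bar>l\<bar>" using assms by auto
  hence "int (m + 1) \<le> 1 + \<bar>n\<bar> + \<bar>l\<bar>" by linarith
  also have "\<dots> \<le> (1 + \<bar>l\<bar>) * (1 + \<bar>n\<bar>)" by (simp add: algebra_simps)
  finally have "real_of_int (int (m + 1)) \<le> real_of_int ((1 + \<bar>l\<bar>) * (1 + \<bar>n\<bar>))"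
    unfolding of_int_le_iff .
  thus ?thesis by simp
qed

section \<open>Summation over dyadic blocks\<close>

context unitary_isometric
begin

text \<open>On the block with \<open>N = 2 ^ i\<close>, \<open>p\<close> costs the factor
  \<open>2 powr (i / 2)\<close>, while the Sobolev weight gains
  \<open>2 powr ((1 / 2 + \<epsilon>) * i)\<close>. What remains is \<open>r ^ i\<close> with
  \<open>r = 2 powr (- \<epsilon>)\<close>.\<close>

lemma one_sided_bound:
  assumes \<sigma>: "\<sigma> = 1 \<or> \<sigma> = -1" and l: "l \<in> spec_K M"
    and L: "\<sigma> * l \<le> 2 \<or> ladder (- \<sigma>) (e l) = 0"
    and \<epsilon>: "\<epsilon> > 0" and y: "y \<noteq> 0"
  shows "\<exists>C>0. \<forall>S c. finite S \<and> S \<subseteq> spec_K M \<and> (\<forall>n\<in>S. \<exists>m. n = l + 2 * \<sigma> * int m) \<longrightarrow>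
      p (\<Sum>n\<in>S. cscale M (c n) (e n)) \<le> C * sqrt (\<Sum>n\<in>S. (1 + (of_int n * y)\<^sup>2) powr (1 / 2 + \<epsilon>) * (cmod (c n))\<^sup>2)"
proof -
  obtain C where C: "C > 0" "block_constant l \<sigma> C"
    using block_bound[OF \<sigma> l L] by (elim exE conjE)
  define s where "s = 1 / 2 + \<epsilon>"
  \<comment> \<open>Collects three comparisons: \<open>N\<close> with
    \<open>(1 + \<bar>l\<bar>) * (1 + \<bar>n\<bar>)\<close>, then
    \<open>(1 + \<bar>n\<bar>)\<^sup>2\<close> with \<open>2 * (1 + n\<^sup>2)\<close>, and finally
    \<open>1 + n\<^sup>2\<close> with
    \<open>(1 + 1 / y\<^sup>2) * (1 + (n * y)\<^sup>2)\<close>.\<close>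
  define a where "a = 1 / (2 * (1 + real_of_int \<bar>l\<bar>)\<^sup>2 * (1 + 1 / y\<^sup>2))"
  define W where "W n = (1 + (real_of_int n * y)\<^sup>2) powr s" for n
  define r where "r = 2 powr (- \<epsilon>)"
  have s: "s > 0" using \<epsilon> by (simp add: s_def)
  have r: "0 < r" "r < 1" using \<epsilon> by (simp_all add: r_def powr_less_one)
  have l1: "(1 + real_of_int \<bar>l\<bar>)\<^sup>2 > 0" by (intro zero_less_power add_pos_nonneg) auto
  have y1: "1 + 1 / y\<^sup>2 > 0" by (intro add_pos_nonneg) auto
  have a: "a > 0" unfolding a_def using l1 y1 by simp
  have weight: "a * (real N)\<^sup>2 \<le> 1 + (real_of_int n * y)\<^sup>2" if "n = l + 2 * \<sigma> * int m" "N \<le> m + 1" for n m N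
  proof -
    have "real N \<le> (1 + real_of_int \<bar>l\<bar>) * (1 + real_of_int \<bar>n\<bar>)"
      using ladder_index_bound[OF \<sigma> that(1)] that(2) by linarith
    hence "(real N)\<^sup>2 \<le> ((1 + real_of_int \<bar>l\<bar>) * (1 + real_of_int \<bar>n\<bar>))\<^sup>2" by (intro power_mono) auto
    also have "\<dots> = (1 + real_of_int \<bar>l\<bar>)\<^sup>2 * (1 + real_of_int \<bar>n\<bar>)\<^sup>2" by (rule power_mult_distrib)
    also have "(1 + real_of_int \<bar>n\<bar>)\<^sup>2 \<le> 2 * (1 + (real_of_int n)\<^sup>2)"
      using sum_squares_bound[of 1 "real_of_int \<bar>n\<bar>"] by (simp add: power2_eq_square algebra_simps)
    also have "1 + (real_of_int n)\<^sup>2 \<le> (1 + 1 / y\<^sup>2) * (1 + (real_of_int n * y)\<^sup>2)"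
    proof -
      have "(1 + 1 / y\<^sup>2) * (1 + (real_of_int n * y)\<^sup>2) = 1 + (real_of_int n)\<^sup>2 + ((real_of_int n * y)\<^sup>2 + 1 / y\<^sup>2)"
        using y by (simp add: field_simps)
      thus ?thesis by simp
    qed
    finally have "(real N)\<^sup>2 \<le> (1 + real_of_int \<bar>l\<bar>)\<^sup>2 * (2 * ((1 + 1 / y\<^sup>2) * (1 + (real_of_int n * y)\<^sup>2)))"
      by (simp add: mult_left_mono)
    also have "\<dots> = (1 + (real_of_int n * y)\<^sup>2) / a" by (simp add: a_def)
    finally show ?thesis using a by (simp add: field_simps)
  qed
  show ?thesis
  proof (rule exI[of _ "C / sqrt (a powr s) / (1 - r)"], intro conjI allI impI; (elim conjE)?)
    show "C / sqrt (a powr s) / (1 - r) > 0" using C(1) a r by simp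
    fix S :: "int set" and c :: "int \<Rightarrow> complex"
    assume S: "finite S" "S \<subseteq> spec_K M" and nm: "\<forall>n\<in>S. \<exists>m. n = l + 2 * \<sigma> * int m"
    define Q where "Q = (\<Sum>n\<in>S. W n * (cmod (c n))\<^sup>2)"
    \<comment> \<open>The function \<open>j\<close> chosen from this assigns each type its dyadic
      block, so its fibres partition \<open>S\<close>.\<close>
    have "\<exists>j m. n = l + 2 * \<sigma> * int m \<and> 2 ^ j \<le> m + 1 \<and> m + 1 \<le> 2 * 2 ^ j" if n: "n \<in> S" for n
    proof -
      obtain m where m: "n = l + 2 * \<sigma> * int m" using nm n by blast
      obtain j where "2 ^ j \<le> m + 1" "m + 1 < 2 ^ (j + 1)"
        using ex_power_ivl1[of 2 "m + 1"] by auto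
      thus ?thesis using m by (intro exI[of _ j] exI[of _ m]) simp
    qed
    hence "\<forall>n\<in>S. \<exists>j m. n = l + 2 * \<sigma> * int m \<and> 2 ^ j \<le> m + 1 \<and> m + 1 \<le> 2 * 2 ^ j" by blast
    from bchoice[OF this] obtain j where
      j: "\<forall>n\<in>S. \<exists>m. n = l + 2 * \<sigma> * int m \<and> 2 ^ j n \<le> m + 1 \<and> m + 1 \<le> 2 * 2 ^ j n" ..
    have block: "p (\<Sum>n | n \<in> S \<and> j n = i. cscale M (c n) (e n)) \<le> C / sqrt (a powr s) * sqrt Q * r ^ i" for i
    proof -
      define B where "B = {n. n \<in> S \<and> j n = i}"
      have pow2: "(2 :: real) ^ i = 2 powr real i" by (simp add: powr_realpow)
      have B: "finite B" "B \<subseteq> S" using S by (auto simp: B_def)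
      have "1 \<le> (2 ^ i :: nat) \<and> finite B \<and> B \<subseteq> spec_K M \<and> (\<forall>n\<in>B. \<exists>m. n = l + 2 * \<sigma> * int m \<and> 2 ^ i \<le> m + 1 \<and> m + 1 \<le> 2 * 2 ^ i)"
        using B S j by (auto simp: B_def)
      with C(2) [unfolded block_constant_def] have "p (\<Sum>n\<in>B. cscale M (c n) (e n)) \<le> C * sqrt (real (2 ^ i)) * sqrt (\<Sum>n\<in>B. (cmod (c n))\<^sup>2)"
        by blast
      also have "(\<Sum>n\<in>B. (cmod (c n))\<^sup>2) \<le> Q / (a * (2 ^ i)\<^sup>2) powr s"
      proof -
        have "(a * (2 ^ i)\<^sup>2) powr s * (\<Sum>n\<in>B. (cmod (c n))\<^sup>2) \<le> (\<Sum>n\<in>B. W n * (cmod (c n))\<^sup>2)"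
          unfolding sum_distrib_left
        proof (intro sum_mono mult_right_mono)
          fix n assume "n \<in> B"
          hence n: "n \<in> S" "j n = i" by (auto simp: B_def)
          obtain m where m: "n = l + 2 * \<sigma> * int m" "2 ^ j n \<le> m + 1"
            using bspec[OF j n(1)] by (elim exE conjE)
          have "a * (2 ^ i)\<^sup>2 \<le> 1 + (real_of_int n * y)\<^sup>2" using weight[OF m] n(2) by simp
          thus "(a * (2 ^ i)\<^sup>2) powr s \<le> W n"
            unfolding W_def using a s by (intro powr_mono2) auto
        qed auto
        also have "\<dots> \<le> Q" unfolding Q_def using B S by (intro sum_mono2) (auto simp: W_def)
        finally show ?thesis using a by (simp add: pos_le_divide_eq mult.commute)
      qed
      also have "sqrt (Q / (a * (2 ^ i)\<^sup>2) powr s) = sqrt Q / sqrt (a powr s) * 2 powr (- s * i)"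
      proof -
        have "(a * (2 ^ i)\<^sup>2) powr s = a powr s * (2 powr (s * i))\<^sup>2"
        proof -
          have "((2 ^ i)\<^sup>2 :: real) powr s = 2 powr (s * i) * 2 powr (s * i)"
            unfolding pow2 power2_eq_square powr_add[symmetric] powr_powr by (simp add: algebra_simps)
          thus ?thesis using a by (simp add: powr_mult power2_eq_square)
        qed
        thus ?thesis by (simp add: real_sqrt_divide real_sqrt_mult powr_minus_divide)
      qed
      also have "C * sqrt (real (2 ^ i)) * (sqrt Q / sqrt (a powr s) * 2 powr (- s * i)) =
          C / sqrt (a powr s) * sqrt Q * (sqrt (real (2 ^ i)) * 2 powr (- s * i))"
        by simp
      also have "sqrt (real (2 ^ i)) * 2 powr (- s * i) = r ^ i"
      proof -
        have "sqrt (real (2 ^ i)) = (2 powr real i) powr (1 / 2)"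
          using pow2 by (simp add: powr_half_sqrt)
        also have "\<dots> = 2 powr (real i / 2)" unfolding powr_powr by simp
        finally have "sqrt (real (2 ^ i)) * 2 powr (- s * i) = 2 powr (real i / 2 + - s * i)"
          by (simp only: powr_add)
        also have "real i / 2 + - s * i = - \<epsilon> * real i" by (simp add: s_def algebra_simps)
        also have "2 powr (- \<epsilon> * real i) = r powr real i" by (simp only: r_def powr_powr)
        also have "\<dots> = r ^ i" using r(1) by (rule powr_realpow)
        finally show ?thesis .
      qed
      finally show ?thesis using C(1) by (simp add: B_def mult_left_mono)
    qed
    have "(\<Sum>n\<in>S. cscale M (c n) (e n)) = (\<Sum>i\<in>j ` S. \<Sum>n | n \<in> S \<and> j n = i. cscale M (c n) (e n))"
      by (rule sum.image_gen[OF S(1)])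
    hence "p (\<Sum>n\<in>S. cscale M (c n) (e n)) \<le> (\<Sum>i\<in>j ` S. p (\<Sum>n | n \<in> S \<and> j n = i. cscale M (c n) (e n)))"
      using p_sum by simp
    also have "\<dots> \<le> (\<Sum>i\<in>j ` S. C / sqrt (a powr s) * sqrt Q * r ^ i)"
      by (intro sum_mono block)
    also have "\<dots> = C / sqrt (a powr s) * sqrt Q * (\<Sum>i\<in>j ` S. r ^ i)"
      by (simp add: sum_distrib_left)
    also have "\<dots> \<le> C / sqrt (a powr s) * sqrt Q * (1 / (1 - r))"
    proof (rule mult_left_mono)
      have "(\<Sum>i\<in>j ` S. r ^ i) \<le> (\<Sum>i. r ^ i)"
        using S(1) r by (intro sum_le_suminf summable_geometric) auto
      also have "\<dots> = 1 / (1 - r)" using r by (intro suminf_geometric) simp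
      finally show "(\<Sum>i\<in>j ` S. r ^ i) \<le> 1 / (1 - r)" .
      have "Q \<ge> 0" unfolding Q_def by (intro sum_nonneg) (simp add: W_def)
      thus "0 \<le> C / sqrt (a powr s) * sqrt Q" using C(1) by simp
    qed
    finally show "p (\<Sum>n\<in>S. cscale M (c n) (e n)) \<le> C / sqrt (a powr s) / (1 - r) *
        sqrt (\<Sum>n\<in>S. (1 + (of_int n * y)\<^sup>2) powr (1 / 2 + \<epsilon>) * (cmod (c n))\<^sup>2)"
      by (simp add: Q_def W_def s_def mult_ac)
  qed
qed

lemma sobolev_bound:
  assumes \<epsilon>: "\<epsilon> > 0" and y: "y \<noteq> 0"
  shows "\<exists>C>0. \<forall>v. p v \<le> C * sobolev_norm M (y *\<^sub>R mat_J) q (1 / 2 + \<epsilon>) v"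
proof -
  obtain l where l: "l \<in> spec_K M" and "\<forall>\<sigma>\<in>{1, -1}. \<sigma> * l \<le> 2 \<or> ladder (- \<sigma>) (e l) = 0"
    by (rule minimal_K_type)
  hence L: "\<sigma> * l \<le> 2 \<or> ladder (- \<sigma>) (e l) = 0" if "\<sigma> = 1 \<or> \<sigma> = -1" for \<sigma> using that by blast
  define w where "w n = (1 + (real_of_int n * y)\<^sup>2) powr (1 / 2 + \<epsilon>)" for n
  have ex: "\<exists>C>0. \<forall>S c. finite S \<and> S \<subseteq> spec_K M \<and> (\<forall>n\<in>S. \<exists>m. n = l + 2 * \<sigma> * int m) \<longrightarrow>
      p (\<Sum>n\<in>S. cscale M (c n) (e n)) \<le> C * sqrt (\<Sum>n\<in>S. w n * (cmod (c n))\<^sup>2)" if "\<sigma> = 1 \<or> \<sigma> = -1" for \<sigma>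
    unfolding w_def by (rule one_sided_bound[OF that l L[OF that] \<epsilon> y])
  obtain C1 where C1: "C1 > 0" "\<forall>S c. finite S \<and> S \<subseteq> spec_K M \<and> (\<forall>n\<in>S. \<exists>m. n = l + 2 * 1 * int m) \<longrightarrow>
      p (\<Sum>n\<in>S. cscale M (c n) (e n)) \<le> C1 * sqrt (\<Sum>n\<in>S. w n * (cmod (c n))\<^sup>2)"
    using ex[of 1, OF disjI1[OF refl]] by (elim exE conjE)
  obtain C2 where C2: "C2 > 0" "\<forall>S c. finite S \<and> S \<subseteq> spec_K M \<and> (\<forall>n\<in>S. \<exists>m. n = l + 2 * (-1) * int m) \<longrightarrow>
      p (\<Sum>n\<in>S. cscale M (c n) (e n)) \<le> C2 * sqrt (\<Sum>n\<in>S. w n * (cmod (c n))\<^sup>2)"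
    using ex[of "-1", OF disjI2[OF refl]] by (elim exE conjE)
  have "p v \<le> (C1 + C2) * sobolev_norm M (y *\<^sub>R mat_J) q (1 / 2 + \<epsilon>) v" for v
  proof -
    obtain S where S: "finite S" "S \<subseteq> spec_K M" "\<forall>n\<in>spec_K M - S. coord n v = 0"
        "v = (\<Sum>n\<in>S. cscale M (coord n v) (e n))"
      by (rule coord_expansion)
    \<comment> \<open>The type \<open>l\<close> belongs to both directions; it is counted in
      \<open>S1\<close> only.\<close>
    define S1 S2 where "S1 = {n \<in> S. \<exists>m. n = l + 2 * 1 * int m}" and "S2 = S - S1"
    have S2: "\<exists>m. n = l + 2 * (-1) * int m" if n: "n \<in> S2" for n
    proof -
      have "n \<in> spec_K M" "n \<in> S" "n \<notin> S1" using n S(2) by (auto simp: S2_def)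
      obtain \<sigma> m where \<sigma>: "\<sigma> = 1 \<or> \<sigma> = -1" and m: "n = l + 2 * \<sigma> * int m"
        by (rule spec_tower[OF l \<open>n \<in> spec_K M\<close>])
      have "\<sigma> \<noteq> 1"
      proof
        assume "\<sigma> = 1"
        from m[unfolded this] have "n \<in> S1" unfolding S1_def using \<open>n \<in> S\<close> by blast
        with \<open>n \<notin> S1\<close> show False ..
      qed
      hence "\<sigma> = -1" using \<sigma> by simp
      from m[unfolded this] show ?thesis ..
    qed
    define Q where "Q = (\<Sum>n\<in>S. w n * (cmod (coord n v))\<^sup>2)"
    have Q: "sqrt (\<Sum>n\<in>T. w n * (cmod (coord n v))\<^sup>2) \<le> sqrt Q" if "T \<subseteq> S" for T
      unfolding Q_def using S(1) that by (intro real_sqrt_le_mono sum_mono2) (auto simp: w_def)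
    have "S1 \<subseteq> S" by (auto simp: S1_def)
    hence v: "(\<Sum>n\<in>S. cscale M (coord n v) (e n)) =
        (\<Sum>n\<in>S2. cscale M (coord n v) (e n)) + (\<Sum>n\<in>S1. cscale M (coord n v) (e n))"
      unfolding S2_def using S(1) by (rule sum.subset_diff)
    have "p v = p (\<Sum>n\<in>S. cscale M (coord n v) (e n))" by (rule arg_cong[OF S(4)])
    also have "\<dots> \<le> p (\<Sum>n\<in>S1. cscale M (coord n v) (e n)) + p (\<Sum>n\<in>S2. cscale M (coord n v) (e n))"
      unfolding v by (subst add.commute[of "p _"]) (rule p_triangle)
    also have "\<dots> \<le> C1 * sqrt (\<Sum>n\<in>S1. w n * (cmod (coord n v))\<^sup>2) + C2 * sqrt (\<Sum>n\<in>S2. w n * (cmod (coord n v))\<^sup>2)"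
    proof (rule add_mono)
      have "finite S1 \<and> S1 \<subseteq> spec_K M \<and> (\<forall>n\<in>S1. \<exists>m. n = l + 2 * 1 * int m)"
        using S(1,2) unfolding S1_def by auto
      thus "p (\<Sum>n\<in>S1. cscale M (coord n v) (e n)) \<le> C1 * sqrt (\<Sum>n\<in>S1. w n * (cmod (coord n v))\<^sup>2)"
        by (rule C1(2)[rule_format])
      have "finite S2 \<and> S2 \<subseteq> spec_K M \<and> (\<forall>n\<in>S2. \<exists>m. n = l + 2 * (-1) * int m)"
        using S(1,2) S2 unfolding S2_def by auto
      thus "p (\<Sum>n\<in>S2. cscale M (coord n v) (e n)) \<le> C2 * sqrt (\<Sum>n\<in>S2. w n * (cmod (coord n v))\<^sup>2)"
        by (rule C2(2)[rule_format])
    qed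
    also have "\<dots> \<le> C1 * sqrt Q + C2 * sqrt Q"
      using C1(1) C2(1) by (intro add_mono mult_left_mono Q) (auto simp: S1_def S2_def)
    also have "sqrt Q = sobolev_norm M (y *\<^sub>R mat_J) q (1 / 2 + \<epsilon>) v"
      unfolding sobolev_norm_eq[OF S(1-3)] Q_def w_def ..
    finally show ?thesis by (simp add: distrib_right)
  qed
  thus ?thesis using C1(1) C2(1) by (intro exI[of _ "C1 + C2"]) auto
qed

text \<open>A single type is a block of its own, with \<open>N = m + 1\<close>. As there is no
  summation over blocks, the exponent 1/2 is reached without loss.\<close>

lemma e_bound: "\<exists>C>0. \<forall>n\<in>spec_K M. p (e n) \<le> C * (1 + \<bar>real_of_int n\<bar>) powr (1 / 2)"
proof -
  obtain l where l: "l \<in> spec_K M" and "\<forall>\<sigma>\<in>{1, -1}. \<sigma> * l \<le> 2 \<or> ladder (- \<sigma>) (e l) = 0"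
    by (rule minimal_K_type)
  hence L: "\<sigma> * l \<le> 2 \<or> ladder (- \<sigma>) (e l) = 0" if "\<sigma> = 1 \<or> \<sigma> = -1" for \<sigma> using that by blast
  have one_side: "\<exists>C>0. \<forall>n\<in>spec_K M. \<forall>m. n = l + 2 * \<sigma> * int m \<longrightarrow> p (e n) \<le> C * sqrt (1 + \<bar>real_of_int n\<bar>)"
    if \<sigma>: "\<sigma> = 1 \<or> \<sigma> = -1" for \<sigma>
  proof -
    obtain C where C: "C > 0" "block_constant l \<sigma> C"
      using block_bound[OF \<sigma> l L[OF \<sigma>]] by (elim exE conjE)
    show ?thesis
    proof (rule exI[of _ "C * sqrt (1 + real_of_int \<bar>l\<bar>)"], intro conjI ballI allI impI)
      show "C * sqrt (1 + real_of_int \<bar>l\<bar>) > 0" using C(1) by (simp add: add_pos_nonneg)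
      fix n m assume n: "n \<in> spec_K M" and m: "n = l + 2 * \<sigma> * int m"
      have "1 \<le> m + 1 \<and> finite {n} \<and> {n} \<subseteq> spec_K M \<and>
        (\<forall>n\<in>{n}. \<exists>m'. n = l + 2 * \<sigma> * int m' \<and> m + 1 \<le> m' + 1 \<and> m' + 1 \<le> 2 * (m + 1))"
        using n m by auto
      hence "p (\<Sum>n\<in>{n}. cscale M 1 (e n)) \<le> C * sqrt (real (m + 1)) * sqrt (\<Sum>n\<in>{n}. (cmod 1)\<^sup>2)"
        by (rule C(2)[unfolded block_constant_def, rule_format])
      hence "p (e n) \<le> C * sqrt (real (m + 1))" by simp
      also have "real (m + 1) \<le> (1 + real_of_int \<bar>l\<bar>) * (1 + \<bar>real_of_int n\<bar>)"
        using ladder_index_bound[OF \<sigma> m] by simp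
      finally show "p (e n) \<le> C * sqrt (1 + real_of_int \<bar>l\<bar>) * sqrt (1 + \<bar>real_of_int n\<bar>)"
        using C(1) by (simp add: real_sqrt_mult mult.assoc)
    qed
  qed
  obtain C1 where C1: "C1 > 0" "\<forall>n\<in>spec_K M. \<forall>m. n = l + 2 * 1 * int m \<longrightarrow> p (e n) \<le> C1 * sqrt (1 + \<bar>real_of_int n\<bar>)"
    using one_side[of 1, OF disjI1[OF refl]] by (elim exE conjE)
  obtain C2 where C2: "C2 > 0" "\<forall>n\<in>spec_K M. \<forall>m. n = l + 2 * (-1) * int m \<longrightarrow> p (e n) \<le> C2 * sqrt (1 + \<bar>real_of_int n\<bar>)"
    using one_side[of "-1", OF disjI2[OF refl]] by (elim exE conjE)
  have "p (e n) \<le> (C1 + C2) * (1 + \<bar>real_of_int n\<bar>) powr (1 / 2)" if n: "n \<in> spec_K M" for n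
  proof -
    obtain \<sigma> m where \<sigma>: "\<sigma> = 1 \<or> \<sigma> = -1" and m: "n = l + 2 * \<sigma> * int m" by (rule spec_tower[OF l n])
    from \<sigma> have "p (e n) \<le> C1 * sqrt (1 + \<bar>real_of_int n\<bar>) \<or> p (e n) \<le> C2 * sqrt (1 + \<bar>real_of_int n\<bar>)"
    proof
      assume "\<sigma> = 1"
      with C1(2)[rule_format, OF n m[unfolded this]] show ?thesis by simp
    next
      assume "\<sigma> = -1"
      with C2(2)[rule_format, OF n m[unfolded this]] show ?thesis by simp
    qed
    moreover have "0 \<le> C1 * sqrt (1 + \<bar>real_of_int n\<bar>)" "0 \<le> C2 * sqrt (1 + \<bar>real_of_int n\<bar>)"
      using C1(1) C2(1) by simp_all
    ultimately have "p (e n) \<le> (C1 + C2) * sqrt (1 + \<bar>real_of_int n\<bar>)"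
      unfolding distrib_right by linarith
    thus ?thesis by (simp add: powr_half_sqrt)
  qed
  thus ?thesis using C1(1) C2(1) by (intro exI[of _ "C1 + C2"]) auto
qed

end

theorem corollary5:
  fixes M :: "'v::ab_group_add gK"
    and p q :: "'v \<Rightarrow> real"
    and e :: "int \<Rightarrow> 'v"
    and Y :: "real^2^2"
    and c \<epsilon> :: real
  assumes "harish_chandra_module M"
    and "gK_irreducible M"
    and "unitarizable M"
    and "unitary_norm M q"
    and "\<forall>n\<in>spec_K M. module.span (cscale M) {e n} = K_type M n \<and> q (e n) = 1"
    and "Y \<in> so2" and "c > 0" and "- c * killing_form Y Y = 1"
    and "isometric_G_continuous_norm M p"
    and "\<epsilon> > 0"
  shows "(\<exists>C\<^sub>\<epsilon>>0. \<forall>v. p v \<le> C\<^sub>\<epsilon> * sobolev_norm M Y q (1 / 2 + \<epsilon>) v) \<and>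
         (\<exists>C>0. \<forall>n\<in>spec_K M. p (e n) \<le> C * (1 + \<bar>real_of_int n\<bar>) powr (1 / 2))"
proof -
  interpret gK_module M using assms(1) by (rule harish_chandra_module.axioms(1))
  have q_norm: "is_norm M q"
    by (rule assms(4)[unfolded unitary_norm_def G_continuous_norm_def, THEN conjunct1, THEN conjunct1])
  have p_norm: "is_norm M p"
    by (rule assms(9)[unfolded isometric_G_continuous_norm_def G_continuous_norm_def, THEN conjunct1, THEN conjunct1])
  interpret Q: normed_module M q by unfold_locales (rule q_norm)
  interpret P: normed_module M p by unfold_locales (rule p_norm)
  obtain \<rho> h where \<rho>: "globalization M q \<rho>" and h: "inducing_inner_product M q h"
    and inv: "\<forall>g\<in>SL2. \<forall>x\<in>banach_completion q. \<forall>y\<in>banach_completion q. h (\<rho> g x) (\<rho> g y) = h x y"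
    using assms(4)[unfolded unitary_norm_def, THEN conjunct2] by (elim exE conjE)
  have h_add: "h (compl_add q x y) z = h x z + h y z"
    if "x \<in> banach_completion q" "y \<in> banach_completion q" "z \<in> banach_completion q" for x y z
    by (rule h[unfolded inducing_inner_product_def, THEN conjunct1, rule_format, OF that])
  have h_scale: "h (compl_scale M q a x) y = a * h x y"
    if "x \<in> banach_completion q" "y \<in> banach_completion q" for a x y
    by (rule h[unfolded inducing_inner_product_def, THEN conjunct2, THEN conjunct1, rule_format, OF that])
  have h_cnj: "h y x = cnj (h x y)" if "x \<in> banach_completion q" "y \<in> banach_completion q" for x y
    by (rule h[unfolded inducing_inner_product_def, THEN conjunct2, THEN conjunct2, THEN conjunct1, rule_format, OF that])
  have h_norm: "h x x = complex_of_real ((compl_norm q x)\<^sup>2)" if "x \<in> banach_completion q" for x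
    by (rule h[unfolded inducing_inner_product_def, THEN conjunct2, THEN conjunct2, THEN conjunct2, rule_format, OF that])
  have \<rho>_in: "\<rho> g x \<in> banach_completion q" if "g \<in> SL2" "x \<in> banach_completion q" for g x
    by (rule \<rho>[unfolded globalization_def continuous_rep_def, THEN conjunct1, THEN conjunct1, rule_format, OF that])
  \<comment> \<open>Invariance of \<open>h\<close> on the diagonal makes \<open>q\<close> isometric,
    which brings \<open>q\<close> under the same framework as \<open>p\<close>.\<close>
  have iso: "compl_norm q (\<rho> g (to_completion q v)) = q v" if g: "g \<in> SL2" for g v
  proof -
    have x: "\<rho> g (to_completion q v) \<in> banach_completion q" by (rule \<rho>_in[OF g Q.to_completion_in])
    have "h (\<rho> g (to_completion q v)) (\<rho> g (to_completion q v)) = h (to_completion q v) (to_completion q v)"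
      by (rule inv[rule_format, OF g Q.to_completion_in Q.to_completion_in])
    hence "complex_of_real ((compl_norm q (\<rho> g (to_completion q v)))\<^sup>2) = of_real ((q v)\<^sup>2)"
      unfolding h_norm[OF x] h_norm[OF Q.to_completion_in] Q.compl_norm_to_completion .
    hence "(compl_norm q (\<rho> g (to_completion q v)))\<^sup>2 = (q v)\<^sup>2" unfolding of_real_eq_iff .
    thus ?thesis by (rule power2_eq_imp_eq) (simp_all add: Q.compl_norm_nonneg[OF x])
  qed
  interpret QI: isometric_globalization M q \<rho> by unfold_locales (fact \<rho> iso)+
  \<comment> \<open>The invariant inner product restricted from the completion to
    \<open>V\<close>.\<close>
  define b where "b v w = h (to_completion q v) (to_completion q w)" for v w
  have b_add: "b (u + v) w = b u w + b v w" for u v w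
    unfolding b_def Q.to_completion_add by (rule h_add) (rule Q.to_completion_in)+
  have b_scale: "b (cscale M a v) w = a * b v w" for a v w
    unfolding b_def Q.to_completion_scale by (rule h_scale) (rule Q.to_completion_in)+
  have b_cnj: "b w v = cnj (b v w)" for v w
    unfolding b_def by (rule h_cnj) (rule Q.to_completion_in)+
  have b_norm: "b v v = complex_of_real ((q v)\<^sup>2)" for v
    unfolding b_def h_norm[OF Q.to_completion_in] Q.compl_norm_to_completion ..
  have b_K: "b (K_act M k v) (K_act M k w) = b v w" if k: "k \<in> SO2" for k v w
    unfolding b_def QI.rep_K[OF k, symmetric]
    by (rule inv[rule_format, OF subsetD[OF SO2_subset_SL2 k] Q.to_completion_in Q.to_completion_in])
  have b_skew: "b (lie_act M X v) w = - b v (lie_act M X w)" if X: "X \<in> {mat_H, mat_S}" for X v w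
  proof (rule QI.isometric_imp_skew[OF b_add b_scale b_cnj b_norm])
    show X': "X \<in> sl2" using X J_H_S_in_sl2 by auto
    show "mexp (t *\<^sub>R X) \<in> SL2" for t using X mexp_in_SL2[of X t] by auto
    show "lie_act M X (v + w) = lie_act M X v + lie_act M X w" for v w by (rule lie_plus[OF X'])
    show "lie_act M X (cscale M a v) = cscale M a (lie_act M X v)" for a v by (rule lie_scale[OF X'])
  qed
  obtain \<pi> where \<pi>: "globalization M p \<pi>" "\<forall>g\<in>SL2. \<forall>v. compl_norm p (\<pi> g (to_completion p v)) = p v"
    using assms(9)[unfolded isometric_G_continuous_norm_def, THEN conjunct2] by (elim exE conjE)
  interpret unitary_isometric M b q e p \<pi>
  proof (unfold_locales; (fact q_norm b_add b_scale b_cnj b_norm b_K b_skew assms(2) \<pi>(1))?)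
    show "compl_norm p (\<pi> g (to_completion p v)) = p v" if "g \<in> SL2" for g v
      using \<pi>(2) that by blast
    show "module.span (cscale M) {e n} = K_type M n" "q (e n) = 1" if "n \<in> spec_K M" for n
      using assms(5) that by blast+
  qed
  obtain y where Y: "Y = y *\<^sub>R mat_J" using assms(6) by (rule so2_decomposition)
  \<comment> \<open>The normalization of \<open>Y\<close> reads
    \<open>8 * c * y\<^sup>2 = 1\<close>.\<close>
  have "y \<noteq> 0" using assms(8) by (auto simp: Y killing_form_so2)
  thus ?thesis using sobolev_bound[OF assms(10), of y] e_bound unfolding Y by blast
qed

end
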